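(* Let $f\in L^2(\Omega)$ and let $u\in H^2_0(\Omega)$ be the solution of $a(u,v)=(f,v)_{L^2(\Omega)}$ for all $v\in H^2_0(\Omega)$. Suppose that $u\in H^4(\Omega)$. Then for all $w_h\in V_h$ (the two-dimensional rectangular Morley element space), $$a_h(u,w_h)-(f,w_h)_{L^2(\Omega)}\le Ch^2\big(\|f\|_{L^2(\Omega)}+|u|_{H^4(\Omega)}\big)|w_h|_h,$$ where $C>0$ is a constant independent of the meshsize $h$, of $f$, $u$ and $w_h$.
   Context: $\Omega\subset\mathbb{R}^2$ is a bounded Lipschitz domain and $\mathcal{T}_h$ is a uniform partition of $\Omega$ into axis-parallel squares $K$; each $K$ with center $(x_{1,c},x_{2,c})$ is mapped to $[-1,1]^2$ by $\xi_i=(x_i-x_{i,c})/h$, $i=1,2$ (so $K$ has side length $2h$). Continuous form: $a(u,v)=(\nabla^2u,\nabla^2v)_{L^2(\Omega)}$, with $\nabla^2$ the Hessian matrix (weak form of $\Delta^2u=f$ in $\Omega$, $u=\partial u/\partial n=0$ on $\partial\Omega$). Rectangular Morley space: $P(K)=P_2(K)+\mathrm{span}\{x_1^3,x_2^3\}$, where $P_l(K)$ denotes polynomials of total degree $\le l$ on $K$. $V_h$ is the set of $v\in L^2(\Omega)$ with $v|_K\in P(K)$ for all $K\in\mathcal{T}_h$, such that $v$ is continuous at all internal vertices and vanishes at all boundary vertices of $\mathcal{T}_h$, and $\int_e\frac{\partial v}{\partial n_e}\,ds$ is continuous across each internal edge $e$ and vanishes on each boundary edge $e$. Discrete form: $a_h(v,w)=\sum_{K\in\mathcal{T}_h}\int_K\nabla^2v:\nabla^2w\,dx$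 (Hessian element by element) and $|v|_h^2=a_h(v,v)$ for piecewise $H^2$ functions. *)

theory Defs
  imports "HOL-Analysis.Analysis"
begin

section \<open>Domains\<close>

definition lipschitz_domain :: "(real^2) set \<Rightarrow> bool" where
  "lipschitz_domain \<Omega> \<longleftrightarrow> open \<Omega> \<and> connected \<Omega> \<and> \<Omega> \<noteq> {} \<and>
    (\<forall>p\<in>frontier \<Omega>. \<exists>r>0. \<exists>Q \<gamma> L.
       orthogonal_transformation (Q :: real^2 \<Rightarrow> real^2) \<and>
       L-lipschitz_on UNIV (\<gamma> :: real \<Rightarrow> real) \<and>
       \<Omega> \<inter> ball p r = {x \<in> ball p r. \<gamma> (Q x $ 1) < Q x $ 2})"

section \<open>Sobolev spaces\<close>

text \<open>Elements of $L^2$ and of the Sobolev spaces are represented by real functions on the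
  whole plane. Only their values almost everywhere on the set in question matter.\<close>

definition L2 :: "(real^2) set \<Rightarrow> (real^2 \<Rightarrow> real) \<Rightarrow> bool" where
  "L2 U f \<longleftrightarrow> f \<in> borel_measurable (lebesgue_on U) \<and>
     integrable (lebesgue_on U) (\<lambda>x. (f x)\<^sup>2)"

definition L2_inner :: "(real^2) set \<Rightarrow> (real^2 \<Rightarrow> real) \<Rightarrow> (real^2 \<Rightarrow> real) \<Rightarrow> real" where
  "L2_inner U f g = (LINT x|lebesgue_on U. f x * g x)"

definition L2_norm :: "(real^2) set \<Rightarrow> (real^2 \<Rightarrow> real) \<Rightarrow> real" where
  "L2_norm U f = sqrt (L2_inner U f f)"

definition partial_deriv :: "2 \<Rightarrow> (real^2 \<Rightarrow> real) \<Rightarrow> real^2 \<Rightarrow> real" where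
  "partial_deriv i \<phi> x = frechet_derivative \<phi> (at x) (axis i 1)"

definition smooth :: "(real^2 \<Rightarrow> real) \<Rightarrow> bool" where
  "smooth \<phi> \<longleftrightarrow> (\<forall>is. foldr partial_deriv is \<phi> differentiable_on UNIV)"

definition test_functions :: "(real^2) set \<Rightarrow> (real^2 \<Rightarrow> real) set" where
  "test_functions U = {\<phi>. smooth \<phi> \<and>
     compact (closure {x. \<phi> x \<noteq> 0}) \<and> closure {x. \<phi> x \<noteq> 0} \<subseteq> U}"

definition multi_order :: "nat^2 \<Rightarrow> nat" where
  "multi_order \<alpha> = \<alpha> $ 1 + \<alpha> $ 2"

definition classical_deriv :: "nat^2 \<Rightarrow> (real^2 \<Rightarrow> real) \<Rightarrow> real^2 \<Rightarrow> real" where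
  "classical_deriv \<alpha> \<phi> = (partial_deriv 1 ^^ (\<alpha> $ 1)) ((partial_deriv 2 ^^ (\<alpha> $ 2)) \<phi>)"

definition locally_integrable :: "(real^2) set \<Rightarrow> (real^2 \<Rightarrow> real) \<Rightarrow> bool" where
  "locally_integrable U f \<longleftrightarrow> (\<forall>C. compact C \<and> C \<subseteq> U \<longrightarrow> f absolutely_integrable_on C)"

definition has_weak_deriv ::
  "(real^2) set \<Rightarrow> nat^2 \<Rightarrow> (real^2 \<Rightarrow> real) \<Rightarrow> (real^2 \<Rightarrow> real) \<Rightarrow> bool" where
  "has_weak_deriv U \<alpha> f g \<longleftrightarrow> locally_integrable U f \<and> locally_integrable U g \<and>
     (\<forall>\<phi>\<in>test_functions U.
        (LINT x|lebesgue_on U. f x * classical_deriv \<alpha> \<phi> x) =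
        (-1) ^ multi_order \<alpha> * (LINT x|lebesgue_on U. g x * \<phi> x))"

text \<open>On an open set the weak derivative is unique up to a null set, so that integrals of
  expressions in it do not depend on the choice made here.\<close>

definition weak_deriv ::
  "(real^2) set \<Rightarrow> nat^2 \<Rightarrow> (real^2 \<Rightarrow> real) \<Rightarrow> real^2 \<Rightarrow> real" where
  "weak_deriv U \<alpha> f = (SOME g. has_weak_deriv U \<alpha> f g)"

definition sobolev :: "nat \<Rightarrow> (real^2) set \<Rightarrow> (real^2 \<Rightarrow> real) set" where
  "sobolev m U = {v. L2 U v \<and>
     (\<forall>\<alpha>. multi_order \<alpha> \<le> m \<longrightarrow> (\<exists>g. L2 U g \<and> has_weak_deriv U \<alpha> v g))}"

definition sobolev_norm :: "nat \<Rightarrow> (real^2) set \<Rightarrow> (real^2 \<Rightarrow> real) \<Rightarrow> real" where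
  "sobolev_norm m U v = sqrt (\<Sum>\<alpha> | multi_order \<alpha> \<le> m. (L2_norm U (weak_deriv U \<alpha> v))\<^sup>2)"

definition sobolev_seminorm :: "nat \<Rightarrow> (real^2) set \<Rightarrow> (real^2 \<Rightarrow> real) \<Rightarrow> real" where
  "sobolev_seminorm m U v = sqrt (\<Sum>\<alpha> | multi_order \<alpha> = m. (L2_norm U (weak_deriv U \<alpha> v))\<^sup>2)"

definition sobolev0 :: "nat \<Rightarrow> (real^2) set \<Rightarrow> (real^2 \<Rightarrow> real) set" where
  "sobolev0 m U = {v \<in> sobolev m U. \<exists>\<phi>. (\<forall>n. \<phi> n \<in> test_functions U) \<and>
     (\<lambda>n::nat. sobolev_norm m U (\<lambda>x. v x - \<phi> n x)) \<longlonglongrightarrow> 0}"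

section \<open>The continuous bilinear form\<close>

definition hessian :: "(real^2) set \<Rightarrow> (real^2 \<Rightarrow> real) \<Rightarrow> real^2 \<Rightarrow> real^2^2" where
  "hessian U v x = (\<chi> i j. weak_deriv U (axis i 1 + axis j 1) v x)"

text \<open>The inner product on \<^typ>\<open>real^2^2\<close> is the Frobenius product of matrices.\<close>

definition a_form :: "(real^2) set \<Rightarrow> (real^2 \<Rightarrow> real) \<Rightarrow> (real^2 \<Rightarrow> real) \<Rightarrow> real" where
  "a_form U v w = (LINT x|lebesgue_on U. hessian U v x \<bullet> hessian U w x)"

section \<open>Uniform partitions into squares\<close>

definition square :: "real \<Rightarrow> real^2 \<Rightarrow> (real^2) set" where
  "square h c = cbox (c - (\<chi> i. h)) (c + (\<chi> i. h))"

definition uniform_partition :: "(real^2) set \<Rightarrow> real \<Rightarrow> (real^2) set set \<Rightarrow> bool" where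
  "uniform_partition \<Omega> h T \<longleftrightarrow> h > 0 \<and> finite T \<and> (\<forall>K\<in>T. \<exists>c. K = square h c) \<and>
     \<Union>T = closure \<Omega> \<and>
     (\<forall>K\<in>T. \<forall>K'\<in>T. K \<inter> K' face_of K \<and> K \<inter> K' face_of K')"

section \<open>The rectangular Morley space\<close>

definition polys :: "nat \<Rightarrow> (real^2 \<Rightarrow> real) set" where
  "polys l = {p. \<exists>c. \<forall>x. p x = (\<Sum>(i,j)\<in>{(i,j). i + j \<le> l}. c i j * (x $ 1) ^ i * (x $ 2) ^ j)}"

definition morley_polys :: "(real^2 \<Rightarrow> real) set" where
  "morley_polys = {p. \<exists>q\<in>polys 2. \<exists>a b. \<forall>x. p x = q x + a * (x $ 1) ^ 3 + b * (x $ 2) ^ 3}"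

text \<open>The integral of the derivative of \<open>p\<close> in direction \<open>n\<close> over the segment from \<open>a\<close> to
  \<open>b\<close>, with respect to arc length.\<close>

definition edge_flux :: "real^2 \<Rightarrow> real^2 \<Rightarrow> real^2 \<Rightarrow> (real^2 \<Rightarrow> real) \<Rightarrow> real" where
  "edge_flux a b n p = norm (b - a) *
     integral {0..1} (\<lambda>t. frechet_derivative p (at (a + t *\<^sub>R (b - a))) n)"

definition unit_normal :: "real^2 \<Rightarrow> real^2 \<Rightarrow> real^2 \<Rightarrow> bool" where
  "unit_normal a b n \<longleftrightarrow> norm n = 1 \<and> n \<bullet> (b - a) = 0"

text \<open>The polynomial \<open>p K\<close> is the restriction of \<open>v\<close> to \<open>K\<close>. It supplies the one-sided
  values of \<open>v\<close> and of its normal derivative on the boundary of \<open>K\<close>, where the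
  representative \<open>v\<close> itself carries no information. Vertices of a square are its extreme
  points. An edge is internal if it is not part of the boundary of the domain.\<close>

definition morley_space ::
  "(real^2) set \<Rightarrow> (real^2) set set \<Rightarrow> (real^2 \<Rightarrow> real) set" where
  "morley_space \<Omega> T = {v. L2 \<Omega> v \<and>
     (\<exists>p. (\<forall>K\<in>T. p K \<in> morley_polys \<and> (AE x in lebesgue_on K. v x = p K x)) \<and>
       (\<forall>K\<in>T. \<forall>K'\<in>T. \<forall>z. z extreme_point_of K \<and> z extreme_point_of K' \<and> z \<in> \<Omega> \<longrightarrow>
          p K z = p K' z) \<and>
       (\<forall>K\<in>T. \<forall>z. z extreme_point_of K \<and> z \<in> frontier \<Omega> \<longrightarrow> p K z = 0) \<and>
       (\<forall>K\<in>T. \<forall>K'\<in>T. \<forall>a b n. closed_segment a b edge_of K \<and> closed_segment a b edge_of K' \<and>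
          \<not> closed_segment a b \<subseteq> frontier \<Omega> \<and> unit_normal a b n \<longrightarrow>
          edge_flux a b n (p K) = edge_flux a b n (p K')) \<and>
       (\<forall>K\<in>T. \<forall>a b n. closed_segment a b edge_of K \<and>
          closed_segment a b \<subseteq> frontier \<Omega> \<and> unit_normal a b n \<longrightarrow>
          edge_flux a b n (p K) = 0))}"

section \<open>The discrete bilinear form\<close>

definition ah_form ::
  "(real^2) set set \<Rightarrow> (real^2 \<Rightarrow> real) \<Rightarrow> (real^2 \<Rightarrow> real) \<Rightarrow> real" where
  "ah_form T v w = (\<Sum>K\<in>T. a_form (interior K) v w)"

definition h_seminorm :: "(real^2) set set \<Rightarrow> (real^2 \<Rightarrow> real) \<Rightarrow> real" where
  "h_seminorm T v = sqrt (ah_form T v v)"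

end

theory Submission
  imports Defs "HOL-Computational_Algebra.Polynomial"
begin

text \<open>A Morley function \<open>w\<close> is compared with a smooth, compactly supported companion \<open>J w\<close>, a combination
  of products of one-dimensional functions attached to the interior vertices (values and gradients
  of \<open>w\<close>) and to the interior edges (mean normal derivatives). The companion is admissible in
  the weak equation, so no traces are needed, and the consistency error becomes the sum over the cells
  of the residual functional of \<open>u\<close> and \<open>f\<close> at \<open>w - J w\<close>. As vertex values and mean normal
  derivatives agree, the second derivatives of \<open>w - J w\<close> are on each cell orthogonal to the affine
  functions. A Bramble-Hilbert estimate then gains two powers of \<open>h\<close>; it is proved by duality,
  since a compactly supported function of one variable whose moments of order 0 and 1 vanish is a
  second derivative. The coefficients of \<open>w - J w\<close> on a cell are controlled by the second and third
  derivatives of \<open>w\<close> on the neighbouring cells. Extending \<open>w\<close> by zero to the infinite grid puts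
  boundary vertices and edges on the same footing as interior ones.\<close>

section \<open>Smooth functions of one variable\<close>

text \<open>Products of functions of one variable are used throughout because derivatives, supports
  and integrals then reduce to one variable, with a power of 1/h for each derivative. The count of
  powers is as follows. The moment conditions replace the pairing of a product with a second
  derivative of \<open>u\<close> by pairings with fourth derivatives, bounded by
  \<open>h ^ 3\<close> times their norms on the cell; the two derivatives on the product cost 1/h^2.
  A cell thus contributes h times its coefficients of order 2 and 3, and the energy of
  \<open>w\<close> on the cell is of the size of their squares divided by h^2, which gives the
  second h. The load needs no moment condition, since the pairing with \<open>f\<close> already
  carries the square root of the area. The energy sees no coefficient of order 0 or 1. The companion
  must therefore reproduce affine functions exactly on a cell when it is given their vertex values
  and gradients, and the gradients chosen at a vertex may differ from those of the cells around it
  only by coefficients of order 2 and 3. The first demand shapes the reference functions; the second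
  is met by comparing neighbouring cells.\<close>

primrec Ck :: "nat \<Rightarrow> (real \<Rightarrow> real) \<Rightarrow> bool" where
  "Ck 0 f = True"
| "Ck (Suc k) f = (\<exists>f'. (\<forall>x. (f has_real_derivative f' x) (at x)) \<and> Ck k f')"

text \<open>\<open>Ck\<close> asks for no continuity of the last derivative; demanded for all
  \<open>k\<close> at once this makes no difference and gives the infinitely differentiable
  functions.\<close>

definition smooth1 :: "(real \<Rightarrow> real) \<Rightarrow> bool" where
  "smooth1 f \<longleftrightarrow> (\<forall>k. Ck k f)"

lemma Ck_Suc_imp: "Ck (Suc k) f \<Longrightarrow> Ck k f"
  by (induction k arbitrary: f) (simp, metis Ck.simps(2))

lemma Ck_const: "Ck k (\<lambda>x. c)"
  by (induction k arbitrary: c) (auto intro!: exI[of _ "\<lambda>x. 0"] derivative_eq_intros)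

lemma Ck_add: "Ck k f \<Longrightarrow> Ck k g \<Longrightarrow> Ck k (\<lambda>x. f x + g x)"
proof (induction k arbitrary: f g)
  case (Suc k)
  then obtain f' g' where "\<And>x. (f has_real_derivative f' x) (at x)" "Ck k f'"
    "\<And>x. (g has_real_derivative g' x) (at x)" "Ck k g'" by auto
  with Suc.IH[of f' g'] show ?case
    by (auto intro!: exI[of _ "\<lambda>x. f' x + g' x"] derivative_eq_intros)
qed simp

lemma Ck_mult: "Ck k f \<Longrightarrow> Ck k g \<Longrightarrow> Ck k (\<lambda>x. f x * g x)"
proof (induction k arbitrary: f g)
  case (Suc k)
  then obtain f' g' where *: "\<And>x. (f has_real_derivative f' x) (at x)" "Ck k f'"
    "\<And>x. (g has_real_derivative g' x) (at x)" "Ck k g'" by auto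
  have "Ck k (\<lambda>x. f' x * g x)" "Ck k (\<lambda>x. f x * g' x)"
    using Suc * by (auto dest!: Ck_Suc_imp simp del: Ck.simps)
  then have "Ck k (\<lambda>x. f' x * g x + f x * g' x)" by (rule Ck_add)
  then show ?case using *
    by (auto intro!: exI[of _ "\<lambda>x. f' x * g x + f x * g' x"] derivative_eq_intros)
qed simp

lemma Ck_affine: "Ck k f \<Longrightarrow> Ck k (\<lambda>x. f (a * x + b))"
proof (induction k arbitrary: f)
  case (Suc k)
  then obtain f' where *: "\<And>x. (f has_real_derivative f' x) (at x)" "Ck k f'" by auto
  have "((\<lambda>x. f (a * x + b)) has_real_derivative f' (a * x + b) * a) (at x)" for x
    by (rule DERIV_chain2[OF *(1)]) (auto intro!: derivative_eq_intros)
  moreover have "Ck k (\<lambda>x. f' (a * x + b) * a)"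
    using Suc.IH[OF *(2)] by (intro Ck_mult Ck_const)
  ultimately show ?case by (auto intro!: exI[of _ "\<lambda>x. f' (a * x + b) * a"])
qed simp

lemma smooth1_const [simp, intro]: "smooth1 (\<lambda>x. c)"
  by (simp add: smooth1_def Ck_const)

lemma smooth1_add [intro]: "smooth1 f \<Longrightarrow> smooth1 g \<Longrightarrow> smooth1 (\<lambda>x. f x + g x)"
  by (simp add: smooth1_def Ck_add)

lemma smooth1_mult [intro]: "smooth1 f \<Longrightarrow> smooth1 g \<Longrightarrow> smooth1 (\<lambda>x. f x * g x)"
  by (simp add: smooth1_def Ck_mult)

lemma smooth1_minus [intro]: "smooth1 f \<Longrightarrow> smooth1 (\<lambda>x. - f x)"
  using smooth1_mult[of "\<lambda>x. -1" f] by simp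

lemma smooth1_diff [intro]: "smooth1 f \<Longrightarrow> smooth1 g \<Longrightarrow> smooth1 (\<lambda>x. f x - g x)"
  using smooth1_add[of f "\<lambda>x. - g x"] by auto

lemma smooth1_divide [intro]: "smooth1 f \<Longrightarrow> smooth1 (\<lambda>x. f x / c)"
  using smooth1_mult[of f "\<lambda>x. 1 / c"] by auto

lemma smooth1_affine: "smooth1 f \<Longrightarrow> smooth1 (\<lambda>x. f (a * x + b))"
  by (simp add: smooth1_def Ck_affine)

lemma smooth1_id [simp, intro]: "smooth1 (\<lambda>x. x)"
  unfolding smooth1_def
proof
  fix k show "Ck k (\<lambda>x. x)"
    by (cases k) (auto intro!: exI[of _ "\<lambda>x. 1"] derivative_eq_intros Ck_const)
qed

lemma smooth1_power [intro]: "smooth1 f \<Longrightarrow> smooth1 (\<lambda>x. f x ^ n)"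
  by (induction n) auto

lemma smooth1_DERIV: "smooth1 f \<Longrightarrow> (f has_real_derivative deriv f x) (at x)"
  unfolding smooth1_def using Ck.simps(2)[of 0 f] DERIV_imp_deriv by metis

lemma smooth1_deriv [intro]:
  assumes "smooth1 f" shows "smooth1 (deriv f)"
  unfolding smooth1_def
proof
  fix k
  obtain f' where f': "\<And>x. (f has_real_derivative f' x) (at x)" "Ck k f'"
    using assms unfolding smooth1_def by (metis Ck.simps(2))
  then have "deriv f = f'" using DERIV_imp_deriv by blast
  with f' show "Ck k (deriv f)" by simp
qed

lemma smooth1I_DERIV:
  assumes "\<And>x. (f has_real_derivative f' x) (at x)" "smooth1 f'"
  shows "smooth1 f"
  unfolding smooth1_def
proof
  fix k show "Ck k f"
    using assms by (cases k) (auto simp: smooth1_def)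
qed

lemma smooth1_funpow_deriv [intro]: "smooth1 f \<Longrightarrow> smooth1 ((deriv ^^ n) f)"
  by (induction n) auto

lemma smooth1_continuous_on: "smooth1 f \<Longrightarrow> continuous_on S f"
  by (meson DERIV_isCont continuous_at_imp_continuous_on smooth1_DERIV)

lemma smooth1_bounded: "smooth1 f \<Longrightarrow> \<exists>B\<ge>0. \<forall>x\<in>{a..b}. \<bar>f x\<bar> \<le> B"
proof -
  assume "smooth1 f"
  then have "compact (f ` {a..b})"
    by (intro compact_continuous_image smooth1_continuous_on) auto
  then obtain B where "\<And>x. x \<in> {a..b} \<Longrightarrow> \<bar>f x\<bar> \<le> B"
    unfolding compact_eq_bounded_closed bounded_iff real_norm_def by blast
  then show ?thesis by (intro exI[of _ "max B 0"]) (auto simp: le_max_iff_disj)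
qed

lemma smooth1_integral_deriv:
  assumes "smooth1 f" "a \<le> b"
  shows "(deriv f has_integral f b - f a) {a..b}"
  using assms smooth1_DERIV[OF assms(1)]
  by (intro fundamental_theorem_of_calculus)
     (auto simp: has_real_derivative_iff_has_vector_derivative intro: has_vector_derivative_at_within)

lemma deriv_zero_off:
  assumes "open U" "x \<in> U" "\<And>y. y \<in> U \<Longrightarrow> f y = (0::real)"
  shows "deriv f x = 0"
proof -
  have "(f has_real_derivative 0) (at x) \<longleftrightarrow> ((\<lambda>x. 0) has_real_derivative 0) (at x)"
    using assms by (intro DERIV_cong_ev) (auto simp: eventually_nhds)
  then show ?thesis by (auto intro: DERIV_imp_deriv)
qed

subsection \<open>A flat function, a bump and a step\<close>

text \<open>The functions p(1/x) exp(-1/x), extended by 0, form a class that is closed under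
  differentiation. Carrying the polynomial along lets one induction on the order prove
  smoothness.\<close>

definition flat :: "real poly \<Rightarrow> real \<Rightarrow> real" where
  "flat p x = (if x > 0 then poly p (1 / x) * exp (- (1 / x)) else 0)"

text \<open>This is the difference quotient of \<open>flat p\<close> at 0. With y = 1/x it becomes y
  p(y) / exp y, and \<open>pCons 0 p\<close> is the polynomial y p(y).\<close>

lemma flat_over_x_tendsto: "((\<lambda>x. flat p x / x) \<longlongrightarrow> 0) (at 0)"
proof -
  have "((\<lambda>y. poly (pCons 0 p) y / exp y) \<longlongrightarrow> 0) at_top"
  proof -
    have "((\<lambda>y. coeff (pCons 0 p) i * (y ^ i / exp y)) \<longlongrightarrow> 0) at_top" for i
      using tendsto_mult[OF tendsto_const tendsto_power_div_exp_0[of i], of "coeff (pCons 0 p) i"] by simp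
    then have "((\<lambda>y. \<Sum>i\<le>degree (pCons 0 p). coeff (pCons 0 p) i * (y ^ i / exp y)) \<longlongrightarrow> (\<Sum>i\<le>degree (pCons 0 p). 0)) at_top"
      by (intro tendsto_sum) auto
    then show ?thesis by (simp add: poly_altdef sum_divide_distrib)
  qed
  then have "((\<lambda>x. poly (pCons 0 p) (inverse x) / exp (inverse x)) \<longlongrightarrow> 0) (at_right 0)"
    by (rule filterlim_compose[OF _ filterlim_inverse_at_top_right])
  then have "((\<lambda>x. flat p x / x) \<longlongrightarrow> 0) (at_right 0)"
  proof (rule Lim_transform_eventually)
    show "\<forall>\<^sub>F x in at_right 0. poly (pCons 0 p) (inverse x) / exp (inverse x) = flat p x / x"
      using eventually_at_right_less[of 0]
      by eventually_elim (simp add: flat_def exp_minus field_simps)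
  qed
  moreover have "((\<lambda>x. flat p x / x) \<longlongrightarrow> 0) (at_left 0)"
  proof (rule Lim_transform_eventually[OF tendsto_const])
    show "\<forall>\<^sub>F x in at_left 0. 0 = flat p x / x"
      by (auto simp: flat_def eventually_at intro!: exI[of _ 1])
  qed
  ultimately show ?thesis by (simp add: filterlim_split_at)
qed

text \<open>For positive x the chain rule yields the factor 1/x^2, which is \<open>monom 1 2\<close>
  evaluated at 1/x; the exponential contributes \<open>p\<close> and the polynomial factor
  \<open>- pderiv p\<close>. At 0 the preceding limit is used.\<close>

lemma flat_DERIV: "(flat p has_real_derivative flat (monom 1 2 * (p - pderiv p)) x) (at x)"
proof -
  consider "x > 0" | "x = 0" | "x < 0" by linarith
  then show ?thesis
  proof cases
    case 1
    have "((\<lambda>x. poly p (1 / x) * exp (- (1 / x))) has_real_derivative flat (monom 1 2 * (p - pderiv p)) x) (at x)"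
      using 1 by (auto intro!: derivative_eq_intros DERIV_chain2[OF poly_DERIV]
          simp: flat_def poly_monom field_simps power2_eq_square)
    moreover have "\<forall>\<^sub>F y in nhds x. flat p y = poly p (1 / y) * exp (- (1 / y))"
      using 1 by (auto simp: flat_def eventually_nhds intro!: exI[of _ "{0<..}"])
    ultimately show ?thesis by (subst DERIV_cong_ev[OF refl _ refl])
  next
    case 2
    show ?thesis using flat_over_x_tendsto[of p] unfolding 2 DERIV_def
      by (simp add: flat_def)
  next
    case 3
    have "\<forall>\<^sub>F y in nhds x. flat p y = 0"
      using 3 by (auto simp: flat_def eventually_nhds intro!: exI[of _ "{..<0}"])
    then show ?thesis using 3
      by (subst DERIV_cong_ev[OF refl _ refl]) (auto simp: flat_def)
  qed
qed

lemma smooth1_flat: "smooth1 (flat p)"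
proof -
  have "Ck k (flat p)" for k
    by (induction k arbitrary: p) (auto intro: flat_DERIV exI)
  then show ?thesis by (simp add: smooth1_def)
qed

definition bump0 :: "real \<Rightarrow> real" where
  "bump0 x = flat 1 (1 * x + 1/2) * flat 1 (-1 * x + 1/2)"

text \<open>The support stays in [-1/2, 1/2], so the reference functions built from it are
  polynomial near the ends of [-1, 1]. The integral is 2, the length of the reference interval, so
  that \<open>bump\<close> has mean 1 along an edge.\<close>

definition bump :: "real \<Rightarrow> real" where
  "bump x = bump0 x * (2 / integral {-1..1} bump0)"

lemma smooth1_bump0: "smooth1 bump0"
  unfolding bump0_def[abs_def] by (intro smooth1_mult smooth1_affine smooth1_flat)

lemma bump0_nonneg: "bump0 x \<ge> 0"
  by (simp add: bump0_def flat_def)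

lemma integral_bump0_pos: "integral {-1..1} bump0 > 0"
proof -
  have c: "continuous_on (cbox (-1) 1) bump0" by (rule smooth1_continuous_on[OF smooth1_bump0])
  have "bump0 0 \<noteq> 0" by (simp add: bump0_def flat_def)
  then have "integral (cbox (-1) 1) bump0 \<noteq> 0"
    using integral_cbox_eq_0_iff[OF c] bump0_nonneg by fastforce
  moreover have "integral {-1..1} bump0 \<ge> 0"
    by (intro integral_nonneg integrable_continuous_interval smooth1_continuous_on smooth1_bump0 bump0_nonneg)
  ultimately show ?thesis by simp
qed

lemma smooth1_bump: "smooth1 bump"
  unfolding bump_def[abs_def] by (intro smooth1_mult smooth1_bump0 smooth1_const)

lemma bump_nonneg: "bump x \<ge> 0"
  using bump0_nonneg integral_bump0_pos by (simp add: bump_def less_imp_le)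

lemma bump_even: "bump (- x) = bump x"
  by (simp add: bump_def bump0_def algebra_simps)

lemma bump_zero: "\<bar>x\<bar> \<ge> 1/2 \<Longrightarrow> bump x = 0"
  by (auto simp: bump_def bump0_def flat_def)

lemma bump_integral: "(bump has_integral 2) {-1..1}"
proof -
  have "(bump0 has_integral integral {-1..1} bump0) {-1..1}"
    by (intro integrable_integral integrable_continuous_interval smooth1_continuous_on smooth1_bump0)
  from has_integral_mult_left[OF this, of "2 / integral {-1..1} bump0"] show ?thesis
    using integral_bump0_pos unfolding bump_def[abs_def] by simp
qed

definition step :: "real \<Rightarrow> real" where
  "step x = integral {-1..x} bump / 2"

lemma step_eq_0: "x \<le> -1/2 \<Longrightarrow> step x = 0"
  unfolding step_def by (subst integral_cong[of _ _ "\<lambda>x. 0"]) (auto intro!: bump_zero)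

lemma step_DERIV: "(step has_real_derivative bump x / 2) (at x)"
proof (cases "x > -1")
  case True
  have "((\<lambda>u. integral {-1..u} bump) has_real_derivative bump x) (at x within {-1..x+1})"
    using True by (intro integral_has_real_derivative smooth1_continuous_on smooth1_bump) auto
  then have "((\<lambda>u. integral {-1..u} bump) has_real_derivative bump x) (at x)"
    using True by (simp add: at_within_Icc_at)
  then show ?thesis unfolding step_def[abs_def] by (rule DERIV_cdivide)
next
  case False
  have "\<forall>\<^sub>F y in nhds x. step y = 0"
    using False by (auto simp: eventually_nhds intro!: exI[of _ "{..<-1/2}"] step_eq_0)
  moreover have "bump x = 0" using False by (intro bump_zero) auto
  ultimately show ?thesis using False
    by (subst DERIV_cong_ev[OF refl _ refl]) auto
qed

lemma smooth1_step: "smooth1 step"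
  by (rule smooth1I_DERIV[OF step_DERIV]) (intro smooth1_divide smooth1_bump)

lemma step_mono: "x \<le> y \<Longrightarrow> step x \<le> step y"
  by (rule DERIV_nonneg_imp_nondecreasing[of x y step])
     (use step_DERIV bump_nonneg in \<open>fastforce+\<close>)

lemma step_eq_1: "x \<ge> 1/2 \<Longrightarrow> step x = 1"
proof -
  have *: "step y = step z" if "1/2 \<le> y" "y \<le> z" for y z
  proof (cases "y < z")
    case True
    show ?thesis
    proof (rule DERIV_isconst2[of y z step z, symmetric, OF True])
      show "continuous_on {y..z} step" by (rule smooth1_continuous_on[OF smooth1_step])
      show "(step has_real_derivative 0) (at u)" if "y < u" "u < z" for u
        using step_DERIV[of u] bump_zero[of u] that \<open>1/2 \<le> y\<close> by simp
    qed (use True in auto)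
  qed (use that in auto)
  have 1: "step 1 = 1" unfolding step_def using bump_integral by (simp add: integral_unique)
  assume "x \<ge> 1/2"
  with *[of "1/2" x] *[of "1/2" 1] 1 show ?thesis by simp
qed

lemma step_bounds: "0 \<le> step x" "step x \<le> 1"
  using step_mono[of "min x (-1)" x] step_mono[of x "max x 1"]
    step_eq_0[of "min x (-1)"] step_eq_1[of "max x 1"] by auto

section \<open>Products of functions of one variable\<close>

definition tens :: "(real \<Rightarrow> real) \<Rightarrow> (real \<Rightarrow> real) \<Rightarrow> real^2 \<Rightarrow> real" where
  "tens A B x = A (x $ 1) * B (x $ 2)"

lemma Basis_real2: "(Basis :: (real^2) set) = {axis 1 1, axis 2 1}"
  by (auto simp: Basis_vec_def UNIV_2)

lemma axis_12_neq: "(axis 1 1 :: real^2) \<noteq> axis 2 1"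
  by (simp add: axis_eq_axis)

text \<open>Fubini, read off from the description of \<open>lborel\<close> as an image of the
  product measure indexed by the basis vectors; \<open>F\<close> assigns to each basis vector its
  factor.\<close>

lemma tens_lborel:
  assumes "integrable lborel A" "integrable lborel B"
  shows integrable_tens: "integrable lborel (tens A B)"
    and integral_tens: "integral\<^sup>L lborel (tens A B) = integral\<^sup>L lborel A * integral\<^sup>L lborel B"
proof -
  interpret product_sigma_finite "\<lambda>_::real^2. lborel :: real measure"
    by standard
  define F where "F b = (if b = (axis 1 1 :: real^2) then A else B)" for b
  have F: "integrable lborel (F b)" for b using assms by (simp add: F_def)
  have [measurable]: "A \<in> borel_measurable borel" "B \<in> borel_measurable borel"
    using assms[THEN borel_measurable_integrable] by auto
  have [measurable]: "tens A B \<in> borel_measurable borel"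
    unfolding tens_def[abs_def] by measurable
  have eq: "tens A B (\<Sum>b\<in>Basis. f b *\<^sub>R b) = (\<Prod>b\<in>Basis. F b (f b))" for f
    using axis_12_neq unfolding Basis_real2 by (simp add: tens_def F_def axis_def)
  have m: "(\<lambda>f. \<Sum>b\<in>Basis. f b *\<^sub>R b :: real^2) \<in> measurable (\<Pi>\<^sub>M b\<in>Basis. lborel) borel"
    by measurable
  show "integrable lborel (tens A B)"
    unfolding lborel_eq[where ?'a = "real^2"] using product_integrable_prod[of Basis F, OF _ F]
    by (subst integrable_distr_eq[OF m]) (simp_all add: eq)
  have "integral\<^sup>L lborel (tens A B) = (\<Prod>b\<in>Basis. integral\<^sup>L lborel (F b))"
    unfolding lborel_eq[where ?'a = "real^2"] using product_integral_prod[of Basis F, OF _ F]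
    by (subst integral_distr[OF m]) (simp_all add: eq)
  also have "\<dots> = integral\<^sup>L lborel A * integral\<^sup>L lborel B"
    using axis_12_neq by (simp add: Basis_real2 F_def)
  finally show "integral\<^sup>L lborel (tens A B) = integral\<^sup>L lborel A * integral\<^sup>L lborel B" .
qed

lemma tens_has_derivative:
  assumes "smooth1 A" "smooth1 B"
  shows "(tens A B has_derivative
    (\<lambda>h. h $ 1 * tens (deriv A) B x + h $ 2 * tens A (deriv B) x)) (at x)"
proof -
  have 1: "((\<lambda>x. F (x $ i)) has_derivative (\<lambda>h. h $ i * deriv F (x $ i))) (at x)"
    if "smooth1 F" for F and i :: 2
  proof -
    have "(F has_derivative (\<lambda>h. h * deriv F (x $ i))) (at (x $ i))"
      using smooth1_DERIV[OF that] unfolding has_field_derivative_def by (simp add: mult_commute_abs)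
    moreover have "((\<lambda>x::real^2. x $ i) has_derivative (\<lambda>h. h $ i)) (at x)"
      by (intro bounded_linear_imp_has_derivative bounded_linear_vec_nth)
    ultimately show ?thesis
      using has_derivative_compose[of "\<lambda>x. x $ i"] by blast
  qed
  show ?thesis unfolding tens_def[abs_def]
    by (rule has_derivative_eq_rhs[OF has_derivative_mult[OF 1[OF assms(1)] 1[OF assms(2)]]])
       (auto simp: algebra_simps)
qed

lemma partial_deriv_eqI: "(f has_derivative D) (at x) \<Longrightarrow> partial_deriv i f x = D (axis i 1)"
  unfolding partial_deriv_def using frechet_derivative_at by metis

lemma partial_deriv_tens:
  assumes "smooth1 A" "smooth1 B"
  shows "partial_deriv 1 (tens A B) = tens (deriv A) B"
    and "partial_deriv 2 (tens A B) = tens A (deriv B)"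
  using partial_deriv_eqI[OF tens_has_derivative[OF assms]] by (auto simp: axis_def)

lemma tens_differentiable: "smooth1 A \<Longrightarrow> smooth1 B \<Longrightarrow> tens A B differentiable_on S"
  by (meson differentiable_at_imp_differentiable_on differentiable_def tens_has_derivative)

lemma continuous_on_tens: "smooth1 A \<Longrightarrow> smooth1 B \<Longrightarrow> continuous_on S (tens A B)"
  by (simp add: differentiable_imp_continuous_on tens_differentiable)

lemma smooth_tens:
  assumes "smooth1 A" "smooth1 B"
  shows "smooth (tens A B)"
proof -
  have "\<exists>A' B'. smooth1 A' \<and> smooth1 B' \<and> foldr partial_deriv is (tens A B) = tens A' B'" for "is"
  proof (induction "is")
    case (Cons i "is")
    then obtain A' B' where *: "smooth1 A'" "smooth1 B'" "foldr partial_deriv is (tens A B) = tens A' B'"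
      by blast
    have "i = 1 \<or> i = 2" by (rule exhaust_2)
    with * show ?case
      using partial_deriv_tens[OF *(1,2)] smooth1_deriv by auto
  qed (use assms in auto)
  then show ?thesis unfolding smooth_def using tens_differentiable by metis
qed

lemma classical_deriv_tens:
  assumes "smooth1 A" "smooth1 B"
  shows "classical_deriv \<alpha> (tens A B) = tens ((deriv ^^ (\<alpha> $ 1)) A) ((deriv ^^ (\<alpha> $ 2)) B)"
proof -
  have 1: "(partial_deriv 1 ^^ n) (tens A B) = tens ((deriv ^^ n) A) B" if "smooth1 A" "smooth1 B" for A B n
    using that by (induction n) (auto simp: partial_deriv_tens smooth1_funpow_deriv)
  have 2: "(partial_deriv 2 ^^ n) (tens A B) = tens A ((deriv ^^ n) B)" if "smooth1 A" "smooth1 B" for A B n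
    using that by (induction n) (auto simp: partial_deriv_tens smooth1_funpow_deriv)
  show ?thesis unfolding classical_deriv_def
    using assms by (simp add: 1 2 smooth1_funpow_deriv)
qed

lemma test_functionsI:
  assumes "smooth \<phi>" "compact C" "C \<subseteq> U" "\<And>x. x \<notin> C \<Longrightarrow> \<phi> x = 0"
  shows "\<phi> \<in> test_functions U"
proof -
  have "closure {x. \<phi> x \<noteq> 0} \<subseteq> C"
    using assms by (intro closure_minimal compact_imp_closed) auto
  moreover from this have "compact (closure {x. \<phi> x \<noteq> 0})"
    using assms(2) by (metis closed_Int_compact closed_closure inf.absorb1)
  ultimately show ?thesis using assms unfolding test_functions_def by auto
qed

lemma tens_test:
  assumes "smooth1 A" "smooth1 B" "cbox (vector [a1, a2]) (vector [b1, b2]) \<subseteq> U"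
    "\<And>x. x \<notin> {a1..b1} \<Longrightarrow> A x = 0" "\<And>x. x \<notin> {a2..b2} \<Longrightarrow> B x = 0"
  shows "tens A B \<in> test_functions U"
proof (rule test_functionsI[OF smooth_tens compact_cbox assms(3)])
  show "tens A B x = 0" if "x \<notin> cbox (vector [a1, a2]) (vector [b1, b2])" for x
    using that assms(4)[of "x $ 1"] assms(5)[of "x $ 2"]
    unfolding mem_box_cart by (auto simp: forall_2 vector_2 tens_def)
qed (use assms in auto)

section \<open>Integration by parts against test functions\<close>

lemma integrable_continuous_compact_support:
  fixes g :: "'a::euclidean_space \<Rightarrow> real"
  assumes "continuous_on UNIV g" "compact C" "\<And>x. x \<notin> C \<Longrightarrow> g x = 0"
  shows "integrable lborel g"
proof -
  have "integrable lborel (\<lambda>x. indicator C x *\<^sub>R g x)"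
    using assms(2) continuous_on_subset[OF assms(1)] by (intro borel_integrable_compact) auto
  also have "(\<lambda>x. indicator C x *\<^sub>R g x) = g"
    using assms(3) by (auto simp: fun_eq_iff indicator_def)
  finally show ?thesis .
qed

lemma integral_translate_diff:
  fixes g :: "'a::euclidean_space \<Rightarrow> real"
  assumes "integrable lborel g"
  shows "(\<integral>x. g (x + e) - g x \<partial>lborel) = 0" and "integrable lborel (\<lambda>x. g (x + e) - g x)"
proof -
  have [measurable]: "g \<in> borel_measurable borel" using assms by auto
  have d: "distr lborel borel (\<lambda>x. x + e) = lborel"
    using lborel_distr_plus[of e] by (subst add.commute) simp
  have i: "integrable lborel (\<lambda>x. g (x + e))"
    using integrable_distr_eq[of "\<lambda>x. x + e" lborel borel g] assms d by simp
  have "(\<integral>x. g (x + e) \<partial>lborel) = integral\<^sup>L lborel g"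
    using integral_distr[of "\<lambda>x. x + e" lborel borel g] d by simp
  then show "(\<integral>x. g (x + e) - g x \<partial>lborel) = 0" "integrable lborel (\<lambda>x. g (x + e) - g x)"
    using i assms by auto
qed

lemma derivative_zero_off:
  fixes f :: "'a::euclidean_space \<Rightarrow> real"
  assumes "(f has_derivative D) (at x)" "compact C" "\<And>x. x \<notin> C \<Longrightarrow> f x = 0" "x \<notin> C"
  shows "D = (\<lambda>_. 0)"
proof -
  have "\<forall>\<^sub>F y in nhds x. y \<in> - C"
    using assms(2,4) by (intro eventually_nhds_in_open) (auto simp: compact_imp_closed)
  then have "\<forall>\<^sub>F y in nhds x. 0 = f y"
    by (rule eventually_mono) (use assms(3) in auto)
  then have "\<forall>\<^sub>F y in at x. 0 = f y"
    by (simp add: eventually_nhds_conv_at)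
  then have "(f has_derivative (\<lambda>_. 0)) (at x)"
    by (rule has_derivative_transform_eventually[OF has_derivative_const]) (use assms(3,4) in auto)
  then show ?thesis using assms(1) has_derivative_unique by blast
qed

text \<open>Translation invariance makes every difference quotient integrate to zero. The mean value
  theorem bounds the quotients by the bound of the derivative, and for steps of length at most 1
  they all vanish off one compact set, so dominated convergence applies.\<close>

lemma integral_directional_deriv_zero:
  fixes \<psi> :: "real^2 \<Rightarrow> real"
  assumes D: "\<And>x. (\<psi> has_derivative D x) (at x)" and cont: "continuous_on UNIV (\<lambda>x. D x e)"
    and C: "compact C" "\<And>x. x \<notin> C \<Longrightarrow> \<psi> x = 0"
  shows "(\<integral>x. D x e \<partial>lborel) = 0"
proof -
  define g where "g x = D x e" for x
  have g0: "g x = 0" if "x \<notin> C" for x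
    using derivative_zero_off[OF D C that] by (simp add: g_def)
  have "bounded (g ` C)"
    using C(1) cont continuous_on_subset unfolding g_def[symmetric]
    by (intro compact_imp_bounded compact_continuous_image) auto
  then obtain B where "\<And>x. x \<in> C \<Longrightarrow> \<bar>g x\<bar> \<le> B" unfolding bounded_iff real_norm_def by blast
  with g0 have B: "\<bar>g x\<bar> \<le> max B 0" for x by (cases "x \<in> C") (auto simp: le_max_iff_disj)
  have \<psi>c: "continuous_on UNIV \<psi>"
    using D by (meson continuous_at_imp_continuous_on has_derivative_continuous)
  have \<psi>i: "integrable lborel \<psi>"
    by (rule integrable_continuous_compact_support[OF \<psi>c C])
  define q where "q n x = real (Suc n) * (\<psi> (x + (1 / real (Suc n)) *\<^sub>R e) - \<psi> x)" for n x
  have line: "((\<lambda>t. \<psi> (x + t *\<^sub>R e)) has_real_derivative g (x + t *\<^sub>R e)) (at t)" for x t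
  proof -
    have "((\<lambda>t. x + t *\<^sub>R e) has_derivative (\<lambda>h. h *\<^sub>R e)) (at t)"
      by (auto intro!: derivative_eq_intros)
    from has_derivative_compose[OF this D] 
    have "((\<lambda>t. \<psi> (x + t *\<^sub>R e)) has_derivative (\<lambda>h. D (x + t *\<^sub>R e) (h *\<^sub>R e))) (at t)" .
    moreover have "linear (D (x + t *\<^sub>R e))" using D has_derivative_linear by blast
    ultimately show ?thesis
      by (simp add: has_field_derivative_def g_def linear_cmul mult_commute_abs)
  qed
  have qB: "\<bar>q n x\<bar> \<le> max B 0" for n x
  proof -
    have "\<exists>z>0. z < 1 / real (Suc n) \<and> \<psi> (x + (1 / real (Suc n)) *\<^sub>R e) - \<psi> (x + 0 *\<^sub>R e)
      = (1 / real (Suc n) - 0) * g (x + z *\<^sub>R e)"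
      by (rule MVT2) (use line in auto)
    then obtain z where "q n x = g (x + z *\<^sub>R e)" by (auto simp: q_def field_simps)
    then show ?thesis using B by simp
  qed
  have ql: "(\<lambda>n. q n x) \<longlonglongrightarrow> g x" for x
  proof -
    have "((\<lambda>h. (\<psi> (x + h *\<^sub>R e) - \<psi> x) / h) \<longlongrightarrow> g x) (at 0)"
      using line[of x 0] unfolding DERIV_def by simp
    moreover have "filterlim (\<lambda>n. 1 / real (Suc n)) (at 0) sequentially"
      unfolding filterlim_at using LIMSEQ_inverse_real_of_nat by (auto simp: inverse_eq_divide)
    ultimately have "(\<lambda>n. (\<psi> (x + (1 / real (Suc n)) *\<^sub>R e) - \<psi> x) / (1 / real (Suc n))) \<longlonglongrightarrow> g x"
      by (rule filterlim_compose)
    then show ?thesis by (simp add: q_def mult.commute)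
  qed
  \<comment> \<open>The points from which some step \<open>t *\<^sub>R e\<close> with t in [0, 1]
    leads into \<open>C\<close>.\<close>
  define C' where "C' = {x - y | x y. x \<in> C \<and> y \<in> (\<lambda>t. t *\<^sub>R e) ` {0..1::real}}"
  have C': "compact C'" unfolding C'_def
    by (intro compact_differences C(1) compact_continuous_image continuous_intros) auto
  have q0: "q n x = 0" if "x \<notin> C'" for n x
  proof -
    have "x \<notin> C" using that unfolding C'_def by (force intro: image_eqI[of _ _ 0])
    moreover have "x + (1 / real (Suc n)) *\<^sub>R e \<notin> C"
    proof
      assume "x + (1 / real (Suc n)) *\<^sub>R e \<in> C"
      then have "(x + (1 / real (Suc n)) *\<^sub>R e) - (1 / real (Suc n)) *\<^sub>R e \<in> C'"
        unfolding C'_def by (intro CollectI exI conjI refl imageI) auto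
      then show False using that by simp
    qed
    ultimately show ?thesis by (simp add: q_def C(2))
  qed
  have qi: "integral\<^sup>L lborel (q n) = 0" "integrable lborel (q n)" for n
    using integral_translate_diff[OF \<psi>i] unfolding q_def[abs_def] by simp_all
  have "(\<lambda>n. integral\<^sup>L lborel (q n)) \<longlonglongrightarrow> integral\<^sup>L lborel g"
  proof (rule integral_dominated_convergence[where w = "\<lambda>x. max B 0 * indicator C' x"])
    show "integrable lborel (\<lambda>x. max B 0 * indicator C' x :: real)"
      using C' emeasure_bounded_finite[OF compact_imp_bounded[OF C']]
      by (intro integrable_mult_right) (simp add: integrable_indicator_iff compact_imp_closed)
    show "AE x in lborel. norm (q n x) \<le> max B 0 * indicator C' x" for n
      using qB q0 by (auto simp: indicator_def)
    show "g \<in> borel_measurable lborel" using cont unfolding g_def[abs_def]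
      by (simp add: borel_measurable_continuous_onI)
  qed (use ql qi(2) borel_measurable_integrable in auto)
  then show ?thesis using qi(1) by (simp add: g_def[abs_def] LIMSEQ_const_iff)
qed

lemma smooth_differentiable: "smooth \<phi> \<Longrightarrow> \<phi> differentiable_on UNIV"
  unfolding smooth_def by (metis foldr_Nil id_apply)

lemma smooth_partial_deriv: "smooth \<phi> \<Longrightarrow> smooth (partial_deriv i \<phi>)"
  unfolding smooth_def
proof
  fix "is" assume "\<forall>is. foldr partial_deriv is \<phi> differentiable_on UNIV"
  then have "foldr partial_deriv (is @ [i]) \<phi> differentiable_on UNIV" by blast
  then show "foldr partial_deriv is (partial_deriv i \<phi>) differentiable_on UNIV" by simp
qed

lemma smooth_has_derivative:
  "smooth \<phi> \<Longrightarrow> (\<phi> has_derivative frechet_derivative \<phi> (at x)) (at x)"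
  using smooth_differentiable[of \<phi>] by (simp add: differentiable_on_def frechet_derivative_works)

lemma smooth_continuous_on: "smooth \<phi> \<Longrightarrow> continuous_on S \<phi>"
  using continuous_on_subset[OF differentiable_imp_continuous_on[OF smooth_differentiable]] by blast

lemma partial_deriv_zero_off:
  assumes "smooth \<phi>" "compact C" "\<And>x. x \<notin> C \<Longrightarrow> \<phi> x = 0" "x \<notin> C"
  shows "partial_deriv i \<phi> x = 0"
  using derivative_zero_off[OF smooth_has_derivative[OF assms(1)] assms(2-)]
  by (simp add: partial_deriv_def fun_eq_iff)

text \<open>The product of \<open>tens A B\<close> with \<open>\<phi>\<close> has compact support
  although \<open>tens A B\<close> need not have it, so the integral of its partial derivative
  vanishes and the product rule does the rest.\<close>

lemma integral_tens_parts:
  assumes AB: "smooth1 A" "smooth1 B" and \<phi>: "smooth \<phi>" "compact C" "\<And>x. x \<notin> C \<Longrightarrow> \<phi> x = 0"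
  shows "(\<integral>x. tens A B x * partial_deriv i \<phi> x \<partial>lborel) = - (\<integral>x. partial_deriv i (tens A B) x * \<phi> x \<partial>lborel)"
proof -
  have sm: "smooth (tens A B)" by (rule smooth_tens[OF AB])
  define D where "D x h = tens A B x * frechet_derivative \<phi> (at x) h + frechet_derivative (tens A B) (at x) h * \<phi> x" for x h
  have D: "((\<lambda>x. tens A B x * \<phi> x) has_derivative D x) (at x)" for x
    unfolding D_def using has_derivative_mult[OF smooth_has_derivative[OF sm] smooth_has_derivative[OF \<phi>(1)]] by blast
  have De: "D x (axis i 1) = tens A B x * partial_deriv i \<phi> x + partial_deriv i (tens A B) x * \<phi> x" for x
    by (simp add: D_def partial_deriv_def)
  have c: "continuous_on UNIV (\<lambda>x. tens A B x * partial_deriv i \<phi> x)"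
    "continuous_on UNIV (\<lambda>x. partial_deriv i (tens A B) x * \<phi> x)"
    by (intro continuous_intros smooth_continuous_on smooth_partial_deriv sm \<phi>(1))+
  have i: "integrable lborel (\<lambda>x. tens A B x * partial_deriv i \<phi> x)"
    "integrable lborel (\<lambda>x. partial_deriv i (tens A B) x * \<phi> x)"
    by (rule integrable_continuous_compact_support[OF c(1) \<phi>(2)] integrable_continuous_compact_support[OF c(2) \<phi>(2)],
        use \<phi> partial_deriv_zero_off in force)+
  have "(\<integral>x. D x (axis i 1) \<partial>lborel) = 0"
    by (rule integral_directional_deriv_zero[OF D _ \<phi>(2)])
       (unfold De, intro continuous_intros c, simp add: \<phi>(3))
  then show ?thesis unfolding De using i by simp
qed

lemma integral_tens_classical_deriv:
  assumes "smooth1 A" "smooth1 B" and \<phi>: "smooth \<phi>" "compact C" "\<And>x. x \<notin> C \<Longrightarrow> \<phi> x = 0"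
  shows "(\<integral>x. tens A B x * classical_deriv \<alpha> \<phi> x \<partial>lborel) = (-1) ^ multi_order \<alpha> *
    (\<integral>x. tens ((deriv ^^ (\<alpha> $ 1)) A) ((deriv ^^ (\<alpha> $ 2)) B) x * \<phi> x \<partial>lborel)"
proof -
  have P: "smooth ((partial_deriv i ^^ n) \<phi>) \<and> (\<forall>x. x \<notin> C \<longrightarrow> (partial_deriv i ^^ n) \<phi> x = 0)"
    if "smooth \<phi>" "\<And>x. x \<notin> C \<Longrightarrow> \<phi> x = 0" for \<phi> i n
    using that by (induction n) (auto simp: smooth_partial_deriv intro!: partial_deriv_zero_off[OF _ \<phi>(2)])
  have 1: "(\<integral>x. tens A B x * (partial_deriv 1 ^^ n) \<phi> x \<partial>lborel) = (-1) ^ n * (\<integral>x. tens ((deriv ^^ n) A) B x * \<phi> x \<partial>lborel)"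
    if "smooth1 A" "smooth1 B" "smooth \<phi>" "\<And>x. x \<notin> C \<Longrightarrow> \<phi> x = 0" for A B \<phi> n
    using that
  proof (induction n arbitrary: A)
    case (Suc n)
    have "(\<integral>x. tens A B x * (partial_deriv 1 ^^ Suc n) \<phi> x \<partial>lborel)
      = - (\<integral>x. tens (deriv A) B x * (partial_deriv 1 ^^ n) \<phi> x \<partial>lborel)"
      using integral_tens_parts[OF Suc.prems(1,2) _ \<phi>(2), of "(partial_deriv 1 ^^ n) \<phi>" 1]
        P[OF Suc.prems(3,4), of n 1] partial_deriv_tens[OF Suc.prems(1,2)] by simp
    also have "\<dots> = (-1) ^ Suc n * (\<integral>x. tens ((deriv ^^ Suc n) A) B x * \<phi> x \<partial>lborel)"
      using Suc.IH[of "deriv A"] Suc.prems by (simp add: smooth1_deriv funpow_swap1)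
    finally show ?case .
  qed simp
  have 2: "(\<integral>x. tens A B x * (partial_deriv 2 ^^ n) \<phi> x \<partial>lborel) = (-1) ^ n * (\<integral>x. tens A ((deriv ^^ n) B) x * \<phi> x \<partial>lborel)"
    if "smooth1 A" "smooth1 B" "smooth \<phi>" "\<And>x. x \<notin> C \<Longrightarrow> \<phi> x = 0" for A B \<phi> n
    using that
  proof (induction n arbitrary: B)
    case (Suc n)
    have "(\<integral>x. tens A B x * (partial_deriv 2 ^^ Suc n) \<phi> x \<partial>lborel)
      = - (\<integral>x. tens A (deriv B) x * (partial_deriv 2 ^^ n) \<phi> x \<partial>lborel)"
      using integral_tens_parts[OF Suc.prems(1,2) _ \<phi>(2), of "(partial_deriv 2 ^^ n) \<phi>" 2]
        P[OF Suc.prems(3,4), of n 2] partial_deriv_tens[OF Suc.prems(1,2)] by simp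
    also have "\<dots> = (-1) ^ Suc n * (\<integral>x. tens A ((deriv ^^ Suc n) B) x * \<phi> x \<partial>lborel)"
      using Suc.IH[of "deriv B"] Suc.prems by (simp add: smooth1_deriv funpow_swap1)
    finally show ?case .
  qed simp
  show ?thesis unfolding classical_deriv_def multi_order_def
    using 1[OF assms(1,2)] 2[OF _ assms(2)] P[OF \<phi>(1,3)] \<phi>(1,3) assms(1)
    by (simp add: power_add smooth1_funpow_deriv)
qed

section \<open>Weak derivatives\<close>

lemma open_sets_lebesgue: "open U \<Longrightarrow> U \<in> sets (lebesgue :: 'a::euclidean_space measure)"
  by simp

lemma integral_lebesgue_on:
  fixes f :: "'a::euclidean_space \<Rightarrow> real"
  assumes "U \<in> sets lebesgue"
  shows "(LINT x|lebesgue_on U. f x) = (LINT x|lebesgue. indicator U x * f x)"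
  using assms by (subst integral_restrict_space) auto

lemma integrable_lebesgue_on:
  fixes f :: "'a::euclidean_space \<Rightarrow> real"
  assumes "U \<in> sets lebesgue"
  shows "integrable (lebesgue_on U) f \<longleftrightarrow> integrable lebesgue (\<lambda>x. indicator U x * f x)"
  using assms by (subst integrable_restrict_space) auto

lemma AE_lebesgue_on:
  assumes "U \<in> sets lebesgue"
  shows "(AE x in lebesgue_on U. P x) \<longleftrightarrow> (AE x in lebesgue. x \<in> U \<longrightarrow> P x)"
  using assms by (subst AE_restrict_space_iff) auto

lemma test_functionsD:
  assumes "\<phi> \<in> test_functions U"
  obtains C where "smooth \<phi>" "compact C" "C \<subseteq> U" "\<And>x. x \<notin> C \<Longrightarrow> \<phi> x = 0"
  using assms closure_subset[of "{x. \<phi> x \<noteq> 0}"] unfolding test_functions_def by blast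

lemma classical_deriv_smooth:
  assumes "smooth \<phi>"
  shows "smooth (classical_deriv \<alpha> \<phi>)"
proof -
  have "smooth ((partial_deriv i ^^ n) \<psi>)" if "smooth \<psi>" for i n \<psi>
    using that by (induction n) (auto simp: smooth_partial_deriv)
  then show ?thesis using assms by (simp add: classical_deriv_def)
qed

lemma classical_deriv_zero_off:
  assumes "smooth \<phi>" "compact C" "\<And>x. x \<notin> C \<Longrightarrow> \<phi> x = 0" "x \<notin> C"
  shows "classical_deriv \<alpha> \<phi> x = 0"
proof -
  have "smooth ((partial_deriv i ^^ n) \<psi>) \<and> (\<forall>x. x \<notin> C \<longrightarrow> (partial_deriv i ^^ n) \<psi> x = 0)"
    if "smooth \<psi>" "\<And>x. x \<notin> C \<Longrightarrow> \<psi> x = 0" for i n \<psi>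
    using that by (induction n)
      (auto simp: smooth_partial_deriv intro!: partial_deriv_zero_off[OF _ assms(2)])
  then show ?thesis using assms by (simp add: classical_deriv_def)
qed

lemma borel_measurable_lebesgue_continuous:
  fixes g :: "'a::euclidean_space \<Rightarrow> real"
  assumes "continuous_on UNIV g"
  shows "g \<in> borel_measurable lebesgue"
  using borel_measurable_continuous_onI[OF assms] by (intro measurable_completion) simp

lemma integrable_product_compact_support:
  fixes f g :: "real^2 \<Rightarrow> real"
  assumes "locally_integrable U f" "compact C" "C \<subseteq> U" "continuous_on UNIV g" "\<And>x. x \<notin> C \<Longrightarrow> g x = 0"
  shows "integrable lebesgue (\<lambda>x. indicator U x * (f x * g x))"
    and "integrable lebesgue (\<lambda>x. f x * g x)"
    and "U \<in> sets lebesgue \<Longrightarrow> (LINT x|lebesgue_on U. f x * g x) = (LINT x|lebesgue. f x * g x)"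
proof -
  have f: "integrable lebesgue (\<lambda>x. indicator C x *\<^sub>R f x)"
    using assms(1-3) unfolding locally_integrable_def set_integrable_def by blast
  have "bounded (g ` C)"
    using assms(2) continuous_on_subset[OF assms(4)]
    by (intro compact_imp_bounded compact_continuous_image) auto
  then obtain B where "\<And>x. x \<in> C \<Longrightarrow> \<bar>g x\<bar> \<le> B" unfolding bounded_iff real_norm_def by blast
  then have B: "\<bar>g x\<bar> \<le> max B 0" for x using assms(5) by (cases "x \<in> C") (auto simp: le_max_iff_disj)
  have g: "g \<in> borel_measurable lebesgue"
    by (rule borel_measurable_lebesgue_continuous[OF assms(4)])
  have "integrable lebesgue (\<lambda>x. (indicator C x *\<^sub>R f x) * g x)"
  proof (rule Bochner_Integration.integrable_bound[OF integrable_mult_right[OF f, of "max B 0"]])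
    show "AE x in lebesgue. norm (indicator C x *\<^sub>R f x * g x) \<le> norm (max B 0 * (indicator C x *\<^sub>R f x))"
      using B by (intro always_eventually allI) (simp add: abs_mult mult.commute[of "\<bar>g _\<bar>"] mult_left_mono mult.commute[of "max B 0"])
  qed (use f g borel_measurable_integrable in auto)
  also have "(\<lambda>x. (indicator C x *\<^sub>R f x) * g x) = (\<lambda>x. f x * g x)"
    using assms(5) by (auto simp: fun_eq_iff indicator_def)
  finally show i: "integrable lebesgue (\<lambda>x. f x * g x)" .
  have eq: "(\<lambda>x. indicator U x * (f x * g x)) = (\<lambda>x. f x * g x)"
    using assms(3,5) by (auto simp: fun_eq_iff indicator_def)
  show "integrable lebesgue (\<lambda>x. indicator U x * (f x * g x))" using i unfolding eq .
  show "(LINT x|lebesgue_on U. f x * g x) = (LINT x|lebesgue. f x * g x)" if "U \<in> sets lebesgue"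
    unfolding integral_lebesgue_on[OF that] eq ..
qed

lemma locally_integrable_continuous:
  assumes "continuous_on UNIV (f :: real^2 \<Rightarrow> real)"
  shows "locally_integrable U f"
  unfolding locally_integrable_def set_integrable_def
proof (intro allI impI)
  fix C :: "(real^2) set" assume "compact C \<and> C \<subseteq> U"
  then have "integrable lborel (\<lambda>x. indicator C x *\<^sub>R f x)"
    using continuous_on_subset[OF assms] by (intro borel_integrable_compact) auto
  then show "integrable lebesgue (\<lambda>x. indicator C x *\<^sub>R f x)"
    using integrable_completion by blast
qed

lemma locally_integrable_add:
  "locally_integrable U f \<Longrightarrow> locally_integrable U g \<Longrightarrow> locally_integrable U (\<lambda>x. f x + g x)"
  unfolding locally_integrable_def by (simp add: set_integral_add)

lemma locally_integrable_cmult: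
  "locally_integrable U f \<Longrightarrow> locally_integrable U (\<lambda>x. c * f x)"
  unfolding locally_integrable_def by simp

lemma locally_integrable_cong_AE:
  assumes "locally_integrable U f" "open U" "AE x in lebesgue_on U. f x = g x"
  shows "locally_integrable U g"
  unfolding locally_integrable_def
proof (intro allI impI)
  fix C assume C: "compact C \<and> C \<subseteq> U"
  have "AE x in lebesgue. x \<in> U \<longrightarrow> f x = g x"
    using assms by (simp add: AE_lebesgue_on)
  then obtain N where N: "N \<in> null_sets lebesgue" "{x. \<not> (x \<in> U \<longrightarrow> f x = g x)} \<subseteq> N"
    unfolding eventually_ae_filter by auto
  show "g absolutely_integrable_on C"
    by (rule absolutely_integrable_spike[where f = f and S = N])
       (use assms(1) C N in \<open>auto simp: locally_integrable_def negligible_iff_null_sets\<close>)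
qed

section \<open>Rules for weak derivatives\<close>

lemma has_weak_deriv_tens:
  assumes "open U" "smooth1 A" "smooth1 B"
  shows "has_weak_deriv U \<alpha> (tens A B) (tens ((deriv ^^ (\<alpha> $ 1)) A) ((deriv ^^ (\<alpha> $ 2)) B))"
proof -
  have c: "continuous_on UNIV (tens A B)"
    "continuous_on UNIV (tens ((deriv ^^ (\<alpha> $ 1)) A) ((deriv ^^ (\<alpha> $ 2)) B))"
    using assms by (auto intro!: continuous_on_tens smooth1_funpow_deriv)
  show ?thesis unfolding has_weak_deriv_def
  proof (intro conjI ballI locally_integrable_continuous c)
    fix \<phi> assume "\<phi> \<in> test_functions U"
    then obtain C where C: "smooth \<phi>" "compact C" "C \<subseteq> U" "\<And>x. x \<notin> C \<Longrightarrow> \<phi> x = 0"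
      using test_functionsD by blast
    have d: "continuous_on UNIV (classical_deriv \<alpha> \<phi>)" "continuous_on UNIV \<phi>"
      by (intro smooth_continuous_on classical_deriv_smooth C)+
    note m = borel_measurable_continuous_onI[OF continuous_on_mult[OF c(1) d(1)]]
      borel_measurable_continuous_onI[OF continuous_on_mult[OF c(2) d(2)]]
    show "(LINT x|lebesgue_on U. tens A B x * classical_deriv \<alpha> \<phi> x) = (- 1) ^ multi_order \<alpha> *
      (LINT x|lebesgue_on U. tens ((deriv ^^ (\<alpha> $ 1)) A) ((deriv ^^ (\<alpha> $ 2)) B) x * \<phi> x)"
      using integrable_product_compact_support(3)[OF locally_integrable_continuous[OF c(1)] C(2,3) d(1) classical_deriv_zero_off[OF C(1,2,4)]]
        integrable_product_compact_support(3)[OF locally_integrable_continuous[OF c(2)] C(2,3) d(2) C(4)]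
        integral_tens_classical_deriv[OF assms(2,3) C(1,2,4), of \<alpha>] m assms(1)
      by (simp add: integral_completion)
  qed
qed

lemma has_weak_deriv_add:
  assumes "open U" "has_weak_deriv U \<alpha> f f'" "has_weak_deriv U \<alpha> g g'"
  shows "has_weak_deriv U \<alpha> (\<lambda>x. f x + g x) (\<lambda>x. f' x + g' x)"
  unfolding has_weak_deriv_def
proof (intro conjI ballI)
  show "locally_integrable U (\<lambda>x. f x + g x)" "locally_integrable U (\<lambda>x. f' x + g' x)"
    using assms by (auto simp: has_weak_deriv_def intro!: locally_integrable_add)
  fix \<phi> assume \<phi>: "\<phi> \<in> test_functions U"
  then obtain C where C: "smooth \<phi>" "compact C" "C \<subseteq> U" "\<And>x. x \<notin> C \<Longrightarrow> \<phi> x = 0"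
    using test_functionsD by blast
  have d: "continuous_on UNIV (classical_deriv \<alpha> \<phi>)" "continuous_on UNIV \<phi>"
    by (intro smooth_continuous_on classical_deriv_smooth C)+
  have i: "integrable (lebesgue_on U) (\<lambda>x. h x * classical_deriv \<alpha> \<phi> x)"
    "integrable (lebesgue_on U) (\<lambda>x. h x * \<phi> x)" if "locally_integrable U h" for h
    using integrable_product_compact_support(1)[OF that C(2,3) d(1) classical_deriv_zero_off[OF C(1,2,4)]]
      integrable_product_compact_support(1)[OF that C(2,3) d(2) C(4)] assms(1)
    by (simp_all add: integrable_lebesgue_on)
  show "(LINT x|lebesgue_on U. (f x + g x) * classical_deriv \<alpha> \<phi> x) =
      (- 1) ^ multi_order \<alpha> * (LINT x|lebesgue_on U. (f' x + g' x) * \<phi> x)"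
    using assms(2,3) \<phi> i unfolding has_weak_deriv_def by (simp add: distrib_left distrib_right)
qed

lemma has_weak_deriv_cmult:
  assumes "has_weak_deriv U \<alpha> f f'"
  shows "has_weak_deriv U \<alpha> (\<lambda>x. c * f x) (\<lambda>x. c * f' x)"
  using assms unfolding has_weak_deriv_def
  by (auto simp: locally_integrable_cmult mult.assoc)

lemma has_weak_deriv_cong_AE:
  assumes "open U" "has_weak_deriv U \<alpha> f f'" "AE x in lebesgue_on U. f x = g x"
  shows "has_weak_deriv U \<alpha> g f'"
proof -
  have g: "locally_integrable U g"
    using assms locally_integrable_cong_AE unfolding has_weak_deriv_def by blast
  have "(LINT x|lebesgue_on U. f x * classical_deriv \<alpha> \<phi> x) = (LINT x|lebesgue_on U. g x * classical_deriv \<alpha> \<phi> x)"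
    if "\<phi> \<in> test_functions U" for \<phi>
  proof (rule integral_cong_AE)
    obtain C where C: "smooth \<phi>" "compact C" "C \<subseteq> U" "\<And>x. x \<notin> C \<Longrightarrow> \<phi> x = 0"
      using \<open>\<phi> \<in> test_functions U\<close> test_functionsD by blast
    have d: "continuous_on UNIV (classical_deriv \<alpha> \<phi>)"
      by (intro smooth_continuous_on classical_deriv_smooth C)
    have "integrable (lebesgue_on U) (\<lambda>x. h x * classical_deriv \<alpha> \<phi> x)" if "locally_integrable U h" for h
      using integrable_product_compact_support(1)[OF that C(2,3) d(1) classical_deriv_zero_off[OF C(1,2,4)]] assms(1)
      by (simp_all add: integrable_lebesgue_on)
    then show "(\<lambda>x. f x * classical_deriv \<alpha> \<phi> x) \<in> borel_measurable (lebesgue_on U)"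
      "(\<lambda>x. g x * classical_deriv \<alpha> \<phi> x) \<in> borel_measurable (lebesgue_on U)"
      using g assms(2) borel_measurable_integrable unfolding has_weak_deriv_def by blast+
    show "AE x in lebesgue_on U. f x * classical_deriv \<alpha> \<phi> x = g x * classical_deriv \<alpha> \<phi> x"
      using assms(3) by eventually_elim simp
  qed
  then show ?thesis using assms(2) g unfolding has_weak_deriv_def by simp
qed

lemma test_functions_mono: "V \<subseteq> U \<Longrightarrow> \<phi> \<in> test_functions V \<Longrightarrow> \<phi> \<in> test_functions U"
  unfolding test_functions_def by blast

lemma has_weak_deriv_subset:
  assumes "open U" "open V" "V \<subseteq> U" "has_weak_deriv U \<alpha> f g"
  shows "has_weak_deriv V \<alpha> f g"
  unfolding has_weak_deriv_def
proof (intro conjI ballI)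
  show l: "locally_integrable V f" "locally_integrable V g"
    using assms(3,4) unfolding has_weak_deriv_def locally_integrable_def by blast+
  have lU: "locally_integrable U f" "locally_integrable U g"
    using assms(4) unfolding has_weak_deriv_def by auto
  fix \<phi> assume \<phi>: "\<phi> \<in> test_functions V"
  then obtain C where C: "smooth \<phi>" "compact C" "C \<subseteq> V" "\<And>x. x \<notin> C \<Longrightarrow> \<phi> x = 0"
    using test_functionsD by blast
  have d: "continuous_on UNIV (classical_deriv \<alpha> \<phi>)" "continuous_on UNIV \<phi>"
    by (intro smooth_continuous_on classical_deriv_smooth C)+
  have CU: "C \<subseteq> U" using C assms by auto
  note z = classical_deriv_zero_off[OF C(1,2,4)]
  note p = integrable_product_compact_support(3)
  show "(LINT x|lebesgue_on V. f x * classical_deriv \<alpha> \<phi> x) =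
      (- 1) ^ multi_order \<alpha> * (LINT x|lebesgue_on V. g x * \<phi> x)"
    using p[OF l(1) C(2,3) d(1) z] p[OF l(2) C(2,3) d(2) C(4)]
      p[OF lU(1) C(2) CU d(1) z] p[OF lU(2) C(2) CU d(2) C(4)] assms test_functions_mono[OF assms(3) \<phi>]
    unfolding has_weak_deriv_def by simp
qed

subsection \<open>The fundamental lemma of the calculus of variations\<close>

text \<open>By Henstock's lemma the Riemann sums of the absolute value are small.\<close>

lemma negligible_if_box_integrals_zero:
  fixes g :: "'a::euclidean_space \<Rightarrow> real"
  assumes g: "g absolutely_integrable_on cbox a b"
    and z: "\<And>c d. cbox c d \<subseteq> cbox a b \<Longrightarrow> integral (cbox c d) g = 0"
  shows "AE x in lebesgue. x \<in> cbox a b \<longrightarrow> g x = 0"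
proof -
  have gi: "g integrable_on cbox a b" using g absolutely_integrable_on_def by blast
  have "((\<lambda>x. \<bar>g x\<bar>) has_integral 0) (cbox a b)"
    unfolding has_integral
  proof (intro allI impI)
    fix e :: real assume "e > 0"
    then obtain \<gamma> where \<gamma>: "gauge \<gamma>" "\<And>p. \<lbrakk>p tagged_partial_division_of (cbox a b); \<gamma> fine p\<rbrakk> \<Longrightarrow>
      sum (\<lambda>(x,k). norm(measure lborel k *\<^sub>R g x - integral k g)) p < e"
      using Henstock_lemma[OF gi] by blast
    show "\<exists>\<gamma>. gauge \<gamma> \<and> (\<forall>\<D>. \<D> tagged_division_of cbox a b \<and> \<gamma> fine \<D> \<longrightarrow>
      norm ((\<Sum>(x, k)\<in>\<D>. measure lborel k *\<^sub>R \<bar>g x\<bar>) - 0) < e)"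
    proof (rule exI[of _ \<gamma>], intro conjI allI impI)
      show "gauge \<gamma>" by (rule \<gamma>(1))
      fix \<D> assume D: "\<D> tagged_division_of cbox a b \<and> \<gamma> fine \<D>"
      have "(\<Sum>(x, k)\<in>\<D>. measure lborel k *\<^sub>R \<bar>g x\<bar>) = (\<Sum>(x,k)\<in>\<D>. norm (measure lborel k *\<^sub>R g x - integral k g))"
      proof (rule sum.cong[OF refl], clarify)
        fix x k assume xk: "(x, k) \<in> \<D>"
        then obtain c d where k: "k = cbox c d" "k \<subseteq> cbox a b"
          using D tagged_division_ofD(3,4) by metis
        then show "measure lborel k *\<^sub>R \<bar>g x\<bar> = norm (measure lborel k *\<^sub>R g x - integral k g)"
          using z by (simp add: abs_mult)
      qed
      also have "\<dots> < e" using \<gamma>(2) D tagged_division_of_def by blast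
      finally have "(\<Sum>(x, k)\<in>\<D>. measure lborel k *\<^sub>R \<bar>g x\<bar>) < e" .
      moreover have "(\<Sum>(x, k)\<in>\<D>. measure lborel k *\<^sub>R \<bar>g x\<bar>) \<ge> 0"
        by (intro sum_nonneg) (auto intro!: mult_nonneg_nonneg)
      ultimately show "norm ((\<Sum>(x, k)\<in>\<D>. measure lborel k *\<^sub>R \<bar>g x\<bar>) - 0) < e" by simp
    qed
  qed
  then have 0: "integral (cbox a b) (\<lambda>x. \<bar>g x\<bar>) = 0" by (rule integral_unique)
  have ai: "(\<lambda>x. \<bar>g x\<bar>) absolutely_integrable_on cbox a b"
    using absolutely_integrable_norm[OF g] by (simp add: o_def)
  have "(LINT x|lebesgue. indicator (cbox a b) x *\<^sub>R \<bar>g x\<bar>) = 0"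
    using set_lebesgue_integral_eq_integral(2)[OF ai] 0 by (simp add: set_lebesgue_integral_def)
  then have "AE x in lebesgue. indicator (cbox a b) x *\<^sub>R \<bar>g x\<bar> = 0"
    using ai unfolding set_integrable_def by (subst (asm) integral_nonneg_eq_0_iff_AE) auto
  then show ?thesis by eventually_elim (auto simp: indicator_def)
qed

section \<open>Smooth cutoffs that converge to the indicator of a box\<close>

definition cutoff :: "real \<Rightarrow> real \<Rightarrow> nat \<Rightarrow> real \<Rightarrow> real" where
  "cutoff a b n x = step (real (Suc n) * x + (- real (Suc n) * a - 2)) * step (- real (Suc n) * x + (real (Suc n) * b - 2))"

lemma smooth1_cutoff: "smooth1 (cutoff a b n)"
  unfolding cutoff_def[abs_def] by (intro smooth1_mult smooth1_affine smooth1_step)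

lemma cutoff_bounds: "0 \<le> cutoff a b n x" "cutoff a b n x \<le> 1"
  using step_bounds by (auto simp: cutoff_def intro!: mult_nonneg_nonneg mult_le_one)

text \<open>The margin is due to the shift by 2: at scaled distance 1 from an end point the argument
  of \<open>step\<close> is -1, where \<open>step\<close> still vanishes.\<close>

lemma cutoff_zero:
  assumes "x \<notin> {a + 1 / real (Suc n)..b - 1 / real (Suc n)}"
  shows "cutoff a b n x = 0"
proof -
  define N where "N = real (Suc n)"
  have p: "N > 0" by (simp add: N_def)
  have "\<not> (a + 1 / N \<le> x \<and> x \<le> b - 1 / N)" using assms by (simp add: N_def)
  then have "N * x < N * a + 1 \<or> N * b - 1 < N * x"
    using p by (auto simp: field_simps)
  then have "step (N * x + (- N * a - 2)) = 0 \<or> step (- N * x + (N * b - 2)) = 0"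
    using step_eq_0[of "N * x + (- N * a - 2)"] step_eq_0[of "- N * x + (N * b - 2)"] by auto
  then show ?thesis unfolding cutoff_def N_def by auto
qed

lemma cutoff_zero_outer:
  assumes "x \<notin> {a<..<b}"
  shows "cutoff a b n x = 0"
proof (rule cutoff_zero)
  have "1 / real (Suc n) > 0" by simp
  then show "x \<notin> {a + 1 / real (Suc n)..b - 1 / real (Suc n)}"
    using assms unfolding greaterThanLessThan_iff atLeastAtMost_iff by linarith
qed

lemma cutoff_tendsto: "(\<lambda>n. cutoff a b n x) \<longlonglongrightarrow> indicator {a<..<b} x"
proof (cases "x \<in> {a<..<b}")
  case True
  have l: "filterlim (\<lambda>n. real (Suc n) * c) at_top sequentially" if "c > 0" for c
    using that filterlim_Suc filterlim_compose[OF filterlim_real_sequentially filterlim_Suc]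
    by (intro filterlim_at_top_mult_tendsto_pos[OF tendsto_const]) auto
  \<comment> \<open>The arguments in \<open>cutoff\<close> are the scaled distances minus 2, so 3
    makes them at least 1, where \<open>step\<close> has reached its final value.\<close>
  have "\<forall>\<^sub>F n in sequentially. real (Suc n) * (x - a) \<ge> 3" "\<forall>\<^sub>F n in sequentially. real (Suc n) * (b - x) \<ge> 3"
    using l[of "x - a"] l[of "b - x"] True by (auto simp: filterlim_at_top)
  then have "\<forall>\<^sub>F n in sequentially. cutoff a b n x = 1"
  proof eventually_elim
    case (elim n)
    then show ?case unfolding cutoff_def
      by (subst (1 2) step_eq_1) (simp_all add: algebra_simps)
  qed
  then show ?thesis using True by (simp add: tendsto_eventually)
next
  case False
  then show ?thesis by (simp add: cutoff_zero_outer)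
qed

lemma tens_cutoff_tendsto:
  "(\<lambda>n. tens (cutoff a1 b1 n) (cutoff a2 b2 n) x) \<longlonglongrightarrow> indicator (box (vector [a1, a2]) (vector [b1, b2])) x"
proof -
  have "(\<lambda>n. tens (cutoff a1 b1 n) (cutoff a2 b2 n) x) \<longlonglongrightarrow> indicator {a1<..<b1} (x $ 1) * indicator {a2<..<b2} (x $ 2)"
    unfolding tens_def by (intro tendsto_mult cutoff_tendsto)
  also have "indicator {a1<..<b1} (x $ 1) * indicator {a2<..<b2} (x $ 2)
    = (indicator (box (vector [a1, a2]) (vector [b1, b2])) x :: real)"
    by (auto simp: indicator_def mem_box_cart forall_2 vector_2)
  finally show ?thesis .
qed

lemma tens_cutoff_bounds: "0 \<le> tens (cutoff a1 b1 n) (cutoff a2 b2 n) x" "tens (cutoff a1 b1 n) (cutoff a2 b2 n) x \<le> 1"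
  using cutoff_bounds by (auto simp: tens_def intro!: mult_nonneg_nonneg mult_le_one)

lemma tens_cutoff_zero:
  assumes "x \<notin> box (vector [a1, a2]) (vector [b1, b2])"
  shows "tens (cutoff a1 b1 n) (cutoff a2 b2 n) x = 0"
  using assms cutoff_zero_outer[of "x $ 1" a1 b1] cutoff_zero_outer[of "x $ 2" a2 b2]
  by (auto simp: mem_box_cart forall_2 vector_2 tens_def)

lemma real2_vector: "vector [x $ 1, x $ 2] = (x :: real^2)"
  by (simp add: vec_eq_iff forall_2 vector_2)

text \<open>Smooth cutoffs of a box are test functions, and their limit shows that \<open>g\<close>
  has integral zero over every closed box inside \<open>U\<close>. This settles each box, and
  countably many of them exhaust \<open>U\<close>.\<close>

lemma AE_zero_if_orthogonal_test_functions:
  assumes "open U" "locally_integrable U g"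
    and z: "\<And>\<phi>. \<phi> \<in> test_functions U \<Longrightarrow> (LINT x|lebesgue_on U. g x * \<phi> x) = 0"
  shows "AE x in lebesgue_on U. g x = 0"
proof -
  have box: "integral (cbox a b) g = 0" if ab: "cbox a b \<subseteq> U" for a b :: "real^2"
  proof -
    define k where "k n = tens (cutoff (a $ 1) (b $ 1) n) (cutoff (a $ 2) (b $ 2) n)" for n
    have k0: "k n x = 0" if "x \<notin> box a b" for n x
      using tens_cutoff_zero[of x "a $ 1" "a $ 2" "b $ 1" "b $ 2" n] that by (simp add: k_def real2_vector)
    have gi: "g absolutely_integrable_on cbox a b"
      using assms(2) ab unfolding locally_integrable_def by auto
    have zk: "(LINT x|lebesgue. g x * k n x) = 0" for n
    proof -
      have "k n \<in> test_functions U" unfolding k_def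
        by (rule tens_test[where ?a1.0 = "a $ 1" and ?b1.0 = "b $ 1" and ?a2.0 = "a $ 2" and ?b2.0 = "b $ 2"])
           (use ab in \<open>auto simp: real2_vector smooth1_cutoff intro!: cutoff_zero_outer\<close>)
      then have "(LINT x|lebesgue. indicator U x * (g x * k n x)) = 0"
        using z[of "k n"] assms(1) by (simp add: integral_lebesgue_on)
      moreover have "(\<lambda>x. indicator U x * (g x * k n x)) = (\<lambda>x. g x * k n x)"
        using k0[of _ n] ab box_subset_cbox[of a b] by (auto simp: indicator_def fun_eq_iff)
      ultimately show ?thesis by simp
    qed
    have "(\<lambda>n. LINT x|lebesgue. g x * k n x) \<longlonglongrightarrow> (LINT x|lebesgue. g x * indicator (box a b) x)"
    proof (rule integral_dominated_convergence[where w = "\<lambda>x. norm (indicator (cbox a b) x *\<^sub>R g x)"])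
      have grid_centre: "integrable lebesgue (\<lambda>x. indicator (cbox a b) x *\<^sub>R g x)"
        using gi unfolding set_integrable_def .
      then show "integrable lebesgue (\<lambda>x. norm (indicator (cbox a b) x *\<^sub>R g x))" by (rule integrable_norm)
      have e: "g x * h x = (indicator (cbox a b) x *\<^sub>R g x) * h x" if "\<And>x. x \<notin> box a b \<Longrightarrow> h x = 0" for h :: "_ \<Rightarrow> real" and x
        using that[of x] box_subset_cbox[of a b] by (auto simp: indicator_def)
      have m: "k n \<in> borel_measurable lebesgue" for n
        unfolding k_def by (intro borel_measurable_lebesgue_continuous continuous_on_tens smooth1_cutoff)
      have gm: "(\<lambda>x. indicator (cbox a b) x *\<^sub>R g x) \<in> borel_measurable lebesgue"
        using grid_centre by (rule borel_measurable_integrable)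
      have e': "(\<lambda>x. g x * h x) = (\<lambda>x. (indicator (cbox a b) x *\<^sub>R g x) * h x)"
        if "\<And>x. x \<notin> box a b \<Longrightarrow> h x = 0" for h :: "_ \<Rightarrow> real"
        using e[OF that] by (rule ext)
      have bm: "(\<lambda>x. indicator (box a b) x :: real) \<in> borel_measurable lebesgue"
        by (intro borel_measurable_indicator) simp
      show "(\<lambda>x. g x * indicator (box a b) x) \<in> borel_measurable lebesgue"
        using borel_measurable_times[OF gm bm] by (subst e') auto
      show "(\<lambda>x. g x * k n x) \<in> borel_measurable lebesgue" for n
        by (subst e', erule k0, rule borel_measurable_times[OF gm m])
      show "AE x in lebesgue. (\<lambda>n. g x * k n x) \<longlonglongrightarrow> g x * indicator (box a b) x"
        unfolding k_def using tens_cutoff_tendsto[of "a $ 1" "b $ 1" "a $ 2" "b $ 2"]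
        by (intro always_eventually allI tendsto_mult tendsto_const) (simp add: real2_vector)
      show "AE x in lebesgue. norm (g x * k n x) \<le> norm (indicator (cbox a b) x *\<^sub>R g x)" for n
      proof (intro always_eventually allI)
        fix x show "norm (g x * k n x) \<le> norm (indicator (cbox a b) x *\<^sub>R g x)"
          using k0[of x n] box_subset_cbox[of a b] tens_cutoff_bounds[of "a $ 1" "b $ 1" n "a $ 2" "b $ 2" x]
          by (cases "x \<in> box a b") (auto simp: k_def abs_mult mult_left_le)
      qed
    qed
    then have "(LINT x|lebesgue. g x * indicator (box a b) x) = 0"
      by (simp add: zk LIMSEQ_const_iff)
    moreover have "g absolutely_integrable_on box a b" using gi absolutely_integrable_on_open_interval by blast
    ultimately have "integral (box a b) g = 0"
      using set_lebesgue_integral_eq_integral(2)[of "box a b" g]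
      by (simp add: set_lebesgue_integral_def mult.commute)
    then show ?thesis by (simp add: integral_open_interval)
  qed
  obtain \<D> where D: "countable \<D>" "\<D> \<subseteq> Pow U" "\<And>X. X \<in> \<D> \<Longrightarrow> \<exists>a b. X = cbox a b" "\<Union>\<D> = U"
    using open_countable_Union_open_cbox[OF assms(1)] by metis
  have "AE x in lebesgue. x \<in> X \<longrightarrow> g x = 0" if XD: "X \<in> \<D>" for X
  proof -
    obtain a b where X: "X = cbox a b" using D(3)[OF XD] by blast
    have "cbox a b \<subseteq> U" using D(2) XD X by blast
    show ?thesis unfolding X
      by (rule negligible_if_box_integrals_zero)
         (use \<open>cbox a b \<subseteq> U\<close> assms(2) box in \<open>auto simp: locally_integrable_def\<close>)
  qed
  then have "AE x in lebesgue. \<forall>X\<in>\<D>. x \<in> X \<longrightarrow> g x = 0"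
    by (subst AE_ball_countable[OF D(1)]) blast
  then show ?thesis using D(4) assms(1) by (auto simp: AE_lebesgue_on elim!: eventually_mono)
qed

lemma has_weak_deriv_unique:
  assumes "open U" "has_weak_deriv U \<alpha> f g" "has_weak_deriv U \<alpha> f g'"
  shows "AE x in lebesgue_on U. g x = g' x"
proof -
  have l: "locally_integrable U g" "locally_integrable U g'"
    using assms unfolding has_weak_deriv_def by auto
  then have "locally_integrable U (\<lambda>x. g x + (-1) * g' x)"
    by (intro locally_integrable_add locally_integrable_cmult)
  moreover have "(LINT x|lebesgue_on U. (g x + (-1) * g' x) * \<phi> x) = 0" if \<phi>: "\<phi> \<in> test_functions U" for \<phi>
  proof -
    obtain C where C: "smooth \<phi>" "compact C" "C \<subseteq> U" "\<And>x. x \<notin> C \<Longrightarrow> \<phi> x = 0"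
      using \<phi> test_functionsD by blast
    have "integrable (lebesgue_on U) (\<lambda>x. h x * \<phi> x)" if "locally_integrable U h" for h
      using integrable_product_compact_support(1)[OF that C(2,3) smooth_continuous_on[OF C(1)] C(4)] assms(1)
      by (simp_all add: integrable_lebesgue_on)
    moreover have "(LINT x|lebesgue_on U. g x * \<phi> x) = (LINT x|lebesgue_on U. g' x * \<phi> x)"
      using assms(2,3) \<phi> unfolding has_weak_deriv_def by auto
    ultimately show ?thesis using l by (simp add: left_diff_distrib)
  qed
  ultimately have "AE x in lebesgue_on U. g x + (-1) * g' x = 0"
    using assms(1) by (rule AE_zero_if_orthogonal_test_functions[rotated])
  then show ?thesis by eventually_elim simp
qed

lemma weak_deriv_AE:
  assumes "open U" "has_weak_deriv U \<alpha> f g"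
  shows "AE x in lebesgue_on U. weak_deriv U \<alpha> f x = g x"
proof -
  have "has_weak_deriv U \<alpha> f (weak_deriv U \<alpha> f)"
    unfolding weak_deriv_def by (rule someI[where P = "\<lambda>g. has_weak_deriv U \<alpha> f g", OF assms(2)])
  from has_weak_deriv_unique[OF assms(1) this assms(2)] show ?thesis .
qed

section \<open>Square integrable functions\<close>

lemma L2_integrable_square: "L2 U f \<Longrightarrow> integrable (lebesgue_on U) (\<lambda>x. (f x)\<^sup>2)"
  and L2_measurable: "L2 U f \<Longrightarrow> f \<in> borel_measurable (lebesgue_on U)"
  by (simp_all add: L2_def)

lemma L2_integrable_mult:
  assumes "L2 U f" "L2 U g"
  shows "integrable (lebesgue_on U) (\<lambda>x. f x * g x)"
proof (rule Bochner_Integration.integrable_bound)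
  show "integrable (lebesgue_on U) (\<lambda>x. (f x)\<^sup>2 + (g x)\<^sup>2)"
    using assms by (intro Bochner_Integration.integrable_add L2_integrable_square)
  show "(\<lambda>x. f x * g x) \<in> borel_measurable (lebesgue_on U)"
    using assms[THEN L2_measurable] by measurable
  have "\<bar>x * y\<bar> \<le> x\<^sup>2 + y\<^sup>2" for x y :: real
  proof -
    have "2 * (\<bar>x\<bar> * \<bar>y\<bar>) \<le> x\<^sup>2 + y\<^sup>2" using zero_le_power2[of "\<bar>x\<bar> - \<bar>y\<bar>"] by (simp add: power2_diff)
    moreover have "\<bar>x\<bar> * \<bar>y\<bar> \<ge> 0" by simp
    ultimately show ?thesis unfolding abs_mult by linarith
  qed
  then show "AE x in lebesgue_on U. norm (f x * g x) \<le> norm ((f x)\<^sup>2 + (g x)\<^sup>2)"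
    by (intro always_eventually allI) (simp add: abs_of_nonneg)
qed

lemma L2_norm_nonneg: "L2_norm U f \<ge> 0"
  by (simp add: L2_norm_def L2_inner_def)

lemma L2_norm_square: "(L2_norm U f)\<^sup>2 = (LINT x|lebesgue_on U. (f x)\<^sup>2)"
  by (simp add: L2_norm_def L2_inner_def power2_eq_square)

text \<open>The best choice is t = b/a. Enlarging a and b by e > 0 avoids the degenerate cases a = 0
  and b = 0, and then e tends to 0.\<close>

lemma le_mult_if_le_weighted_mean:
  fixes X a b :: real
  assumes "a \<ge> 0" "b \<ge> 0" "\<And>t. t > 0 \<Longrightarrow> X \<le> (t * a\<^sup>2 + b\<^sup>2 / t) / 2"
  shows "X \<le> a * b"
proof -
  have "X \<le> (a + e) * (b + e)" if "e > 0" for e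
  proof -
    have p: "a + e > 0" "b + e > 0" using assms that by auto
    have "X \<le> ((b + e) / (a + e) * a\<^sup>2 + b\<^sup>2 / ((b + e) / (a + e))) / 2"
      using p by (intro assms(3)) auto
    also have "\<dots> \<le> ((b + e) / (a + e) * (a + e)\<^sup>2 + (b + e)\<^sup>2 / ((b + e) / (a + e))) / 2"
      using p that assms by (intro divide_right_mono add_mono mult_left_mono power_mono) auto
    also have "\<dots> = (a + e) * (b + e)" using p by (simp add: power2_eq_square)
    finally show ?thesis .
  qed
  then have "\<forall>\<^sub>F e in at_right 0. X \<le> (a + e) * (b + e)"
    by (auto intro: eventually_mono[OF eventually_at_right_less])
  moreover have "((\<lambda>e. (a + e) * (b + e)) \<longlongrightarrow> (a + 0) * (b + 0)) (at_right 0)"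
    by (intro tendsto_intros)
  ultimately show ?thesis
    by (intro tendsto_lowerbound[of "\<lambda>e. (a + e) * (b + e)" "a * b" "at_right 0"]) auto
qed

text \<open>Cauchy-Schwarz against a bounded function. \<open>V\<close> stands for the square root
  of the area, and it will be \<open>2 * h\<close> on a cell.\<close>

lemma L2_bounded_pairing:
  assumes U: "U \<in> lmeasurable" "measure lebesgue U \<le> V\<^sup>2" "V \<ge> 0" and f: "L2 U f"
    and g: "g \<in> borel_measurable (lebesgue_on U)" "\<And>x. x \<in> U \<Longrightarrow> \<bar>g x\<bar> \<le> B"
  shows "integrable (lebesgue_on U) (\<lambda>x. f x * g x)"
    and "\<bar>LINT x|lebesgue_on U. f x * g x\<bar> \<le> B * V * L2_norm U f"
proof -
  have Us: "U \<in> sets lebesgue" using U by auto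
  have c1: "integrable (lebesgue_on U) (\<lambda>x. c :: real)" for c
    using U Us by (simp add: integrable_lebesgue_on lmeasurable_iff_integrable)
  have cI: "(LINT x|lebesgue_on U. c) = measure lebesgue U * c" for c :: real
    using Us by (simp add: measure_restrict_space)
  have gL: "L2 U g" unfolding L2_def
  proof (intro conjI g(1) Bochner_Integration.integrable_bound[OF c1[of "B\<^sup>2"]])
    show "AE x in lebesgue_on U. norm ((g x)\<^sup>2) \<le> norm (B\<^sup>2)"
      using g(2) by (intro AE_I2) (force simp: abs_le_square_iff[symmetric])
  qed (use g(1) in measurable)
  show i: "integrable (lebesgue_on U) (\<lambda>x. f x * g x)" by (rule L2_integrable_mult[OF f gL])
  show "\<bar>LINT x|lebesgue_on U. f x * g x\<bar> \<le> B * V * L2_norm U f"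
  proof (cases "U = {}")
    case True
    then show ?thesis using U by (simp add: integral_lebesgue_on L2_norm_def L2_inner_def)
  next
    case False
    then have B: "B \<ge> 0" using g(2) abs_ge_zero order_trans by blast
    have "\<bar>LINT x|lebesgue_on U. f x * g x\<bar> \<le> L2_norm U f * (B * V)"
    proof (rule le_mult_if_le_weighted_mean)
      show "L2_norm U f \<ge> 0" by (rule L2_norm_nonneg)
      show "B * V \<ge> 0" using B U by simp
      fix t :: real assume t: "t > 0"
      have "\<bar>LINT x|lebesgue_on U. f x * g x\<bar> \<le> (LINT x|lebesgue_on U. \<bar>f x * g x\<bar>)"
        using integral_norm_bound[of "lebesgue_on U" "\<lambda>x. f x * g x"] by simp
      also have "\<dots> \<le> (LINT x|lebesgue_on U. t / 2 * (f x)\<^sup>2 + B\<^sup>2 / (2 * t))"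
      proof (rule integral_mono_AE)
        show "AE x in lebesgue_on U. \<bar>f x * g x\<bar> \<le> t / 2 * (f x)\<^sup>2 + B\<^sup>2 / (2 * t)"
        proof (rule AE_I2)
          fix x assume "x \<in> space (lebesgue_on U)"
          then have "\<bar>f x * g x\<bar> \<le> \<bar>f x\<bar> * B" using g(2) by (simp add: abs_mult mult_left_mono)
          also have "\<dots> \<le> t / 2 * (f x)\<^sup>2 + B\<^sup>2 / (2 * t)"
            using zero_le_power2[of "t * \<bar>f x\<bar> - B"] t
            by (simp add: field_simps power2_diff power2_eq_square)
          finally show "\<bar>f x * g x\<bar> \<le> t / 2 * (f x)\<^sup>2 + B\<^sup>2 / (2 * t)" .
        qed
      qed (use i f c1 in \<open>auto simp: L2_def\<close>)
      also have "\<dots> = t / 2 * (L2_norm U f)\<^sup>2 + measure lebesgue U * (B\<^sup>2 / (2 * t))"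
        using f c1[of "B\<^sup>2 / (2 * t)"] cI[of "B\<^sup>2 / (2 * t)"] unfolding L2_def L2_norm_square by simp
      also have "\<dots> \<le> t / 2 * (L2_norm U f)\<^sup>2 + V\<^sup>2 * (B\<^sup>2 / (2 * t))"
        using U t by (intro add_left_mono mult_right_mono) auto
      also have "\<dots> = (t * (L2_norm U f)\<^sup>2 + (B * V)\<^sup>2 / t) / 2"
        using t by (simp add: field_simps power_mult_distrib)
      finally show "\<bar>LINT x|lebesgue_on U. f x * g x\<bar> \<le> (t * (L2_norm U f)\<^sup>2 + (B * V)\<^sup>2 / t) / 2" .
    qed
    then show ?thesis by (simp add: mult_ac)
  qed
qed

section \<open>Primitives of compactly supported functions\<close>

definition prim :: "(real \<Rightarrow> real) \<Rightarrow> real \<Rightarrow> real" where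
  "prim G x = integral {-1..x} G"

text \<open>Left of the support the integrand is zero, and left of -1 the interval of integration is
  even empty. Right of the support the primitive is constant, and the vanishing total integral makes
  this constant zero.\<close>

lemma prim:
  assumes G: "smooth1 G" "r < 1" "\<And>x. x \<notin> {-r..r} \<Longrightarrow> G x = 0" "integral {-1..1} G = 0"
  shows prim_DERIV: "(prim G has_real_derivative G x) (at x)"
    and smooth1_prim: "smooth1 (prim G)"
    and prim_zero: "x \<notin> {-r..r} \<Longrightarrow> prim G x = 0"
    and deriv_prim: "deriv (prim G) = G"
proof -
  have left: "prim G x = 0" if "x < -r" for x
    unfolding prim_def by (subst integral_cong[of _ _ "\<lambda>x. 0"]) (use that in \<open>auto intro!: G(3)\<close>)
  have D: "(prim G has_real_derivative G x) (at x)" for x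
  proof (cases "x > -1")
    case True
    have "((\<lambda>u. integral {-1..u} G) has_real_derivative G x) (at x within {-1..x+1})"
      using True by (intro integral_has_real_derivative smooth1_continuous_on G(1)) auto
    then show ?thesis unfolding prim_def[abs_def]
      using True by (simp add: at_within_Icc_at)
  next
    case False
    have "\<forall>\<^sub>F y in nhds x. prim G y = 0"
      using False G(2) by (auto simp: eventually_nhds intro!: exI[of _ "{..<-r}"] left)
    moreover have "G x = 0" using False G(2) by (intro G(3)) auto
    ultimately show ?thesis by (subst DERIV_cong_ev[OF refl _ refl]) auto
  qed
  then show "(prim G has_real_derivative G x) (at x)" .
  show s: "smooth1 (prim G)" by (rule smooth1I_DERIV[OF D G(1)])
  show "deriv (prim G) = G" using D DERIV_imp_deriv by blast
  assume x: "x \<notin> {-r..r}"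
  show "prim G x = 0"
  proof (cases "x < -r")
    case False
    then have xr: "x > r" using x by auto
    have 1: "prim G 1 = 0" using G(4) by (simp add: prim_def)
    have c: "prim G y = prim G z" if "r < y" "y < z" for y z
    proof (rule DERIV_isconst2[of y z "prim G" z, symmetric, OF that(2)])
      show "continuous_on {y..z} (prim G)" by (rule smooth1_continuous_on[OF s])
      show "(prim G has_real_derivative 0) (at u)" if "y < u" "u < z" for u
        using D[of u] G(3)[of u] that \<open>r < y\<close> by simp
    qed (use that in auto)
    show ?thesis using c[of x 1] c[of 1 x] xr G(2) 1 by (cases x "1 :: real" rule: linorder_cases) auto
  qed (rule left)
qed

lemma integral_bound_Icc:
  fixes G :: "real \<Rightarrow> real"
  assumes "smooth1 G" "a \<le> b" "\<And>x. x \<in> {a..b} \<Longrightarrow> \<bar>G x\<bar> \<le> M"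
  shows "\<bar>integral {a..b} G\<bar> \<le> M * (b - a)"
  using integral_bound[of a b G M] assms by (simp add: smooth1_continuous_on)

lemma prim_bound:
  assumes "smooth1 G" "\<And>x. x \<in> {-1..1} \<Longrightarrow> \<bar>G x\<bar> \<le> M" "x \<in> {-1..1}"
  shows "\<bar>prim G x\<bar> \<le> 2 * M"
proof -
  have M: "M \<ge> 0" using assms(2)[of 0] by auto
  have "\<bar>integral {-1..x} G\<bar> \<le> M * (x - -1)"
    using assms by (intro integral_bound_Icc) auto
  also have "\<dots> \<le> M * 2" using assms(3) M by (intro mult_left_mono) auto
  finally show ?thesis by (simp add: prim_def)
qed

lemma smooth1_integrable: "smooth1 f \<Longrightarrow> f integrable_on {a..b}"
  by (intro integrable_continuous_interval smooth1_continuous_on)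

lemma integral_x_deriv:
  assumes "smooth1 f"
  shows "integral {-1..1} (\<lambda>x. x * deriv f x) = f 1 + f (-1) - integral {-1..1} f"
proof -
  have s: "smooth1 (\<lambda>x. x * f x)" using assms by auto
  have d: "deriv (\<lambda>x. x * f x) = (\<lambda>x. f x + x * deriv f x)"
    by (rule ext, rule DERIV_imp_deriv)
       (auto intro!: derivative_eq_intros smooth1_DERIV[OF assms])
  have "integral {-1..1} (\<lambda>x. f x + x * deriv f x) = f 1 + f (-1)"
    using integral_unique[OF smooth1_integral_deriv[OF s, of "-1" 1]] d by simp
  moreover have "integral {-1..1} (\<lambda>x. f x + x * deriv f x) = integral {-1..1} f + integral {-1..1} (\<lambda>x. x * deriv f x)"
    using assms by (intro integral_add smooth1_integrable) auto
  ultimately show ?thesis by simp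
qed

lemma integral_deriv_Icc:
  "smooth1 f \<Longrightarrow> integral {-1..1} (deriv f) = f 1 - f (-1)"
  using integral_unique[OF smooth1_integral_deriv, of f "-1" 1] by simp

section \<open>Moments of order 0 and 1 on the reference interval\<close>

definition mom0 :: "(real \<Rightarrow> real) \<Rightarrow> real" where "mom0 A = integral {-1..1} A"
definition mom1 :: "(real \<Rightarrow> real) \<Rightarrow> real" where "mom1 A = integral {-1..1} (\<lambda>x. x * A x)"

lemma mom_add: "smooth1 A \<Longrightarrow> smooth1 B \<Longrightarrow> mom0 (\<lambda>x. A x + B x) = mom0 A + mom0 B"
    "smooth1 A \<Longrightarrow> smooth1 B \<Longrightarrow> mom1 (\<lambda>x. A x + B x) = mom1 A + mom1 B"
  by (auto simp: mom0_def mom1_def distrib_left intro!: integral_add smooth1_integrable)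

lemma mom_cmult: "mom0 (\<lambda>x. c * A x) = c * mom0 A" "mom1 (\<lambda>x. c * A x) = c * mom1 A"
  by (simp_all add: mom0_def mom1_def mult.left_commute[of _ c])

lemma mom_minus: "mom0 (\<lambda>x. - A x) = - mom0 A" "mom1 (\<lambda>x. - A x) = - mom1 A"
  using mom_cmult[of "-1" A] by simp_all

lemma mom_diff: "smooth1 A \<Longrightarrow> smooth1 B \<Longrightarrow> mom0 (\<lambda>x. A x - B x) = mom0 A - mom0 B"
    "smooth1 A \<Longrightarrow> smooth1 B \<Longrightarrow> mom1 (\<lambda>x. A x - B x) = mom1 A - mom1 B"
  using mom_add[of A "\<lambda>x. - B x"] by (auto simp: mom_minus)

lemma mom_deriv:
  assumes "smooth1 A"
  shows "mom0 (deriv A) = A 1 - A (-1)" "mom1 (deriv A) = A 1 + A (-1) - mom0 A"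
  using integral_deriv_Icc[OF assms] integral_x_deriv[OF assms] by (simp_all add: mom0_def mom1_def)

lemma mom0_bump: "mom0 bump = 2"
  using bump_integral by (simp add: mom0_def integral_unique)

lemma mom1_even:
  assumes "\<And>x. A (- x) = A x" shows "mom1 A = 0"
proof -
  have "mom1 A = integral {-1..1} (\<lambda>x. - (x * A x))"
    unfolding mom1_def using Henstock_Kurzweil_Integration.integral_reflect_real[of 1 "-1" "\<lambda>x. x * A x"] assms by simp
  then show ?thesis by (simp add: mom1_def)
qed

lemma mom1_bump: "mom1 bump = 0"
  by (rule mom1_even) (rule bump_even)

text \<open>\<open>rho0\<close> and \<open>rho1\<close> are dual to the moments \<open>mom0\<close>
  and \<open>mom1\<close>. \<open>rhoP\<close> is the compactly supported primitive of
  \<open>rho1\<close>, so \<open>rho1\<close> is itself a derivative.\<close>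

definition rho0 :: "real \<Rightarrow> real" where "rho0 x = 1/2 * bump x"
definition rho1 :: "real \<Rightarrow> real" where "rho1 x = -1/2 * deriv bump x"
definition rhoP :: "real \<Rightarrow> real" where "rhoP x = -1/2 * bump x"

lemma smooth1_rho: "smooth1 rho0" "smooth1 rho1" "smooth1 rhoP"
  unfolding rho0_def[abs_def] rho1_def[abs_def] rhoP_def[abs_def]
  by (intro smooth1_mult smooth1_const smooth1_bump smooth1_deriv)+

lemma deriv_cmult: "smooth1 A \<Longrightarrow> deriv (\<lambda>x. c * A x) = (\<lambda>x. c * deriv A x)"
  by (rule ext, rule DERIV_imp_deriv) (auto intro!: derivative_eq_intros smooth1_DERIV)

lemma deriv_rhoP: "deriv rhoP = rho1"
  unfolding rhoP_def[abs_def] rho1_def[abs_def] by (rule deriv_cmult[OF smooth1_bump])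

lemma deriv_bump_zero: "\<bar>x\<bar> > 1/2 \<Longrightarrow> deriv bump x = 0"
  by (rule deriv_zero_off[of "{..<-1/2} \<union> {1/2<..}"]) (auto intro!: bump_zero)

lemma rho_zero: "\<bar>x\<bar> > 1/2 \<Longrightarrow> rho0 x = 0" "\<bar>x\<bar> > 1/2 \<Longrightarrow> rho1 x = 0" "\<bar>x\<bar> > 1/2 \<Longrightarrow> rhoP x = 0"
  by (simp_all add: rho0_def rho1_def rhoP_def bump_zero deriv_bump_zero)

lemma mom_rho: "mom0 rho0 = 1" "mom1 rho0 = 0" "mom0 rho1 = 0" "mom1 rho1 = 1"
  unfolding rho0_def[abs_def] rho1_def[abs_def] mom_cmult
  using mom_deriv[OF smooth1_bump] by (auto simp: mom0_bump mom1_bump bump_zero)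

definition hat :: "(real \<Rightarrow> real) \<Rightarrow> real \<Rightarrow> real" where
  "hat A = prim (prim (\<lambda>x. A x - (mom0 A * rho0 x + mom1 A * rho1 x)))"

text \<open>Removing the moments leaves \<open>G\<close>. Its primitive has compact support because
  the moment of order 0 vanishes; integration by parts turns the first moment of \<open>G\<close>
  into minus the integral of that primitive, which can thus be integrated once more. The condition
  \<open>1/2 \<le> r\<close> makes room for the supports of \<open>rho0\<close> and
  \<open>rho1\<close>.\<close>

lemma hat:
  assumes A: "smooth1 A" "1/2 \<le> r" "r < 1" "\<And>x. x \<notin> {-r..r} \<Longrightarrow> A x = 0"
  shows smooth1_hat: "smooth1 (hat A)"
    and hat_zero: "\<And>x. x \<notin> {-r..r} \<Longrightarrow> hat A x = 0"
    and hat_decomp: "A = (\<lambda>x. (deriv ^^ 2) (hat A) x + (mom0 A * rho0 x + mom1 A * rho1 x))"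
proof -
  define G where "G = (\<lambda>x. A x - (mom0 A * rho0 x + mom1 A * rho1 x))"
  have G: "smooth1 G" "\<And>x. x \<notin> {-r..r} \<Longrightarrow> G x = 0"
    using A smooth1_rho rho_zero by (auto simp: G_def intro!: smooth1_diff smooth1_add smooth1_mult)
  have sm: "smooth1 (\<lambda>x. mom0 A * rho0 x)" "smooth1 (\<lambda>x. mom1 A * rho1 x)"
    "smooth1 (\<lambda>x. mom0 A * rho0 x + mom1 A * rho1 x)"
    by (intro smooth1_add smooth1_mult smooth1_const smooth1_rho)+
  have m: "mom0 G = 0" "mom1 G = 0"
    unfolding G_def using mom_diff[OF A(1) sm(3)] mom_add[OF sm(1,2)]
    by (simp_all add: mom_cmult mom_rho)
  have iG: "integral {-1..1} G = 0" using m by (simp add: mom0_def)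
  note p = prim[OF G(1) A(3) G(2) iG]
  have "mom1 (deriv (prim G)) = prim G 1 + prim G (-1) - mom0 (prim G)"
    by (rule mom_deriv[OF p(2)])
  then have "mom0 (prim G) = 0"
    using p(3)[of 1] p(3)[of "-1"] p(4) m A(3) by simp
  then have ip: "integral {-1..1} (prim G) = 0" by (simp add: mom0_def)
  note q = prim[OF p(2) A(3) p(3) ip]
  have h: "hat A = prim (prim G)" by (simp add: hat_def G_def)
  show "smooth1 (hat A)" unfolding h by (rule q(2))
  show "\<And>x. x \<notin> {-r..r} \<Longrightarrow> hat A x = 0" unfolding h by (rule q(3))
  show "A = (\<lambda>x. (deriv ^^ 2) (hat A) x + (mom0 A * rho0 x + mom1 A * rho1 x))"
  proof -
    have "(deriv ^^ 2) (hat A) = deriv (deriv (prim (prim G)))" unfolding h by (simp add: numeral_2_eq_2)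
    also have "\<dots> = G"
    proof -
      have "deriv (prim G) = G" by (rule deriv_prim[OF G(1) A(3) _ iG]) (rule G(2))
      moreover have "deriv (prim (prim G)) = prim G" by (rule deriv_prim[OF p(2) A(3) _ ip]) (use p(3) in auto)
      ultimately show ?thesis by simp
    qed
    finally have dd: "(deriv ^^ 2) (hat A) = G" .
    show ?thesis unfolding dd by (simp add: G_def)
  qed
qed

lemma mom_bound:
  assumes "smooth1 A" "\<And>x. x \<in> {-1..1} \<Longrightarrow> \<bar>A x\<bar> \<le> a"
  shows "\<bar>mom0 A\<bar> \<le> 2 * a" "\<bar>mom1 A\<bar> \<le> 2 * a"
proof -
  have "\<bar>integral {-1..1} A\<bar> \<le> a * (1 - -1)" using assms by (intro integral_bound_Icc) auto
  then show "\<bar>mom0 A\<bar> \<le> 2 * a" by (simp add: mom0_def)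
  have "\<bar>x * A x\<bar> \<le> a" if "x \<in> {-1..1}" for x
    using assms(2)[OF that] that mult_mono[of "\<bar>x\<bar>" 1 "\<bar>A x\<bar>" a] by (auto simp: abs_mult)
  then have "\<bar>integral {-1..1} (\<lambda>x. x * A x)\<bar> \<le> a * (1 - -1)" using assms by (intro integral_bound_Icc) auto
  then show "\<bar>mom1 A\<bar> \<le> 2 * a" by (simp add: mom1_def)
qed

lemma rho_bounds: "\<exists>R\<ge>0. \<forall>x\<in>{-1..1}. \<bar>rho0 x\<bar> \<le> R \<and> \<bar>rho1 x\<bar> \<le> R \<and> \<bar>rhoP x\<bar> \<le> R"
proof -
  obtain R0 where R0: "R0 \<ge> 0" "\<forall>x\<in>{-1..1}. \<bar>rho0 x\<bar> \<le> R0" using smooth1_bounded[OF smooth1_rho(1)] by blast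
  obtain R1 where R1: "R1 \<ge> 0" "\<forall>x\<in>{-1..1}. \<bar>rho1 x\<bar> \<le> R1" using smooth1_bounded[OF smooth1_rho(2)] by blast
  obtain R2 where R2: "R2 \<ge> 0" "\<forall>x\<in>{-1..1}. \<bar>rhoP x\<bar> \<le> R2" using smooth1_bounded[OF smooth1_rho(3)] by blast
  show ?thesis using R0 R1 R2 by (intro exI[of _ "R0 + R1 + R2"]) (auto intro: order_trans)
qed

text \<open>Each of the two moments is at most 2a, which gives 4Ra for the part that is removed;
  each of the two integrations over [-1, 1] costs another factor 2.\<close>

lemma hat_bound:
  assumes A: "smooth1 A" "1/2 \<le> r" "r < 1" "\<And>x. x \<notin> {-r..r} \<Longrightarrow> A x = 0"
    and a: "\<And>x. x \<in> {-1..1} \<Longrightarrow> \<bar>A x\<bar> \<le> a"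
    and R: "R \<ge> 0" "\<And>x. x \<in> {-1..1} \<Longrightarrow> \<bar>rho0 x\<bar> \<le> R" "\<And>x. x \<in> {-1..1} \<Longrightarrow> \<bar>rho1 x\<bar> \<le> R"
    and x: "x \<in> {-1..1}"
  shows "\<bar>mom0 A * rho0 x + mom1 A * rho1 x\<bar> \<le> 4 * R * a" "\<bar>hat A x\<bar> \<le> 4 * (1 + 4 * R) * a"
proof -
  define G where "G = (\<lambda>x. A x - (mom0 A * rho0 x + mom1 A * rho1 x))"
  have sG: "smooth1 G"
    using A smooth1_rho by (auto simp: G_def intro!: smooth1_diff smooth1_add smooth1_mult)
  have zG: "\<And>x. x \<notin> {-r..r} \<Longrightarrow> G x = 0"
    using A rho_zero by (auto simp: G_def)
  have sm: "smooth1 (\<lambda>x. mom0 A * rho0 x)" "smooth1 (\<lambda>x. mom1 A * rho1 x)"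
    "smooth1 (\<lambda>x. mom0 A * rho0 x + mom1 A * rho1 x)"
    by (intro smooth1_add smooth1_mult smooth1_const smooth1_rho)+
  have "mom0 G = 0"
    unfolding G_def using mom_diff[OF A(1) sm(3)] mom_add[OF sm(1,2)]
    by (simp_all add: mom_cmult mom_rho)
  then have iG: "integral {-1..1} G = 0" by (simp add: mom0_def)
  have 1: "\<bar>mom0 A * rho0 x + mom1 A * rho1 x\<bar> \<le> 4 * R * a" if "x \<in> {-1..1}" for x
  proof -
    have "\<bar>mom0 A * rho0 x\<bar> \<le> (2 * a) * R" "\<bar>mom1 A * rho1 x\<bar> \<le> (2 * a) * R"
      unfolding abs_mult using mom_bound[OF A(1) a] R that a[OF that] by (auto intro!: mult_mono)
    then have "\<bar>mom0 A * rho0 x + mom1 A * rho1 x\<bar> \<le> 2 * a * R + 2 * a * R" by linarith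
    then show ?thesis by (simp add: mult.commute mult.left_commute)
  qed
  then show "\<bar>mom0 A * rho0 x + mom1 A * rho1 x\<bar> \<le> 4 * R * a" using x .
  have "\<bar>G x\<bar> \<le> (1 + 4 * R) * a" if "x \<in> {-1..1}" for x
    using 1[OF that] a[OF that] unfolding G_def by (simp add: algebra_simps)
  then have "\<bar>prim G x\<bar> \<le> 2 * ((1 + 4 * R) * a)" if "x \<in> {-1..1}" for x
    using prim_bound[OF sG _ that] by blast
  then have "\<bar>prim (prim G) x\<bar> \<le> 2 * (2 * ((1 + 4 * R) * a))"
    using prim_bound[OF smooth1_prim[OF sG A(3) zG iG] _ x] by blast
  then show "\<bar>hat A x\<bar> \<le> 4 * (1 + 4 * R) * a" by (simp add: hat_def G_def algebra_simps)
qed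

section \<open>Pairing with rescaled products on a square\<close>

definition resc :: "real \<Rightarrow> real \<Rightarrow> (real \<Rightarrow> real) \<Rightarrow> real \<Rightarrow> real" where
  "resc h c A t = A ((t - c) / h)"

lemma smooth1_resc [intro]: "smooth1 A \<Longrightarrow> smooth1 (resc h c A)"
  using smooth1_affine[of A "1/h" "-c/h"] unfolding resc_def[abs_def]
  by (simp add: diff_divide_distrib)

lemma deriv_resc:
  assumes "smooth1 A"
  shows "deriv (resc h c A) = (\<lambda>t. (1 / h) * resc h c (deriv A) t)"
proof (rule ext, rule DERIV_imp_deriv)
  fix t
  have "((\<lambda>t. (t - c) / h) has_real_derivative 1 / h) (at t)"
    by (auto intro!: derivative_eq_intros DERIV_cdivide[of _ 1])
  from DERIV_chain2[OF smooth1_DERIV[OF assms] this]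
  show "(resc h c A has_real_derivative 1 / h * resc h c (deriv A) t) (at t)"
    unfolding resc_def[abs_def] by (simp add: mult.commute)
qed

lemma funpow_deriv_cmult: "smooth1 A \<Longrightarrow> (deriv ^^ n) (\<lambda>t. c * A t) = (\<lambda>t. c * (deriv ^^ n) A t)"
  by (induction n) (auto simp: deriv_cmult smooth1_funpow_deriv)

lemma funpow_deriv_resc:
  assumes "smooth1 A"
  shows "(deriv ^^ n) (resc h c A) = (\<lambda>t. (1 / h) ^ n * resc h c ((deriv ^^ n) A) t)"
proof (induction n)
  case (Suc n)
  have "(deriv ^^ Suc n) (resc h c A) = deriv (\<lambda>t. (1 / h) ^ n * resc h c ((deriv ^^ n) A) t)"
    using Suc by simp
  also have "\<dots> = (\<lambda>t. (1 / h) ^ n * deriv (resc h c ((deriv ^^ n) A)) t)"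
    using assms by (intro deriv_cmult smooth1_resc smooth1_funpow_deriv)
  also have "\<dots> = (\<lambda>t. (1 / h) ^ Suc n * resc h c ((deriv ^^ Suc n) A) t)"
    using assms by (simp add: deriv_resc smooth1_funpow_deriv mult.left_commute)
  finally show ?case .
qed simp

definition cell :: "real \<Rightarrow> real^2 \<Rightarrow> (real^2) set" where
  "cell h c = box (c - (\<chi> i. h)) (c + (\<chi> i. h))"

lemma mem_cell: "x \<in> cell h c \<longleftrightarrow> \<bar>x $ 1 - c $ 1\<bar> < h \<and> \<bar>x $ 2 - c $ 2\<bar> < h"
  by (auto simp: cell_def mem_box_cart forall_2)

lemma mem_square: "x \<in> square h c \<longleftrightarrow> \<bar>x $ 1 - c $ 1\<bar> \<le> h \<and> \<bar>x $ 2 - c $ 2\<bar> \<le> h"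
  by (auto simp: square_def mem_box_cart forall_2)

lemma interior_square: "interior (square h c) = cell h c"
  by (simp add: square_def cell_def interior_cbox)

lemma open_cell: "open (cell h c)"
  unfolding cell_def by (rule open_box)

lemma cell_sets [simp]: "cell h c \<in> sets lebesgue"
  by (simp add: cell_def)

lemma cell_subset_square: "cell h c \<subseteq> square h c"
  by (auto simp: mem_cell mem_square)

lemma measure_cell:
  assumes "h > 0"
  shows "cell h c \<in> lmeasurable" "measure lebesgue (cell h c) = (2 * h)\<^sup>2"
proof -
  show "cell h c \<in> lmeasurable" by (simp add: cell_def)
  have le: "\<forall>b\<in>Basis. (c - (\<chi> i. h)) \<bullet> b \<le> (c + (\<chi> i. h)) \<bullet> b"
    using assms unfolding Basis_real2 by (simp add: inner_axis)
  have "measure lebesgue (cell h c) = (\<Prod>b\<in>Basis. ((c + (\<chi> i. h)) - (c - (\<chi> i. h))) \<bullet> b)"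
    unfolding cell_def using le by (simp add: measure_lborel_box_eq)
  also have "\<dots> = (2 * h)\<^sup>2"
    using axis_12_neq unfolding Basis_real2 by (simp add: inner_axis power2_eq_square)
  finally show "measure lebesgue (cell h c) = (2 * h)\<^sup>2" .
qed

definition ctens :: "real \<Rightarrow> real^2 \<Rightarrow> (real \<Rightarrow> real) \<Rightarrow> (real \<Rightarrow> real) \<Rightarrow> real^2 \<Rightarrow> real" where
  "ctens h c A B = tens (resc h (c $ 1) A) (resc h (c $ 2) B)"

definition pr :: "real \<Rightarrow> real^2 \<Rightarrow> (real^2 \<Rightarrow> real) \<Rightarrow> (real \<Rightarrow> real) \<Rightarrow> (real \<Rightarrow> real) \<Rightarrow> real" where
  "pr h c \<sigma> A B = (LINT x|lebesgue_on (cell h c). \<sigma> x * ctens h c A B x)"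

lemma ctens_eq: "ctens h c A B x = A ((x $ 1 - c $ 1) / h) * B ((x $ 2 - c $ 2) / h)"
  by (simp add: ctens_def tens_def resc_def)

lemma continuous_on_ctens: "smooth1 A \<Longrightarrow> smooth1 B \<Longrightarrow> continuous_on S (ctens h c A B)"
  unfolding ctens_def by (intro continuous_on_tens smooth1_resc)

lemma cell_coord:
  assumes "h > 0" "x \<in> cell h c"
  shows "(x $ 1 - c $ 1) / h \<in> {-1<..<1}" "(x $ 2 - c $ 2) / h \<in> {-1<..<1}"
  using assms by (auto simp: mem_cell abs_less_iff field_simps)

lemma ctens_bound:
  assumes "h > 0" "x \<in> cell h c" "\<And>x. x \<in> {-1..1} \<Longrightarrow> \<bar>A x\<bar> \<le> a" "\<And>x. x \<in> {-1..1} \<Longrightarrow> \<bar>B x\<bar> \<le> b"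
  shows "\<bar>ctens h c A B x\<bar> \<le> a * b"
proof -
  have "\<bar>A ((x $ 1 - c $ 1) / h)\<bar> \<le> a" "\<bar>B ((x $ 2 - c $ 2) / h)\<bar> \<le> b"
    using cell_coord[OF assms(1,2)] assms(3,4) by auto
  then show ?thesis unfolding ctens_eq abs_mult by (intro mult_mono) auto
qed

lemma ctens_measurable:
  "smooth1 A \<Longrightarrow> smooth1 B \<Longrightarrow> ctens h c A B \<in> borel_measurable (lebesgue_on S)"
  by (intro measurable_restrict_space1 borel_measurable_lebesgue_continuous continuous_on_ctens)

lemma pr_bound:
  assumes h: "h > 0" and \<sigma>: "L2 (cell h c) \<sigma>" and AB: "smooth1 A" "smooth1 B"
    and ab: "\<And>x. x \<in> {-1..1} \<Longrightarrow> \<bar>A x\<bar> \<le> a" "\<And>x. x \<in> {-1..1} \<Longrightarrow> \<bar>B x\<bar> \<le> b"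
  shows "integrable (lebesgue_on (cell h c)) (\<lambda>x. \<sigma> x * ctens h c A B x)"
    and "\<bar>pr h c \<sigma> A B\<bar> \<le> a * b * (2 * h) * L2_norm (cell h c) \<sigma>"
  unfolding pr_def
  using L2_bounded_pairing[of "cell h c" "2 * h" \<sigma> "ctens h c A B" "a * b"] h \<sigma> measure_cell[OF h, of c]
    ctens_measurable[OF AB] ctens_bound[OF h _ ab]
  by auto

lemma pr_integrable:
  assumes "h > 0" "L2 (cell h c) \<sigma>" "smooth1 A" "smooth1 B"
  shows "integrable (lebesgue_on (cell h c)) (\<lambda>x. \<sigma> x * ctens h c A B x)"
proof -
  obtain a b where "\<forall>x\<in>{-1..1}. \<bar>A x\<bar> \<le> a" "\<forall>x\<in>{-1..1}. \<bar>B x\<bar> \<le> b"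
    using smooth1_bounded assms by metis
  then show ?thesis using pr_bound(1)[OF assms] by blast
qed

lemma pr_add1:
  assumes "h > 0" "L2 (cell h c) \<sigma>" "smooth1 A" "smooth1 A'" "smooth1 B"
  shows "pr h c \<sigma> (\<lambda>x. A x + A' x) B = pr h c \<sigma> A B + pr h c \<sigma> A' B"
  unfolding pr_def using pr_integrable[OF assms(1,2) assms(3,5)] pr_integrable[OF assms(1,2) assms(4,5)]
  by (simp add: ctens_eq distrib_left distrib_right flip: Bochner_Integration.integral_add)

lemma pr_add2:
  assumes "h > 0" "L2 (cell h c) \<sigma>" "smooth1 A" "smooth1 B" "smooth1 B'"
  shows "pr h c \<sigma> A (\<lambda>x. B x + B' x) = pr h c \<sigma> A B + pr h c \<sigma> A B'"
  unfolding pr_def using pr_integrable[OF assms(1,2) assms(3,4)] pr_integrable[OF assms(1,2) assms(3,5)]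
  by (simp add: ctens_eq distrib_left distrib_right flip: Bochner_Integration.integral_add)

lemma pr_cmult: "pr h c \<sigma> (\<lambda>x. k * A x) B = k * pr h c \<sigma> A B" "pr h c \<sigma> A (\<lambda>x. k * B x) = k * pr h c \<sigma> A B"
proof -
  have e: "(\<lambda>x. \<sigma> x * ctens h c (\<lambda>x. k * A x) B x) = (\<lambda>x. k * (\<sigma> x * ctens h c A B x))"
    "(\<lambda>x. \<sigma> x * ctens h c A (\<lambda>x. k * B x) x) = (\<lambda>x. k * (\<sigma> x * ctens h c A B x))"
    by (simp_all add: ctens_eq fun_eq_iff)
  show "pr h c \<sigma> (\<lambda>x. k * A x) B = k * pr h c \<sigma> A B" "pr h c \<sigma> A (\<lambda>x. k * B x) = k * pr h c \<sigma> A B"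
    unfolding pr_def e by simp_all
qed

text \<open>The weak derivative relation, tested only with rescaled products supported inside the
  cell. The power of h comes from differentiating in reference coordinates. The sign (-1)^(i+j) is
  left out, since the relation serves derivatives of total order 2.\<close>

definition cell_weak :: "real \<Rightarrow> real^2 \<Rightarrow> nat \<Rightarrow> nat \<Rightarrow> (real^2 \<Rightarrow> real) \<Rightarrow> (real^2 \<Rightarrow> real) \<Rightarrow> bool" where
  "cell_weak h c i j \<sigma> \<tau> \<longleftrightarrow> (\<forall>A B r. smooth1 A \<longrightarrow> smooth1 B \<longrightarrow> r < 1 \<longrightarrow>
     (\<forall>x. x \<notin> {-r..r} \<longrightarrow> A x = 0 \<and> B x = 0) \<longrightarrow>
     pr h c \<sigma> ((deriv ^^ i) A) ((deriv ^^ j) B) = h ^ (i + j) * pr h c \<tau> A B)"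

lemma cell_weakD:
  assumes "cell_weak h c i j \<sigma> \<tau>" "smooth1 A" "smooth1 B" "r < 1"
    "\<And>x. x \<notin> {-r..r} \<Longrightarrow> A x = 0" "\<And>x. x \<notin> {-r..r} \<Longrightarrow> B x = 0"
  shows "pr h c \<sigma> ((deriv ^^ i) A) ((deriv ^^ j) B) = h ^ (i + j) * pr h c \<tau> A B"
  using assms unfolding cell_weak_def by blast

section \<open>A Bramble-Hilbert estimate by duality\<close>

text \<open>The product \<open>A \<otimes> B\<close> is compared with the combination of products of \<open>rho0\<close> and \<open>rho1\<close> that has
  the same moments, so the defect vanishes for affine \<open>\<sigma>\<close>.\<close>

definition defect :: "real \<Rightarrow> real^2 \<Rightarrow> (real^2 \<Rightarrow> real) \<Rightarrow> (real \<Rightarrow> real) \<Rightarrow> (real \<Rightarrow> real) \<Rightarrow> real" where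
  "defect h c \<sigma> A B = pr h c \<sigma> A B - (mom0 A * mom0 B * pr h c \<sigma> rho0 rho0
     + mom0 A * mom1 B * pr h c \<sigma> rho0 rho1 + mom1 A * mom0 B * pr h c \<sigma> rho1 rho0)"

text \<open>With the moment parts \<open>a\<close> of \<open>A\<close> and \<open>b\<close> of
  \<open>B\<close>, the product splits into \<open>hat A''\<close> times \<open>B\<close>,
  \<open>a\<close> times \<open>hat B''\<close>, and \<open>a\<close> times \<open>b\<close>. The
  first two lead to \<sigma>11 and \<sigma>22. Expanding the third gives the three products that
  \<open>defect\<close> subtracts and a fourth, \<open>rho1\<close> times \<open>rho1\<close>, which
  is the mixed derivative of \<open>rhoP\<close> times \<open>rhoP\<close> and leads to
  \<sigma>12.\<close>

lemma defect_eq: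
  assumes h: "h > 0" and \<sigma>: "L2 (cell h c) \<sigma>"
    and w: "cell_weak h c 2 0 \<sigma> \<sigma>11" "cell_weak h c 1 1 \<sigma> \<sigma>12" "cell_weak h c 0 2 \<sigma> \<sigma>22"
    and AB: "smooth1 A" "smooth1 B" "1/2 \<le> r" "r < 1" "\<And>x. x \<notin> {-r..r} \<Longrightarrow> A x = 0" "\<And>x. x \<notin> {-r..r} \<Longrightarrow> B x = 0"
  shows "defect h c \<sigma> A B = h\<^sup>2 * (pr h c \<sigma>11 (hat A) B
    + pr h c \<sigma>22 (\<lambda>x. mom0 A * rho0 x + mom1 A * rho1 x) (hat B)
    + mom1 A * mom1 B * pr h c \<sigma>12 rhoP rhoP)"
proof -
  define a where "a = (\<lambda>x. mom0 A * rho0 x + mom1 A * rho1 x)"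
  define b where "b = (\<lambda>x. mom0 B * rho0 x + mom1 B * rho1 x)"
  have sab: "smooth1 a" "smooth1 b"
    unfolding a_def b_def by (intro smooth1_add smooth1_mult smooth1_const smooth1_rho)+
  have zab: "a x = 0" if "x \<notin> {-r..r}" for x
  proof -
    have "\<bar>x\<bar> > 1/2" using that AB(3) by auto
    then show ?thesis by (simp add: a_def rho_zero)
  qed
  note hA = hat[OF AB(1,3,4) AB(5)]
  note hB = hat[OF AB(2,3,4) AB(6)]
  have shA: "smooth1 (hat A)" "smooth1 (hat B)"
    by (rule smooth1_hat[OF AB(1,3,4)], use AB(5) in simp) (rule smooth1_hat[OF AB(2,3,4)], use AB(6) in simp)
  have zA: "hat A x = 0" if "x \<notin> {-r..r}" for x by (rule hat_zero[OF AB(1,3,4) _ that]) (rule AB(5))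
  have zB: "hat B x = 0" if "x \<notin> {-r..r}" for x by (rule hat_zero[OF AB(2,3,4) _ that]) (rule AB(6))
  have dA: "A = (\<lambda>x. (deriv ^^ 2) (hat A) x + a x)"
    unfolding a_def by (rule hat_decomp[OF AB(1,3,4)]) (rule AB(5))
  have dB: "B = (\<lambda>x. (deriv ^^ 2) (hat B) x + b x)"
    unfolding b_def by (rule hat_decomp[OF AB(2,3,4)]) (rule AB(6))
  have "pr h c \<sigma> A B = pr h c \<sigma> ((deriv ^^ 2) (hat A)) B + pr h c \<sigma> a B"
    by (subst dA, rule pr_add1[OF h \<sigma>]) (use shA sab AB(2) smooth1_funpow_deriv in auto)
  also have "pr h c \<sigma> ((deriv ^^ 2) (hat A)) B = h\<^sup>2 * pr h c \<sigma>11 (hat A) B"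
    using cell_weakD[OF w(1) shA(1) AB(2,4) zA AB(6)] by simp
  also have "pr h c \<sigma> a B = pr h c \<sigma> a ((deriv ^^ 2) (hat B)) + pr h c \<sigma> a b"
    by (subst dB, rule pr_add2[OF h \<sigma>]) (use shA sab smooth1_funpow_deriv in auto)
  also have "pr h c \<sigma> a ((deriv ^^ 2) (hat B)) = h\<^sup>2 * pr h c \<sigma>22 a (hat B)"
    using cell_weakD[OF w(3) sab(1) shA(2) AB(4) zab zB] by (simp add: power2_eq_square)
  also have "pr h c \<sigma> a b = mom0 A * pr h c \<sigma> rho0 b + mom1 A * pr h c \<sigma> rho1 b"
    unfolding a_def by (subst pr_add1[OF h \<sigma>])
      (auto simp: pr_cmult sab intro!: smooth1_mult smooth1_rho)
  also have "pr h c \<sigma> rho0 b = mom0 B * pr h c \<sigma> rho0 rho0 + mom1 B * pr h c \<sigma> rho0 rho1"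
    unfolding b_def by (subst pr_add2[OF h \<sigma>])
      (auto simp: pr_cmult intro!: smooth1_mult smooth1_rho)
  also have "pr h c \<sigma> rho1 b = mom0 B * pr h c \<sigma> rho1 rho0 + mom1 B * pr h c \<sigma> rho1 rho1"
    unfolding b_def by (subst pr_add2[OF h \<sigma>])
      (auto simp: pr_cmult intro!: smooth1_mult smooth1_rho)
  also have "pr h c \<sigma> rho1 rho1 = h\<^sup>2 * pr h c \<sigma>12 rhoP rhoP"
  proof -
    have z: "rhoP x = 0" if "x \<notin> {- (1/2)..1/2}" for x :: real
      by (rule rho_zero(3)) (use that in auto)
    have "pr h c \<sigma> ((deriv ^^ 1) rhoP) ((deriv ^^ 1) rhoP) = h ^ (1 + 1) * pr h c \<sigma>12 rhoP rhoP"
      by (rule cell_weakD[OF w(2) smooth1_rho(3) smooth1_rho(3), where r = "1/2"]; (rule z, assumption | simp))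
    then show ?thesis
      by (simp add: deriv_rhoP power2_eq_square)
  qed
  finally show ?thesis unfolding defect_def a_def[symmetric] by (simp add: algebra_simps)
qed

text \<open>Two powers of h come from \<open>defect_eq\<close>, the third is the square root of the
  area in \<open>pr_bound\<close>. The three summands of the constant belong to \<sigma>11,
  \<sigma>22 and \<sigma>12, in this order.\<close>

lemma defect_bound_compact:
  "\<exists>C\<ge>0. \<forall>h c \<sigma> \<sigma>11 \<sigma>12 \<sigma>22 A B a b r. h > 0 \<longrightarrow> L2 (cell h c) \<sigma> \<longrightarrow>
     L2 (cell h c) \<sigma>11 \<longrightarrow> L2 (cell h c) \<sigma>12 \<longrightarrow> L2 (cell h c) \<sigma>22 \<longrightarrow>
     cell_weak h c 2 0 \<sigma> \<sigma>11 \<longrightarrow> cell_weak h c 1 1 \<sigma> \<sigma>12 \<longrightarrow> cell_weak h c 0 2 \<sigma> \<sigma>22 \<longrightarrow>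
     smooth1 A \<longrightarrow> smooth1 B \<longrightarrow> 1/2 \<le> r \<longrightarrow> r < 1 \<longrightarrow> (\<forall>x. x \<notin> {-r..r} \<longrightarrow> A x = 0 \<and> B x = 0) \<longrightarrow>
     (\<forall>x\<in>{-1..1}. \<bar>A x\<bar> \<le> a \<and> \<bar>B x\<bar> \<le> b) \<longrightarrow>
     \<bar>defect h c \<sigma> A B\<bar> \<le> C * (a * b) * h ^ 3 *
       (L2_norm (cell h c) \<sigma>11 + L2_norm (cell h c) \<sigma>12 + L2_norm (cell h c) \<sigma>22)"
proof -
  obtain R where R: "R \<ge> 0" "\<And>x. x \<in> {-1..1} \<Longrightarrow> \<bar>rho0 x\<bar> \<le> R"
    "\<And>x. x \<in> {-1..1} \<Longrightarrow> \<bar>rho1 x\<bar> \<le> R" "\<And>x. x \<in> {-1..1} \<Longrightarrow> \<bar>rhoP x\<bar> \<le> R"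
    using rho_bounds by blast
  define H where "H = 4 * (1 + 4 * R)"
  define C where "C = 2 * H + 8 * R * H + 8 * R * R"
  have H: "H \<ge> 0" using R by (simp add: H_def)
  have C: "2 * H \<le> C" "8 * R * H \<le> C" "8 * R * R \<le> C" "C \<ge> 0" using R H by (auto simp: C_def)
  show ?thesis
  proof (intro exI[of _ C] conjI C(4) allI impI)
    fix h c \<sigma> \<sigma>11 \<sigma>12 \<sigma>22 A B a b r
    assume h: "h > 0" and \<sigma>: "L2 (cell h c) \<sigma>" "L2 (cell h c) \<sigma>11" "L2 (cell h c) \<sigma>12" "L2 (cell h c) \<sigma>22"
      and w: "cell_weak h c 2 0 \<sigma> \<sigma>11" "cell_weak h c 1 1 \<sigma> \<sigma>12" "cell_weak h c 0 2 \<sigma> \<sigma>22"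
      and AB: "smooth1 A" "smooth1 B" "1/2 \<le> r" "r < 1" "\<forall>x. x \<notin> {-r..r} \<longrightarrow> A x = 0 \<and> B x = 0"
      and ab: "\<forall>x\<in>{-1..1}. \<bar>A x\<bar> \<le> a \<and> \<bar>B x\<bar> \<le> b"
    define n11 n12 n22 where n: "n11 = L2_norm (cell h c) \<sigma>11" "n12 = L2_norm (cell h c) \<sigma>12" "n22 = L2_norm (cell h c) \<sigma>22"
    have n0: "n11 \<ge> 0" "n12 \<ge> 0" "n22 \<ge> 0" by (simp_all add: n L2_norm_nonneg)
    have z: "\<And>x. x \<notin> {-r..r} \<Longrightarrow> A x = 0" "\<And>x. x \<notin> {-r..r} \<Longrightarrow> B x = 0" using AB(5) by auto
    have a: "\<And>x. x \<in> {-1..1} \<Longrightarrow> \<bar>A x\<bar> \<le> a" and b: "\<And>x. x \<in> {-1..1} \<Longrightarrow> \<bar>B x\<bar> \<le> b" using ab by auto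
    have ab0: "a \<ge> 0" "b \<ge> 0" using a[of 0] b[of 0] by auto
    have hA: "\<bar>hat A x\<bar> \<le> H * a" "\<bar>mom0 A * rho0 x + mom1 A * rho1 x\<bar> \<le> 4 * R * a" if "x \<in> {-1..1}" for x
      using hat_bound[OF AB(1,3,4) _ a R(1-3) that] z(1) unfolding H_def by auto
    have hB: "\<bar>hat B x\<bar> \<le> H * b" if "x \<in> {-1..1}" for x
      using hat_bound[OF AB(2,3,4) _ b R(1-3) that] z(2) unfolding H_def by auto
    have shA: "smooth1 (hat A)" by (rule smooth1_hat[OF AB(1,3,4)], use z in simp)
    have shB: "smooth1 (hat B)" by (rule smooth1_hat[OF AB(2,3,4)], use z in simp)
    have sa: "smooth1 (\<lambda>x. mom0 A * rho0 x + mom1 A * rho1 x)"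
      by (intro smooth1_add smooth1_mult smooth1_const smooth1_rho)
    have "\<bar>pr h c \<sigma>11 (hat A) B\<bar> \<le> (H * a) * b * (2 * h) * n11"
      unfolding n by (rule pr_bound(2)[OF h \<sigma>(2) shA AB(2) hA(1) b])
    also have "\<dots> = (2 * H) * (a * b * h * n11)" by simp
    also have "\<dots> \<le> C * (a * b * h * n11)" using C ab0 h n0 by (intro mult_right_mono) auto
    finally have 1: "\<bar>pr h c \<sigma>11 (hat A) B\<bar> \<le> C * (a * b * h * n11)" .
    have "\<bar>pr h c \<sigma>22 (\<lambda>x. mom0 A * rho0 x + mom1 A * rho1 x) (hat B)\<bar> \<le> (4 * R * a) * (H * b) * (2 * h) * n22"
      unfolding n by (rule pr_bound(2)[OF h \<sigma>(4) sa shB hA(2) hB])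
    also have "\<dots> = (8 * R * H) * (a * b * h * n22)" by simp
    also have "\<dots> \<le> C * (a * b * h * n22)" using C ab0 h n0 by (intro mult_right_mono) auto
    finally have 2: "\<bar>pr h c \<sigma>22 (\<lambda>x. mom0 A * rho0 x + mom1 A * rho1 x) (hat B)\<bar> \<le> C * (a * b * h * n22)" .
    have "\<bar>mom1 A * mom1 B * pr h c \<sigma>12 rhoP rhoP\<bar> \<le> (2 * a) * (2 * b) * (R * R * (2 * h) * n12)"
      unfolding abs_mult using mom_bound(2)[OF AB(1) a] mom_bound(2)[OF AB(2) b] ab0
        pr_bound(2)[OF h \<sigma>(3) smooth1_rho(3,3) R(4,4)]
      unfolding n by (intro mult_mono) auto
    also have "\<dots> = (8 * R * R) * (a * b * h * n12)" by simp
    also have "\<dots> \<le> C * (a * b * h * n12)" using C ab0 h n0 by (intro mult_right_mono) auto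
    finally have 3: "\<bar>mom1 A * mom1 B * pr h c \<sigma>12 rhoP rhoP\<bar> \<le> C * (a * b * h * n12)" .
    have "\<bar>defect h c \<sigma> A B\<bar> = h\<^sup>2 * \<bar>pr h c \<sigma>11 (hat A) B
      + pr h c \<sigma>22 (\<lambda>x. mom0 A * rho0 x + mom1 A * rho1 x) (hat B) + mom1 A * mom1 B * pr h c \<sigma>12 rhoP rhoP\<bar>"
      by (subst defect_eq[OF h \<sigma>(1) w AB(1-4) z]) (auto simp: abs_mult)
    also have "\<dots> \<le> h\<^sup>2 * (C * (a * b * h * n11) + C * (a * b * h * n22) + C * (a * b * h * n12))"
      using 1 2 3 by (intro mult_left_mono) auto
    also have "\<dots> = C * (a * b) * h ^ 3 * (n11 + n12 + n22)" by (simp add: power2_eq_square power3_eq_cube algebra_simps)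
    finally show "\<bar>defect h c \<sigma> A B\<bar> \<le> C * (a * b) * h ^ 3 *
       (L2_norm (cell h c) \<sigma>11 + L2_norm (cell h c) \<sigma>12 + L2_norm (cell h c) \<sigma>22)" unfolding n .
  qed
qed

section \<open>Removing the support condition by cutoffs\<close>

lemma mom_cutoff_tendsto:
  assumes "smooth1 A"
  shows "(\<lambda>n. mom0 (\<lambda>x. cutoff (-1) 1 n x * A x)) \<longlonglongrightarrow> mom0 A"
    and "(\<lambda>n. mom1 (\<lambda>x. cutoff (-1) 1 n x * A x)) \<longlonglongrightarrow> mom1 A"
proof -
  have gen: "(\<lambda>n. integral {-1..1} (\<lambda>x. cutoff (-1) 1 n x * F x)) \<longlonglongrightarrow> integral {-1..1} F" if F: "smooth1 F" for F
  proof -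
    have i: "(\<lambda>x. cutoff (-1) 1 n x * F x) integrable_on {-1<..<1}" "(\<lambda>x. \<bar>F x\<bar>) integrable_on {-1<..<1}" for n
      using smooth1_integrable[OF smooth1_mult[OF smooth1_cutoff F], of "-1" 1 n "-1" 1]
        integrable_continuous_interval[of "-1" 1 "\<lambda>x. \<bar>F x\<bar>"] smooth1_continuous_on[OF F]
      by (auto simp: integrable_on_open_interval_real intro!: continuous_intros)
    have "(\<lambda>n. integral {-1<..<1} (\<lambda>x. cutoff (-1) 1 n x * F x)) \<longlonglongrightarrow> integral {-1<..<1} F"
    proof (rule dominated_convergence(2)[where h = "\<lambda>x. \<bar>F x\<bar>", OF i])
      show "norm (cutoff (-1) 1 n x * F x) \<le> \<bar>F x\<bar>" for n x
        using cutoff_bounds[of "-1" 1 n x] by (simp add: abs_mult mult_left_le_one_le)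
      show "(\<lambda>n. cutoff (-1) 1 n x * F x) \<longlonglongrightarrow> F x" if "x \<in> {-1<..<1}" for x
        using tendsto_mult[OF cutoff_tendsto[of "-1" 1 x] tendsto_const[of "F x"]] that by simp
    qed
    then show ?thesis by (simp add: integral_open_interval_real)
  qed
  show "(\<lambda>n. mom0 (\<lambda>x. cutoff (-1) 1 n x * A x)) \<longlonglongrightarrow> mom0 A"
    unfolding mom0_def by (rule gen[OF assms])
  show "(\<lambda>n. mom1 (\<lambda>x. cutoff (-1) 1 n x * A x)) \<longlonglongrightarrow> mom1 A"
    using gen[OF smooth1_mult[OF smooth1_id assms]] unfolding mom1_def by (simp add: mult.left_commute)
qed

lemma pr_cutoff_tendsto:
  assumes h: "h > 0" and \<sigma>: "L2 (cell h c) \<sigma>" and AB: "smooth1 A" "smooth1 B"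
  shows "(\<lambda>n. pr h c \<sigma> (\<lambda>x. cutoff (-1) 1 n x * A x) (\<lambda>x. cutoff (-1) 1 n x * B x)) \<longlonglongrightarrow> pr h c \<sigma> A B"
  unfolding pr_def
proof (rule integral_dominated_convergence[where w = "\<lambda>x. norm (\<sigma> x * ctens h c A B x)"])
  note i = pr_integrable[OF h \<sigma>]
  show "integrable (lebesgue_on (cell h c)) (\<lambda>x. norm (\<sigma> x * ctens h c A B x))"
    by (rule integrable_norm[OF i[OF AB]])
  show "(\<lambda>x. \<sigma> x * ctens h c A B x) \<in> borel_measurable (lebesgue_on (cell h c))"
    using i[OF AB] by (rule borel_measurable_integrable)
  show "(\<lambda>x. \<sigma> x * ctens h c (\<lambda>x. cutoff (-1) 1 n x * A x) (\<lambda>x. cutoff (-1) 1 n x * B x) x)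
      \<in> borel_measurable (lebesgue_on (cell h c))" for n
    by (rule borel_measurable_integrable[OF i]) (intro smooth1_mult smooth1_cutoff AB)+
  show "AE x in lebesgue_on (cell h c). (\<lambda>n. \<sigma> x * ctens h c (\<lambda>x. cutoff (-1) 1 n x * A x) (\<lambda>x. cutoff (-1) 1 n x * B x) x)
      \<longlonglongrightarrow> \<sigma> x * ctens h c A B x"
  proof (rule AE_I2)
    fix x assume "x \<in> space (lebesgue_on (cell h c))"
    then have x: "x \<in> cell h c" by simp
    have "(\<lambda>n. cutoff (-1) 1 n ((x $ i - c $ i) / h)) \<longlonglongrightarrow> 1" if "i = 1 \<or> i = 2" for i
      using cutoff_tendsto[of "-1" 1 "(x $ i - c $ i) / h"] cell_coord[OF h x] that by auto
    then have "(\<lambda>n. \<sigma> x * ((cutoff (-1) 1 n ((x $ 1 - c $ 1) / h) * A ((x $ 1 - c $ 1) / h)) *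
        (cutoff (-1) 1 n ((x $ 2 - c $ 2) / h) * B ((x $ 2 - c $ 2) / h))))
      \<longlonglongrightarrow> \<sigma> x * ((1 * A ((x $ 1 - c $ 1) / h)) * (1 * B ((x $ 2 - c $ 2) / h)))"
      by (intro tendsto_mult tendsto_const) auto
    then show "(\<lambda>n. \<sigma> x * ctens h c (\<lambda>x. cutoff (-1) 1 n x * A x) (\<lambda>x. cutoff (-1) 1 n x * B x) x)
      \<longlonglongrightarrow> \<sigma> x * ctens h c A B x" by (simp add: ctens_eq)
  qed
  show "AE x in lebesgue_on (cell h c). norm (\<sigma> x * ctens h c (\<lambda>x. cutoff (-1) 1 n x * A x) (\<lambda>x. cutoff (-1) 1 n x * B x) x)
      \<le> norm (\<sigma> x * ctens h c A B x)" for n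
  proof (rule AE_I2)
    fix x
    have "\<bar>cutoff (-1) 1 n y * F y\<bar> \<le> \<bar>F y\<bar>" for y F
      using cutoff_bounds[of "-1" 1 n y] by (simp add: abs_mult mult_left_le_one_le)
    then show "norm (\<sigma> x * ctens h c (\<lambda>x. cutoff (-1) 1 n x * A x) (\<lambda>x. cutoff (-1) 1 n x * B x) x)
      \<le> norm (\<sigma> x * ctens h c A B x)"
      unfolding ctens_eq real_norm_def abs_mult[of "\<sigma> x"] abs_mult[of "cutoff _ _ _ _ * A _"] abs_mult[of "A _" "B _"]
      by (intro mult_left_mono mult_mono) auto
  qed
qed

text \<open>The polynomials and the vertex functions do not vanish near the ends of [-1, 1], so the
  compact case does not apply to them. Cutoffs do not increase the bounds \<open>a\<close> and
  \<open>b\<close>, and moments and pairings converge, so the estimate survives the limit.\<close>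

lemma defect_bound:
  "\<exists>C\<ge>0. \<forall>h c \<sigma> \<sigma>11 \<sigma>12 \<sigma>22 A B a b. h > 0 \<longrightarrow> L2 (cell h c) \<sigma> \<longrightarrow>
     L2 (cell h c) \<sigma>11 \<longrightarrow> L2 (cell h c) \<sigma>12 \<longrightarrow> L2 (cell h c) \<sigma>22 \<longrightarrow>
     cell_weak h c 2 0 \<sigma> \<sigma>11 \<longrightarrow> cell_weak h c 1 1 \<sigma> \<sigma>12 \<longrightarrow> cell_weak h c 0 2 \<sigma> \<sigma>22 \<longrightarrow>
     smooth1 A \<longrightarrow> smooth1 B \<longrightarrow> (\<forall>x\<in>{-1..1}. \<bar>A x\<bar> \<le> a \<and> \<bar>B x\<bar> \<le> b) \<longrightarrow>
     \<bar>defect h c \<sigma> A B\<bar> \<le> C * (a * b) * h ^ 3 *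
       (L2_norm (cell h c) \<sigma>11 + L2_norm (cell h c) \<sigma>12 + L2_norm (cell h c) \<sigma>22)"
proof -
  from defect_bound_compact obtain C where C: "C \<ge> 0"
    "\<And>h c \<sigma> \<sigma>11 \<sigma>12 \<sigma>22 A B a b r. h > 0 \<Longrightarrow> L2 (cell h c) \<sigma> \<Longrightarrow>
     L2 (cell h c) \<sigma>11 \<Longrightarrow> L2 (cell h c) \<sigma>12 \<Longrightarrow> L2 (cell h c) \<sigma>22 \<Longrightarrow>
     cell_weak h c 2 0 \<sigma> \<sigma>11 \<Longrightarrow> cell_weak h c 1 1 \<sigma> \<sigma>12 \<Longrightarrow> cell_weak h c 0 2 \<sigma> \<sigma>22 \<Longrightarrow>
     smooth1 A \<Longrightarrow> smooth1 B \<Longrightarrow> 1/2 \<le> r \<Longrightarrow> r < 1 \<Longrightarrow> (\<forall>x. x \<notin> {-r..r} \<longrightarrow> A x = 0 \<and> B x = 0) \<Longrightarrow>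
     (\<forall>x\<in>{-1..1}. \<bar>A x\<bar> \<le> a \<and> \<bar>B x\<bar> \<le> b) \<Longrightarrow>
     \<bar>defect h c \<sigma> A B\<bar> \<le> C * (a * b) * h ^ 3 *
       (L2_norm (cell h c) \<sigma>11 + L2_norm (cell h c) \<sigma>12 + L2_norm (cell h c) \<sigma>22)"
    by blast
  show ?thesis
  proof (intro exI[of _ C] conjI C(1) allI impI)
    fix h c \<sigma> \<sigma>11 \<sigma>12 \<sigma>22 A B a b
    assume h: "h > 0" and \<sigma>: "L2 (cell h c) \<sigma>" "L2 (cell h c) \<sigma>11" "L2 (cell h c) \<sigma>12" "L2 (cell h c) \<sigma>22"
      and w: "cell_weak h c 2 0 \<sigma> \<sigma>11" "cell_weak h c 1 1 \<sigma> \<sigma>12" "cell_weak h c 0 2 \<sigma> \<sigma>22"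
      and AB: "smooth1 A" "smooth1 B" and ab: "\<forall>x\<in>{-1..1}. \<bar>A x\<bar> \<le> a \<and> \<bar>B x\<bar> \<le> b"
    let ?A = "\<lambda>n x. cutoff (-1) 1 n x * A x" and ?B = "\<lambda>n x. cutoff (-1) 1 n x * B x"
    let ?S = "L2_norm (cell h c) \<sigma>11 + L2_norm (cell h c) \<sigma>12 + L2_norm (cell h c) \<sigma>22"
    have lim: "(\<lambda>n. defect h c \<sigma> (?A n) (?B n)) \<longlonglongrightarrow> defect h c \<sigma> A B"
      unfolding defect_def
      by (intro tendsto_diff tendsto_add tendsto_mult tendsto_const pr_cutoff_tendsto[OF h \<sigma>(1) AB]
          mom_cutoff_tendsto AB)
    \<comment> \<open>The support radius 1 - 1/(n+1) reaches 1/2, as the compact case demands, from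
      n = 1 on.\<close>
    have "\<bar>defect h c \<sigma> (?A n) (?B n)\<bar> \<le> C * (a * b) * h ^ 3 * ?S" if "n \<ge> 1" for n
    proof (rule C(2)[OF h \<sigma> w, where r = "1 - 1 / real (Suc n)"])
      show "smooth1 (?A n)" "smooth1 (?B n)" by (intro smooth1_mult smooth1_cutoff AB)+
      show "1/2 \<le> 1 - 1 / real (Suc n)" "1 - 1 / real (Suc n) < 1" using that by (auto simp: field_simps)
      show "\<forall>x. x \<notin> {- (1 - 1 / real (Suc n))..1 - 1 / real (Suc n)} \<longrightarrow> ?A n x = 0 \<and> ?B n x = 0"
        using cutoff_zero[of _ "-1" n 1] by auto
      have "\<bar>?A n x\<bar> \<le> \<bar>A x\<bar>" "\<bar>?B n x\<bar> \<le> \<bar>B x\<bar>" for x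
        using cutoff_bounds[of "-1" 1 n x] by (simp_all add: abs_mult mult_left_le_one_le)
      then show "\<forall>x\<in>{-1..1}. \<bar>?A n x\<bar> \<le> a \<and> \<bar>?B n x\<bar> \<le> b" using ab order_trans by blast
    qed
    then have "\<forall>\<^sub>F n in sequentially. \<bar>defect h c \<sigma> (?A n) (?B n)\<bar> \<le> C * (a * b) * h ^ 3 * ?S"
      unfolding eventually_sequentially by blast
    then show "\<bar>defect h c \<sigma> A B\<bar> \<le> C * (a * b) * h ^ 3 * ?S"
      using tendsto_upperbound[OF tendsto_rabs[OF lim]] by simp
  qed
qed

section \<open>Reference functions\<close>

text \<open>The multiple of the odd function \<open>deriv bump\<close> removes the first moment.\<close>

definition stp :: "real \<Rightarrow> real" where
  "stp x = step x + mom1 step / 2 * deriv bump x"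

lemma smooth1_stp: "smooth1 stp"
  unfolding stp_def[abs_def] by (intro smooth1_add smooth1_mult smooth1_const smooth1_step smooth1_deriv smooth1_bump)

lemma stp_eq_0: "x < -1/2 \<Longrightarrow> stp x = 0"
  and stp_eq_1: "x > 1/2 \<Longrightarrow> stp x = 1"
  by (simp_all add: stp_def step_eq_0 step_eq_1 deriv_bump_zero)

text \<open>Integrating \<open>x * deriv step x\<close> by parts gives \<open>mom0 step = 1\<close>,
  because half a bump has first moment zero. The moments of \<open>deriv bump\<close> are 0 and -2,
  so the multiple in \<open>stp\<close> changes the first moment only and by the right
  amount.\<close>

lemma mom_stp: "mom0 stp = 1" "mom1 stp = 0"
proof -
  have ds: "deriv step = (\<lambda>x. 1/2 * bump x)"
    using step_DERIV DERIV_imp_deriv by fastforce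
  have "mom1 (deriv step) = 0" unfolding ds mom_cmult by (simp add: mom1_bump)
  then have ms: "mom0 step = 1"
    using mom_deriv(2)[OF smooth1_step] by (simp add: step_eq_0 step_eq_1)
  have mb: "mom0 (deriv bump) = 0" "mom1 (deriv bump) = -2"
    using mom_deriv[OF smooth1_bump] by (simp_all add: bump_zero mom0_bump)
  have s: "smooth1 (\<lambda>x. mom1 step / 2 * deriv bump x)"
    by (intro smooth1_mult smooth1_const smooth1_deriv smooth1_bump)
  show "mom0 stp = 1" "mom1 stp = 0"
    unfolding stp_def[abs_def] mom_add[OF smooth1_step s] mom_cmult by (simp_all add: ms mb)
qed

text \<open>Smooth counterparts of the Hermite functions of the vertex 0: \<open>psi\<close> carries the value and \<open>theta\<close> the
  slope. The restrictions to the two cells meeting at 0 are \<open>psiL\<close>, \<open>stp\<close> and \<open>thL\<close>, \<open>thR\<close>.\<close>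

definition psi :: "real \<Rightarrow> real" where
  "psi t = stp (1 * t + 1) - stp (1 * t + (-1))"

definition theta :: "real \<Rightarrow> real" where
  "theta t = t * psi t - 1/2 * bump (1 * t + (-1)) + 1/2 * bump (1 * t + 1)"

lemma smooth1_psi: "smooth1 psi"
  unfolding psi_def[abs_def] by (intro smooth1_diff smooth1_affine smooth1_stp)

lemma smooth1_theta: "smooth1 theta"
  unfolding theta_def[abs_def]
  by (intro smooth1_diff smooth1_add smooth1_mult smooth1_const smooth1_id smooth1_affine smooth1_psi smooth1_bump)

lemma psi_zero: "\<bar>t\<bar> > 3/2 \<Longrightarrow> psi t = 0"
  by (cases "t > 0") (auto simp: psi_def stp_eq_0 stp_eq_1)

lemma theta_zero: "\<bar>t\<bar> > 3/2 \<Longrightarrow> theta t = 0"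
  by (cases "t > 0") (auto simp: theta_def psi_zero bump_zero)

definition psiL :: "real \<Rightarrow> real" where "psiL x = 1 - stp x"
definition thL :: "real \<Rightarrow> real" where "thL x = (x + 1) * (1 - stp x) - 1/2 * bump x"
definition thR :: "real \<Rightarrow> real" where "thR x = (x - 1) * stp x + 1/2 * bump x"

text \<open>In units of h the centres of the two cells are at distance 1 from the vertex. The cell
  on its right has the vertex at x = -1, so t = x + 1 there; the cell on its left has it at x =
  1.\<close>

lemma psi_shift:
  assumes "x \<in> {-1<..<1}"
  shows "psi (x + 1) = psiL x" "psi (x - 1) = stp x"
  using assms by (auto simp: psi_def psiL_def stp_eq_0 stp_eq_1)

lemma theta_shift:
  assumes "x \<in> {-1<..<1}"
  shows "theta (x + 1) = thL x" "theta (x - 1) = thR x"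
  using psi_shift[OF assms] assms by (auto simp: theta_def thL_def thR_def bump_zero psiL_def)

lemma smooth1_ref: "smooth1 psiL" "smooth1 thL" "smooth1 thR"
  unfolding psiL_def[abs_def] thL_def[abs_def] thR_def[abs_def]
  by (intro smooth1_diff smooth1_add smooth1_mult smooth1_const smooth1_id smooth1_stp smooth1_bump)+

definition pw :: "nat \<Rightarrow> real \<Rightarrow> real" where "pw n x = x ^ n"

lemma smooth1_pw: "smooth1 (pw n)"
  unfolding pw_def[abs_def] by (intro smooth1_power smooth1_id)

lemmas smooth1_all = smooth1_ref smooth1_stp smooth1_bump smooth1_pw

subsection \<open>Boundary values and moments of the reference functions\<close>

lemma deriv_stp_pm1: "deriv stp 1 = 0" "deriv stp (-1) = 0"
proof -
  have "deriv (\<lambda>x. stp x - 1) 1 = 0"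
    by (rule deriv_zero_off[of "{1/2<..}"]) (auto simp: stp_eq_1)
  moreover have "deriv (\<lambda>x. stp x - 1) 1 = deriv stp 1"
    by (rule DERIV_imp_deriv) (auto intro!: derivative_eq_intros smooth1_DERIV smooth1_stp)
  ultimately show "deriv stp 1 = 0" by simp
  show "deriv stp (-1) = 0"
    by (rule deriv_zero_off[of "{..<-1/2}"]) (auto simp: stp_eq_0)
qed

lemma deriv_ref:
  "deriv psiL = (\<lambda>x. - deriv stp x)"
  "deriv thL = (\<lambda>x. (1 - stp x) - (x + 1) * deriv stp x - 1/2 * deriv bump x)"
  "deriv thR = (\<lambda>x. stp x + (x - 1) * deriv stp x + 1/2 * deriv bump x)"
  "deriv (pw n) = (\<lambda>x. real n * x ^ (n - 1))"
  unfolding psiL_def[abs_def] thL_def[abs_def] thR_def[abs_def] pw_def[abs_def]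
  by (rule ext, rule DERIV_imp_deriv,
      auto intro!: derivative_eq_intros smooth1_DERIV smooth1_stp smooth1_bump)+

lemma ref_values:
  "stp 1 = 1" "stp (-1) = 0" "psiL 1 = 0" "psiL (-1) = 1" "thL 1 = 0" "thL (-1) = 0"
  "thR 1 = 0" "thR (-1) = 0" "bump 1 = 0" "bump (-1) = 0"
  "deriv psiL 1 = 0" "deriv psiL (-1) = 0" "deriv thL 1 = 0" "deriv thL (-1) = 1"
  "deriv thR 1 = 1" "deriv thR (-1) = 0" "deriv bump 1 = 0" "deriv bump (-1) = 0"
  by (simp_all add: psiL_def thL_def thR_def deriv_ref stp_eq_0 stp_eq_1 bump_zero deriv_bump_zero deriv_stp_pm1)

lemma mom_pw: "mom0 (pw n) = (1 - (-1) ^ Suc n) / real (Suc n)"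
  "mom1 (pw n) = (1 - (-1) ^ (n + 2)) / real (n + 2)"
proof -
  have g: "integral {-1..1} (\<lambda>x::real. x ^ n) = (1 - (-1) ^ Suc n) / real (Suc n)" for n
  proof -
    have "((\<lambda>x::real. x ^ n) has_integral (1 ^ Suc n / real (Suc n) - (-1) ^ Suc n / real (Suc n))) {-1..1}"
      by (rule fundamental_theorem_of_calculus)
         (auto simp: has_real_derivative_iff_has_vector_derivative[symmetric] simp del: power_Suc of_nat_Suc
          intro!: derivative_eq_intros)
    then show ?thesis by (simp add: integral_unique diff_divide_distrib add_divide_distrib)
  qed
  show "mom0 (pw n) = (1 - (-1) ^ Suc n) / real (Suc n)"
    using g[of n] by (simp add: mom0_def pw_def[abs_def])
  have "(\<lambda>x. x * pw n x) = (\<lambda>x::real. x ^ Suc n)" by (simp add: pw_def)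
  then show "mom1 (pw n) = (1 - (-1) ^ (n + 2)) / real (n + 2)"
    using g[of "Suc n"] by (simp add: mom1_def)
qed

text \<open>The half bumps in \<open>thL\<close> and \<open>thR\<close> are there for the last two
  equations: (x + 1) \<open>psiL\<close> has integral \<open>mom1 psiL + mom0 psiL = 1\<close>, and
  half a bump has integral 1 as well. Slopes at a vertex thus do not change the integral of the
  companion along an edge.\<close>

lemma mom_ref: "mom0 psiL = 1" "mom1 psiL = 0" "mom0 thL = 0" "mom0 thR = 0"
proof -
  have one: "mom0 (\<lambda>x. 1) = 2" "mom1 (\<lambda>x. 1) = 0" "mom0 (\<lambda>x. x) = 0"
    using mom_pw[of 0] mom_pw(1)[of 1] by (simp_all add: pw_def[abs_def])
  show "mom0 psiL = 1" "mom1 psiL = 0"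
    unfolding psiL_def[abs_def] using mom_diff[of "\<lambda>x. 1" stp] smooth1_stp by (simp_all add: one mom_stp)
  have 1: "smooth1 (\<lambda>x. x * psiL x)" "smooth1 (\<lambda>x. x * stp x)" "smooth1 (\<lambda>x. 1/2 * bump x)"
    "smooth1 (\<lambda>x. x * psiL x + psiL x)" "smooth1 (\<lambda>x. x * stp x - stp x)"
    by (intro smooth1_mult smooth1_add smooth1_diff smooth1_all smooth1_id smooth1_const)+
  have x: "mom0 (\<lambda>x. x * psiL x) = mom1 psiL" "mom0 (\<lambda>x. x * stp x) = mom1 stp" by (simp_all add: mom0_def mom1_def)
  have "thL = (\<lambda>x. (x * psiL x + psiL x) - 1/2 * bump x)"
    by (auto simp: thL_def psiL_def fun_eq_iff algebra_simps)
  then show "mom0 thL = 0"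
    using mom_diff(1)[OF 1(4,3)] mom_add(1)[OF 1(1) smooth1_ref(1)] \<open>mom0 psiL = 1\<close> \<open>mom1 psiL = 0\<close>
    by (simp add: x mom_cmult(1) mom0_bump del: times_divide_eq_left)
  have "thR = (\<lambda>x. (x * stp x - stp x) + 1/2 * bump x)"
    by (auto simp: thR_def fun_eq_iff algebra_simps)
  then show "mom0 thR = 0"
    using mom_add(1)[OF 1(5,3)] mom_diff(1)[OF 1(2) smooth1_stp] mom_stp
    by (simp add: x mom_cmult(1) mom0_bump del: times_divide_eq_left)
qed

text \<open>Values and slopes at the two ends determine these moments. This is how agreement at
  vertices and edges becomes agreement of the moments of second derivatives.\<close>

lemma mom_deriv2:
  assumes "smooth1 A"
  shows "mom0 ((deriv ^^ 2) A) = deriv A 1 - deriv A (-1)"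
    "mom1 ((deriv ^^ 2) A) = deriv A 1 + deriv A (-1) - (A 1 - A (-1))"
  using mom_deriv[OF smooth1_deriv[OF assms]] mom_deriv(1)[OF assms] by (simp_all add: numeral_2_eq_2)

section \<open>The residual functional on one cell\<close>

text \<open>The difference a(u,v) - (f,v) on one cell, with v a rescaled product. Two derivatives of
  v give 1/h^2, and the mixed derivative counts twice since the Frobenius product contains it in
  both orders.\<close>

definition cell_residual :: "real \<Rightarrow> real^2 \<Rightarrow> (nat \<Rightarrow> real^2 \<Rightarrow> real) \<Rightarrow> (real^2 \<Rightarrow> real) \<Rightarrow> (real \<Rightarrow> real) \<Rightarrow> (real \<Rightarrow> real) \<Rightarrow> real" where
  "cell_residual h c s f A B = (1 / h\<^sup>2) * (pr h c (s 0) ((deriv ^^ 2) A) B + 2 * pr h c (s 1) (deriv A) (deriv B)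
     + pr h c (s 2) A ((deriv ^^ 2) B)) - pr h c f A B"

text \<open>Think of \<open>s i\<close> and \<open>t i\<close> as the derivatives of \<open>u\<close> of order 2 and 4 with \<open>i\<close> derivatives in the second
  variable.\<close>

definition cell_data :: "real \<Rightarrow> real^2 \<Rightarrow> (nat \<Rightarrow> real^2 \<Rightarrow> real) \<Rightarrow> (nat \<Rightarrow> real^2 \<Rightarrow> real) \<Rightarrow> (real^2 \<Rightarrow> real) \<Rightarrow> bool" where
  "cell_data h c s t f \<longleftrightarrow> h > 0 \<and> L2 (cell h c) f \<and> (\<forall>i<3. L2 (cell h c) (s i)) \<and> (\<forall>i<5. L2 (cell h c) (t i)) \<and>
     (\<forall>i<3. \<forall>j<3. cell_weak h c (2 - j) j (s i) (t (i + j)))"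

lemma smooth1_deriv2 [intro]: "smooth1 A \<Longrightarrow> smooth1 ((deriv ^^ 2) A)"
  by (rule smooth1_funpow_deriv)

lemma deriv_add: "smooth1 A \<Longrightarrow> smooth1 B \<Longrightarrow> deriv (\<lambda>x. A x + B x) = (\<lambda>x. deriv A x + deriv B x)"
  by (rule ext, rule DERIV_imp_deriv) (auto intro!: derivative_eq_intros smooth1_DERIV)

lemma deriv2_add: "smooth1 A \<Longrightarrow> smooth1 B \<Longrightarrow> (deriv ^^ 2) (\<lambda>x. A x + B x) = (\<lambda>x. (deriv ^^ 2) A x + (deriv ^^ 2) B x)"
  by (simp add: numeral_2_eq_2 deriv_add smooth1_deriv)

lemma deriv2_cmult: "smooth1 A \<Longrightarrow> (deriv ^^ 2) (\<lambda>x. k * A x) = (\<lambda>x. k * (deriv ^^ 2) A x)"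
  by (rule funpow_deriv_cmult)

lemma cell_residual_add1:
  assumes "cell_data h c s t f" "smooth1 A" "smooth1 A'" "smooth1 B"
  shows "cell_residual h c s f (\<lambda>x. A x + A' x) B = cell_residual h c s f A B + cell_residual h c s f A' B"
  using assms unfolding cell_residual_def cell_data_def
  by (simp add: deriv2_add deriv_add pr_add1 smooth1_deriv smooth1_deriv2 algebra_simps add_divide_distrib)

lemma cell_residual_add2:
  assumes "cell_data h c s t f" "smooth1 A" "smooth1 B" "smooth1 B'"
  shows "cell_residual h c s f A (\<lambda>x. B x + B' x) = cell_residual h c s f A B + cell_residual h c s f A B'"
  using assms unfolding cell_residual_def cell_data_def
  by (simp add: deriv2_add deriv_add pr_add2 smooth1_deriv smooth1_deriv2 algebra_simps add_divide_distrib)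

lemma cell_residual_cmult:
  assumes "smooth1 A" "smooth1 B"
  shows "cell_residual h c s f (\<lambda>x. k * A x) B = k * cell_residual h c s f A B" "cell_residual h c s f A (\<lambda>x. k * B x) = k * cell_residual h c s f A B"
  using assms unfolding cell_residual_def
  by (simp_all add: deriv2_cmult deriv_cmult pr_cmult algebra_simps)

lemma pr_cong:
  assumes "h > 0" "\<And>x. x \<in> {-1<..<1} \<Longrightarrow> A x = A' x" "\<And>x. x \<in> {-1<..<1} \<Longrightarrow> B x = B' x"
  shows "pr h c \<sigma> A B = pr h c \<sigma> A' B'"
  unfolding pr_def
  by (rule Bochner_Integration.integral_cong) (use cell_coord[OF assms(1)] assms(2,3) in \<open>auto simp: ctens_eq\<close>)

lemma deriv_cong_open:
  assumes "open U" "\<And>x. x \<in> U \<Longrightarrow> A x = A' (x::real)" "x \<in> U"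
  shows "deriv A x = deriv A' x"
  by (rule deriv_cong_ev) (use assms in \<open>auto simp: eventually_nhds\<close>)

text \<open>Derivatives are local on the open interval. This allows functions on the whole line,
  such as a shifted \<open>psi\<close>, to be replaced by the expressions that they have on a single
  cell.\<close>

lemma cell_residual_cong:
  assumes "h > 0" "\<And>x. x \<in> {-1<..<1} \<Longrightarrow> A x = A' x" "\<And>x. x \<in> {-1<..<1} \<Longrightarrow> B x = B' x"
  shows "cell_residual h c s f A B = cell_residual h c s f A' B'"
proof -
  have d: "deriv F x = deriv F' x" if "x \<in> {-1<..<1}" "\<And>x. x \<in> {-1<..<1} \<Longrightarrow> F x = F' x" for F F' :: "real \<Rightarrow> real" and x
    by (rule deriv_cong_open[of "{-1<..<1}"]) (use that in auto)
  have d2: "(deriv ^^ 2) F x = (deriv ^^ 2) F' x" if "x \<in> {-1<..<1}" "\<And>x. x \<in> {-1<..<1} \<Longrightarrow> F x = F' x" for F F' :: "real \<Rightarrow> real" and x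
    unfolding numeral_2_eq_2 by (simp, rule d[OF that(1)], rule d) (use that in auto)
  have p: "pr h c \<sigma> (F A) (G B) = pr h c \<sigma> (F A') (G B')"
    if "\<And>x. x \<in> {-1<..<1} \<Longrightarrow> F A x = F A' x" "\<And>x. x \<in> {-1<..<1} \<Longrightarrow> G B x = G B' x" for F G \<sigma>
    by (rule pr_cong[OF assms(1)]) (use that in auto)
  show ?thesis unfolding cell_residual_def
    using p[of "deriv ^^ 2" "\<lambda>B. B"] p[of deriv deriv] p[of "\<lambda>A. A" "deriv ^^ 2"] p[of "\<lambda>A. A" "\<lambda>B. B"]
      d[of _ A A'] d[of _ B B'] d2[of _ A A'] d2[of _ B B'] assms(2,3)
    by simp
qed

lemma cell_residual_zero: "h > 0 \<Longrightarrow> smooth1 B \<Longrightarrow> (\<And>x. x \<in> {-1<..<1} \<Longrightarrow> A x = 0) \<Longrightarrow> cell_residual h c s f A B = 0"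
  and cell_residual_zero': "h > 0 \<Longrightarrow> smooth1 A \<Longrightarrow> (\<And>x. x \<in> {-1<..<1} \<Longrightarrow> B x = 0) \<Longrightarrow> cell_residual h c s f A B = 0"
proof -
  assume "h > 0" "smooth1 B" "\<And>x. x \<in> {-1<..<1} \<Longrightarrow> A x = 0"
  then have "cell_residual h c s f A B = cell_residual h c s f (\<lambda>x. 0 * bump x) B" by (intro cell_residual_cong) auto
  then show "cell_residual h c s f A B = 0" using cell_residual_cmult(1)[OF smooth1_bump \<open>smooth1 B\<close>, of h c s f 0] by simp
next
  assume "h > 0" "smooth1 A" "\<And>x. x \<in> {-1<..<1} \<Longrightarrow> B x = 0"
  then have "cell_residual h c s f A B = cell_residual h c s f A (\<lambda>x. 0 * bump x)" by (intro cell_residual_cong) auto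
  then show "cell_residual h c s f A B = 0" using cell_residual_cmult(2)[OF \<open>smooth1 A\<close> smooth1_bump, of h c s f 0] by simp
qed

text \<open>Every second derivative of the sum of products is orthogonal to the affine functions.\<close>

definition moment_sums_zero :: "(real \<times> (real \<Rightarrow> real) \<times> (real \<Rightarrow> real)) list \<Rightarrow> bool" where
  "moment_sums_zero ts \<longleftrightarrow> (\<forall>i<3.
     (\<Sum>(k, A, B)\<leftarrow>ts. k * (mom0 ((deriv ^^ (2 - i)) A) * mom0 ((deriv ^^ i) B))) = 0 \<and>
     (\<Sum>(k, A, B)\<leftarrow>ts. k * (mom0 ((deriv ^^ (2 - i)) A) * mom1 ((deriv ^^ i) B))) = 0 \<and>
     (\<Sum>(k, A, B)\<leftarrow>ts. k * (mom1 ((deriv ^^ (2 - i)) A) * mom0 ((deriv ^^ i) B))) = 0)"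

lemma abs_sum_list_le:
  "(\<And>x. x \<in> set xs \<Longrightarrow> \<bar>f x\<bar> \<le> (m::real)) \<Longrightarrow> \<bar>\<Sum>x\<leftarrow>xs. f x\<bar> \<le> real (length xs) * m"
proof (induction xs)
  case (Cons x xs)
  then have "\<bar>f x\<bar> \<le> m" "\<bar>\<Sum>x\<leftarrow>xs. f x\<bar> \<le> real (length xs) * m" by auto
  then show ?case by (simp add: distrib_right)
qed simp

lemma smooth_pairs_bounded:
  assumes "finite P" "\<forall>(A, B)\<in>P. smooth1 A \<and> smooth1 B"
  shows "\<exists>b\<ge>0. \<forall>(A, B)\<in>P. \<forall>i<3. \<forall>x\<in>{-1..1}. \<bar>(deriv ^^ i) A x\<bar> \<le> b \<and> \<bar>(deriv ^^ i) B x\<bar> \<le> b"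
  using assms
proof (induction P)
  case (insert p P)
  then obtain b where b: "b \<ge> 0" "\<forall>(A, B)\<in>P. \<forall>i<3. \<forall>x\<in>{-1..1}. \<bar>(deriv ^^ i) A x\<bar> \<le> b \<and> \<bar>(deriv ^^ i) B x\<bar> \<le> b"
    by auto
  obtain A B where p: "p = (A, B)" by force
  have s: "smooth1 A" "smooth1 B" using insert.prems p by auto
  have ex: "\<exists>m\<ge>0. \<forall>i<3. \<forall>x\<in>{-1..1}. \<bar>(deriv ^^ i) F x\<bar> \<le> m" if F: "smooth1 F" for F
  proof -
    obtain m where m: "\<And>i. m i \<ge> 0" "\<And>i x. x \<in> {-1..1} \<Longrightarrow> \<bar>(deriv ^^ i) F x\<bar> \<le> m i"
      using smooth1_bounded[OF smooth1_funpow_deriv[OF F]] by metis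
    show ?thesis
    proof (intro exI[of _ "m 0 + m 1 + m 2"] conjI allI impI ballI)
      fix i :: nat and x :: real assume "i < 3" "x \<in> {-1..1}"
      then have "\<bar>(deriv ^^ i) F x\<bar> \<le> m i" "i = 0 \<or> i = 1 \<or> i = 2" using m by auto
      then show "\<bar>(deriv ^^ i) F x\<bar> \<le> m 0 + m 1 + m 2" using m(1)[of 0] m(1)[of 1] m(1)[of 2] by auto
    qed (use m(1) in \<open>simp add: add_nonneg_nonneg\<close>)
  qed
  obtain mA where mA: "mA \<ge> 0" "\<forall>i<3. \<forall>x\<in>{-1..1}. \<bar>(deriv ^^ i) A x\<bar> \<le> mA"
    using ex[OF s(1)] by blast
  obtain mB where mB: "mB \<ge> 0" "\<forall>i<3. \<forall>x\<in>{-1..1}. \<bar>(deriv ^^ i) B x\<bar> \<le> mB"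
    using ex[OF s(2)] by blast
  have le: "y \<le> mA \<Longrightarrow> y \<le> b + mA + mB" "y \<le> mB \<Longrightarrow> y \<le> b + mA + mB" "y \<le> b \<Longrightarrow> y \<le> b + mA + mB" for y
    using b(1) mA(1) mB(1) by auto
  show ?case
  proof (intro exI[of _ "b + mA + mB"] conjI)
    show "0 \<le> b + mA + mB" using b(1) mA(1) mB(1) by simp
    show "\<forall>(A, B)\<in>insert p P. \<forall>i<3. \<forall>x\<in>{-1..1}. \<bar>(deriv ^^ i) A x\<bar> \<le> b + mA + mB \<and> \<bar>(deriv ^^ i) B x\<bar> \<le> b + mA + mB"
      unfolding p using b(2) mA(2) mB(2) le by fast
  qed
qed (auto intro: exI[of _ 0])

text \<open>A finite set of factor pairs gives bounds that hold on all cells at once. In the Hessian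
  part 1/h^2 meets the \<open>h ^ 3\<close> of the defect estimate; the load part is bounded
  directly and has its h from the area.\<close>

lemma residual_bound:
  assumes P: "finite P" "\<forall>(A, B)\<in>P. smooth1 A \<and> smooth1 B"
  shows "\<exists>C\<ge>0. \<forall>h c s t f M ts. cell_data h c s t f \<longrightarrow> moment_sums_zero ts \<longrightarrow> snd ` set ts \<subseteq> P \<longrightarrow>
    (\<forall>p\<in>set ts. \<bar>fst p\<bar> \<le> M) \<longrightarrow>
    \<bar>\<Sum>(k, A, B)\<leftarrow>ts. k * cell_residual h c s f A B\<bar> \<le> C * real (length ts) * M * h *
      (L2_norm (cell h c) f + (\<Sum>i<5. L2_norm (cell h c) (t i)))"
proof -
  obtain b where b: "b \<ge> 0" "\<And>A B i x. (A, B) \<in> P \<Longrightarrow> i < 3 \<Longrightarrow> x \<in> {-1..1} \<Longrightarrow> \<bar>(deriv ^^ i) A x\<bar> \<le> b"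
    "\<And>A B i x. (A, B) \<in> P \<Longrightarrow> i < 3 \<Longrightarrow> x \<in> {-1..1} \<Longrightarrow> \<bar>(deriv ^^ i) B x\<bar> \<le> b"
    using smooth_pairs_bounded[OF P] by fast
  from defect_bound obtain D where D: "D \<ge> 0"
    "\<And>h c \<sigma> \<sigma>11 \<sigma>12 \<sigma>22 A B a b. h > 0 \<Longrightarrow> L2 (cell h c) \<sigma> \<Longrightarrow>
     L2 (cell h c) \<sigma>11 \<Longrightarrow> L2 (cell h c) \<sigma>12 \<Longrightarrow> L2 (cell h c) \<sigma>22 \<Longrightarrow>
     cell_weak h c 2 0 \<sigma> \<sigma>11 \<Longrightarrow> cell_weak h c 1 1 \<sigma> \<sigma>12 \<Longrightarrow> cell_weak h c 0 2 \<sigma> \<sigma>22 \<Longrightarrow>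
     smooth1 A \<Longrightarrow> smooth1 B \<Longrightarrow> (\<forall>x\<in>{-1..1}. \<bar>A x\<bar> \<le> a \<and> \<bar>B x\<bar> \<le> b) \<Longrightarrow>
     \<bar>defect h c \<sigma> A B\<bar> \<le> D * (a * b) * h ^ 3 *
       (L2_norm (cell h c) \<sigma>11 + L2_norm (cell h c) \<sigma>12 + L2_norm (cell h c) \<sigma>22)"
    by blast
  \<comment> \<open>The 4 is 1 + 2 + 1 for the entries of the Hessian; the 2 stems from
    \<open>2 * h\<close> in \<open>pr_bound\<close>.\<close>
  define C where "C = 4 * (D * (b * b)) + 2 * (b * b)"
  have C0: "D * (b * b) \<ge> 0" "b * b \<ge> 0" using D(1) b(1) by auto
  show ?thesis
  proof (intro exI[of _ C] conjI allI impI)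
    show "C \<ge> 0" using C0 by (simp add: C_def)
    fix h c s t f M and ts :: "(real \<times> (real \<Rightarrow> real) \<times> (real \<Rightarrow> real)) list"
    assume cd: "cell_data h c s t f" and mz: "moment_sums_zero ts" and tP: "snd ` set ts \<subseteq> P"
      and M: "\<forall>p\<in>set ts. \<bar>fst p\<bar> \<le> M"
    define N where "N = (\<Sum>i<5. L2_norm (cell h c) (t i))"
    define n where "n i = L2_norm (cell h c) (t i)" for i
    have n0: "n i \<ge> 0" for i by (simp add: n_def L2_norm_nonneg)
    have NE: "N = n 0 + n 1 + n 2 + n 3 + n 4" by (simp add: N_def n_def eval_nat_numeral)
    have h: "h > 0" using cd by (simp add: cell_data_def)
    have N0: "N \<ge> 0" using n0 by (simp add: NE add_nonneg_nonneg)
    let ?len = "real (length ts)"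
    have part: "\<bar>\<Sum>(k, A, B)\<leftarrow>ts. k * pr h c (s i) ((deriv ^^ (2 - i)) A) ((deriv ^^ i) B)\<bar>
        \<le> ?len * (M * (D * (b * b) * h ^ 3 * N))" if i: "i < 3" for i
    proof -
      \<comment> \<open>Passing from pairings to defects changes the sum only by multiples of the
        three moment sums, which are zero.\<close>
      have lin: "(\<Sum>(k, A, B)\<leftarrow>ts. k * defect h c (s i) ((deriv ^^ (2 - i)) A) ((deriv ^^ i) B)) =
        (\<Sum>(k, A, B)\<leftarrow>ts. k * pr h c (s i) ((deriv ^^ (2 - i)) A) ((deriv ^^ i) B))
        - ((\<Sum>(k, A, B)\<leftarrow>ts. k * (mom0 ((deriv ^^ (2 - i)) A) * mom0 ((deriv ^^ i) B))) * pr h c (s i) rho0 rho0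
          + (\<Sum>(k, A, B)\<leftarrow>ts. k * (mom0 ((deriv ^^ (2 - i)) A) * mom1 ((deriv ^^ i) B))) * pr h c (s i) rho0 rho1
          + (\<Sum>(k, A, B)\<leftarrow>ts. k * (mom1 ((deriv ^^ (2 - i)) A) * mom0 ((deriv ^^ i) B))) * pr h c (s i) rho1 rho0)"
        by (induction ts) (auto simp: defect_def algebra_simps)
      then have "(\<Sum>(k, A, B)\<leftarrow>ts. k * pr h c (s i) ((deriv ^^ (2 - i)) A) ((deriv ^^ i) B)) =
        (\<Sum>(k, A, B)\<leftarrow>ts. k * defect h c (s i) ((deriv ^^ (2 - i)) A) ((deriv ^^ i) B))"
        using mz i unfolding moment_sums_zero_def by simp
      also have "\<bar>\<dots>\<bar> \<le> ?len * (M * (D * (b * b) * h ^ 3 * N))"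
      proof (rule abs_sum_list_le, clarify)
        fix k A B assume m: "(k, A, B) \<in> set ts"
        then have AB: "(A, B) \<in> P" using tP by force
        have sAB: "smooth1 A" "smooth1 B" using P(2) AB by auto
        have "\<bar>defect h c (s i) ((deriv ^^ (2 - i)) A) ((deriv ^^ i) B)\<bar> \<le> D * (b * b) * h ^ 3 * (n i + n (i + 1) + n (i + 2))"
          unfolding n_def
        proof (rule D(2)[OF h])
          show "L2 (cell h c) (s i)" "L2 (cell h c) (t i)" "L2 (cell h c) (t (i + 1))" "L2 (cell h c) (t (i + 2))"
            using cd i unfolding cell_data_def by auto
          show "cell_weak h c 2 0 (s i) (t i)" "cell_weak h c 1 1 (s i) (t (i + 1))" "cell_weak h c 0 2 (s i) (t (i + 2))"
            using cd i unfolding cell_data_def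
            by (metis add.right_neutral diff_zero zero_less_numeral, metis (no_types) add_diff_cancel_left' one_add_one one_less_numeral_iff semiring_norm(77), metis diff_self_eq_0 lessI numeral_3_eq_3 numeral_2_eq_2)
          show "smooth1 ((deriv ^^ (2 - i)) A)" "smooth1 ((deriv ^^ i) B)" using sAB smooth1_funpow_deriv by auto
          show "\<forall>x\<in>{-1..1}. \<bar>(deriv ^^ (2 - i)) A x\<bar> \<le> b \<and> \<bar>(deriv ^^ i) B x\<bar> \<le> b"
            using b(2)[OF AB, of "2 - i"] b(3)[OF AB i] by auto
        qed
        also have "\<dots> \<le> D * (b * b) * h ^ 3 * N"
        proof (rule mult_left_mono)
          have "i = 0 \<or> i = 1 \<or> i = 2" using i by auto
          then show "n i + n (i + 1) + n (i + 2) \<le> N"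
            using n0[of 0] n0[of 1] n0[of 2] n0[of 3] n0[of 4] by (auto simp: NE eval_nat_numeral)
        qed (use C0 h in auto)
        finally have d: "\<bar>defect h c (s i) ((deriv ^^ (2 - i)) A) ((deriv ^^ i) B)\<bar> \<le> D * (b * b) * h ^ 3 * N" .
        have "\<bar>k\<bar> \<le> M" using M m by force
        then show "\<bar>k * defect h c (s i) ((deriv ^^ (2 - i)) A) ((deriv ^^ i) B)\<bar> \<le> M * (D * (b * b) * h ^ 3 * N)"
          unfolding abs_mult using d by (intro mult_mono) auto
      qed
      finally show ?thesis .
    qed
    have partf: "\<bar>\<Sum>(k, A, B)\<leftarrow>ts. k * pr h c f A B\<bar> \<le> ?len * (M * (b * b * (2 * h) * L2_norm (cell h c) f))"
    proof (rule abs_sum_list_le, clarify)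
      fix k A B assume m: "(k, A, B) \<in> set ts"
      then have AB: "(A, B) \<in> P" using tP by force
      have sAB: "smooth1 A" "smooth1 B" using P(2) AB by auto
      have d: "\<bar>pr h c f A B\<bar> \<le> b * b * (2 * h) * L2_norm (cell h c) f"
        by (rule pr_bound(2)[OF h _ sAB]) (use cd b(2)[OF AB, of 0] b(3)[OF AB, of 0] in \<open>auto simp: cell_data_def\<close>)
      have "\<bar>k\<bar> \<le> M" using M m by force
      then show "\<bar>k * pr h c f A B\<bar> \<le> M * (b * b * (2 * h) * L2_norm (cell h c) f)"
        unfolding abs_mult using d by (intro mult_mono) auto
    qed
    have eq: "(\<Sum>(k, A, B)\<leftarrow>ts. k * cell_residual h c s f A B) = (1 / h\<^sup>2) *
       ((\<Sum>(k, A, B)\<leftarrow>ts. k * pr h c (s 0) ((deriv ^^ (2 - 0)) A) ((deriv ^^ 0) B))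
       + 2 * (\<Sum>(k, A, B)\<leftarrow>ts. k * pr h c (s 1) ((deriv ^^ (2 - 1)) A) ((deriv ^^ 1) B))
       + (\<Sum>(k, A, B)\<leftarrow>ts. k * pr h c (s 2) ((deriv ^^ (2 - 2)) A) ((deriv ^^ 2) B)))
       - (\<Sum>(k, A, B)\<leftarrow>ts. k * pr h c f A B)"
      by (induction ts) (auto simp: cell_residual_def algebra_simps add_divide_distrib diff_divide_distrib)
    define X where "X = ?len * (M * (D * (b * b) * h ^ 3 * N))"
    have "\<bar>\<Sum>(k, A, B)\<leftarrow>ts. k * cell_residual h c s f A B\<bar> \<le> (1 / h\<^sup>2) * (X + 2 * X + X) + ?len * (M * (b * b * (2 * h) * L2_norm (cell h c) f))"
    proof -
      have "\<bar>(1 / h\<^sup>2) * (p + 2 * q + r) - z\<bar> \<le> (1 / h\<^sup>2) * (X + 2 * X + X) + Z"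
        if "\<bar>p\<bar> \<le> X" "\<bar>q\<bar> \<le> X" "\<bar>r\<bar> \<le> X" "\<bar>z\<bar> \<le> Z" for p q r z Z :: real
      proof -
        have "\<bar>(1 / h\<^sup>2) * (p + 2 * q + r)\<bar> = (1 / h\<^sup>2) * \<bar>p + 2 * q + r\<bar>" by (simp add: abs_mult)
        also have "\<dots> \<le> (1 / h\<^sup>2) * (X + 2 * X + X)" using that by (intro mult_left_mono) auto
        finally show ?thesis using that(4) by linarith
      qed
      note this[OF part[folded X_def, of 0] part[folded X_def, of 1] part[folded X_def, of 2] partf]
      then show ?thesis unfolding eq by simp
    qed
    also have "\<dots> = ?len * M * h * (4 * (D * (b * b)) * N + 2 * (b * b) * L2_norm (cell h c) f)"
      using h unfolding X_def by (simp add: power2_eq_square power3_eq_cube field_simps)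
    also have "\<dots> \<le> ?len * M * h * (C * N + C * L2_norm (cell h c) f)"
    proof (cases "ts = []")
      case False
      then obtain p where "p \<in> set ts" by (cases ts) auto
      then have "M \<ge> 0" using M by force
      then show ?thesis using C0 h N0 L2_norm_nonneg[of "cell h c" f]
        by (intro mult_left_mono add_mono mult_right_mono) (auto simp: C_def)
    qed simp
    also have "\<dots> = C * ?len * M * h * (L2_norm (cell h c) f + N)" by (simp add: algebra_simps)
    finally show "\<bar>\<Sum>(k, A, B)\<leftarrow>ts. k * cell_residual h c s f A B\<bar> \<le> C * ?len * M * h *
      (L2_norm (cell h c) f + (\<Sum>i<5. L2_norm (cell h c) (t i)))" unfolding N_def .
  qed
qed

text \<open>The Morley polynomial minus its companion after the affine part has cancelled.
  \<open>d\<close> and \<open>e\<close> are the deviations of the vertex gradients from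
  \<open>a 1 0\<close> and \<open>a 0 1\<close>, and the last four entries are the flux corrections.
  No coefficient of order 0 or 1 is left, as must be the case since the energy does not see
  them.\<close>

definition res_terms :: "(nat \<Rightarrow> nat \<Rightarrow> real) \<Rightarrow> (bool \<Rightarrow> bool \<Rightarrow> real) \<Rightarrow> (bool \<Rightarrow> bool \<Rightarrow> real)
    \<Rightarrow> (real \<times> (real \<Rightarrow> real) \<times> (real \<Rightarrow> real)) list" where
  "res_terms a d e = [
    (a 2 0, pw 2, pw 0), (a 1 1, pw 1, pw 1), (a 0 2, pw 0, pw 2), (a 3 0, pw 3, pw 0), (a 0 3, pw 0, pw 3),
    (- (a 2 0 + a 1 1 + a 0 2 - a 3 0 - a 0 3), psiL, psiL),
    (- (a 2 0 - a 1 1 + a 0 2 + a 3 0 - a 0 3), stp, psiL),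
    (- (a 2 0 - a 1 1 + a 0 2 - a 3 0 + a 0 3), psiL, stp),
    (- (a 2 0 + a 1 1 + a 0 2 + a 3 0 + a 0 3), stp, stp),
    (- d False False, thL, psiL), (- d True False, thR, psiL), (- d False True, thL, stp), (- d True True, thR, stp),
    (- e False False, psiL, thL), (- e True False, stp, thL), (- e False True, psiL, thR), (- e True True, stp, thR),
    (- (- 2 * a 2 0 + 3 * a 3 0 - (d False False + d False True) / 2), thL, bump),
    (- (2 * a 2 0 + 3 * a 3 0 - (d True False + d True True) / 2), thR, bump),
    (- (- 2 * a 0 2 + 3 * a 0 3 - (e False False + e True False) / 2), bump, thL),
    (- (2 * a 0 2 + 3 * a 0 3 - (e False True + e True True) / 2), bump, thR)]"

lemma mom_bump2: "mom0 ((deriv ^^ 2) bump) = 0" "mom1 ((deriv ^^ 2) bump) = 0"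
  using mom_deriv2[OF smooth1_bump] by (simp_all add: ref_values)

lemma mom2_eqs:
  "mom0 ((deriv ^^ 2) psiL) = 0" "mom1 ((deriv ^^ 2) psiL) = 1"
  "mom0 ((deriv ^^ 2) stp) = 0" "mom1 ((deriv ^^ 2) stp) = -1"
  "mom0 ((deriv ^^ 2) thL) = -1" "mom1 ((deriv ^^ 2) thL) = 1"
  "mom0 ((deriv ^^ 2) thR) = 1" "mom1 ((deriv ^^ 2) thR) = 1"
  "mom0 ((deriv ^^ 2) (pw 0)) = 0" "mom1 ((deriv ^^ 2) (pw 0)) = 0"
  "mom0 ((deriv ^^ 2) (pw 1)) = 0" "mom1 ((deriv ^^ 2) (pw 1)) = 0"
  "mom0 ((deriv ^^ 2) (pw 2)) = 4" "mom1 ((deriv ^^ 2) (pw 2)) = 0"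
  "mom0 ((deriv ^^ 2) (pw 3)) = 0" "mom1 ((deriv ^^ 2) (pw 3)) = 4"
  by (simp_all add: mom_deriv2 smooth1_all deriv_stp_pm1 ref_values deriv_ref(4) pw_def del: One_nat_def)

lemma mom1_eqs:
  "mom0 (deriv psiL) = -1" "mom1 (deriv psiL) = 0"
  "mom0 (deriv stp) = 1" "mom1 (deriv stp) = 0"
  "mom0 (deriv thL) = 0" "mom1 (deriv thL) = 0"
  "mom0 (deriv thR) = 0" "mom1 (deriv thR) = 0"
  "mom0 (deriv bump) = 0" "mom1 (deriv bump) = -2"
  "mom0 (deriv (pw 0)) = 0" "mom1 (deriv (pw 0)) = 0"
  "mom0 (deriv (pw 1)) = 2" "mom1 (deriv (pw 1)) = 0"
  "mom0 (deriv (pw 2)) = 0" "mom1 (deriv (pw 2)) = 4/3"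
  "mom0 (deriv (pw 3)) = 2" "mom1 (deriv (pw 3)) = 0"
  using mom_pw(1)[of 0] mom_pw(1)[of 1] mom_pw(1)[of 2] mom_pw(1)[of 3]
  by (simp_all add: mom_deriv smooth1_all ref_values mom_ref mom_stp mom0_bump pw_def)

lemma mom0_eqs:
  "mom0 (pw 0) = 2" "mom1 (pw 0) = 0" "mom0 (pw 1) = 0" "mom1 (pw 1) = 2/3"
  "mom0 (pw 2) = 2/3" "mom1 (pw 2) = 0" "mom0 (pw 3) = 0" "mom1 (pw 3) = 2/5"
  using mom_pw[of 0] mom_pw[of 1] mom_pw[of 2] mom_pw[of 3] by simp_all

text \<open>For a pure second derivative, integration by parts leaves mean normal derivatives, which
  agree, and the difference of the integrals over opposite sides. On a side the companion integrates
  to the trapezoidal sum of the vertex values. The error of that rule is the same on opposite sides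
  because P(K) has no monomial of third degree in both variables, so it cancels. The transversal
  first moments vanish for the polynomial and for the companion. For the mixed derivative the mean
  is an alternating sum of vertex values, and both first moments vanish again.\<close>

lemma moment_sums_zero_res_terms: "moment_sums_zero (res_terms a d e)"
proof -
  note eqs = mom0_eqs mom1_eqs mom2_eqs mom_bump2 mom_ref mom_stp mom0_bump mom1_bump
  have fp: "(deriv ^^ 1) = (deriv :: (real \<Rightarrow> real) \<Rightarrow> _)" "(deriv ^^ 0) = (\<lambda>A :: real \<Rightarrow> real. A)" "2 - 1 = (1::nat)" by auto
  have c: "i = 0 \<or> i = 1 \<or> i = 2" if "i < 3" for i :: nat using that by auto
  show ?thesis unfolding moment_sums_zero_def
    by (intro allI impI conjI; drule c; elim disjE)
       (simp_all add: res_terms_def eqs fp del: funpow.simps One_nat_def, simp_all add: eqs field_simps del: One_nat_def)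
qed

text \<open>This is \<open>L\<close> at the difference of the Morley polynomial with coefficients \<open>a\<close> and its smooth companion,
  which has vertex values \<open>v\<close> and vertex gradients \<open>(p, q)\<close>; \<open>D1\<close> and \<open>D2\<close> correct the edge fluxes.\<close>

definition local_functional :: "((real \<Rightarrow> real) \<Rightarrow> (real \<Rightarrow> real) \<Rightarrow> real) \<Rightarrow> (nat \<Rightarrow> nat \<Rightarrow> real) \<Rightarrow>
   (bool \<Rightarrow> bool \<Rightarrow> real) \<Rightarrow> (bool \<Rightarrow> bool \<Rightarrow> real) \<Rightarrow> (bool \<Rightarrow> bool \<Rightarrow> real) \<Rightarrow> (bool \<Rightarrow> real) \<Rightarrow> (bool \<Rightarrow> real) \<Rightarrow> real" where
  "local_functional L a v p q D1 D2 =
     (a 0 0 * L (pw 0) (pw 0) + a 1 0 * L (pw 1) (pw 0) + a 0 1 * L (pw 0) (pw 1) + a 2 0 * L (pw 2) (pw 0)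
      + a 1 1 * L (pw 1) (pw 1) + a 0 2 * L (pw 0) (pw 2) + a 3 0 * L (pw 3) (pw 0) + a 0 3 * L (pw 0) (pw 3))
     - ((v False False * L psiL psiL + v True False * L stp psiL + v False True * L psiL stp + v True True * L stp stp)
      + (p False False * L thL psiL + p True False * L thR psiL + p False True * L thL stp + p True True * L thR stp)
      + (q False False * L psiL thL + q True False * L stp thL + q False True * L psiL thR + q True True * L stp thR)
      + (D1 False * L thL bump + D1 True * L thR bump) + (D2 False * L bump thL + D2 True * L bump thR))"

definition sg :: "bool \<Rightarrow> real" where "sg b = (if b then 1 else -1)"

definition corner_value :: "(nat \<Rightarrow> nat \<Rightarrow> real) \<Rightarrow> bool \<Rightarrow> bool \<Rightarrow> real" where
  "corner_value a b1 b2 = a 0 0 + sg b1 * a 1 0 + sg b2 * a 0 1 + a 2 0 + sg b1 * sg b2 * a 1 1 + a 0 2 + sg b1 * a 3 0 + sg b2 * a 0 3"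

text \<open>The mean of the normal derivative over the side at \<open>sg b\<close>, in reference
  coordinates. The term of \<open>a 1 1\<close> is odd along the side and drops out.\<close>

definition flux1 :: "(nat \<Rightarrow> nat \<Rightarrow> real) \<Rightarrow> bool \<Rightarrow> real" where
  "flux1 a b = a 1 0 + 2 * sg b * a 2 0 + 3 * a 3 0"

definition flux2 :: "(nat \<Rightarrow> nat \<Rightarrow> real) \<Rightarrow> bool \<Rightarrow> real" where
  "flux2 a b = a 0 1 + 2 * sg b * a 0 2 + 3 * a 0 3"

text \<open>Affine functions are reproduced exactly: \<open>psiL\<close> and \<open>stp\<close> add
  up to 1, and combining the values -1 and 1 with the slopes 1 at both ends gives x, since the bumps
  in \<open>thL\<close> and \<open>thR\<close> cancel.\<close>

lemma cell_residual_linear_identities: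
  assumes cd: "cell_data h c s t f"
  defines "L \<equiv> cell_residual h c s f"
  shows "L (pw 0) (pw 0) = L psiL psiL + L stp psiL + L psiL stp + L stp stp"
    and "L (pw 1) (pw 0) = - L psiL psiL + L stp psiL - L psiL stp + L stp stp + L thL psiL + L thR psiL + L thL stp + L thR stp"
    and "L (pw 0) (pw 1) = - L psiL psiL - L stp psiL + L psiL stp + L stp stp + L psiL thL + L stp thL + L psiL thR + L stp thR"
proof -
  have p0: "pw 0 = (\<lambda>x. psiL x + stp x)" by (simp add: pw_def psiL_def fun_eq_iff)
  have p1: "pw 1 = (\<lambda>x. (-1) * psiL x + (stp x + (thL x + thR x)))"
    by (auto simp: pw_def psiL_def thL_def thR_def fun_eq_iff algebra_simps)
  note a1 = cell_residual_add1[OF cd, folded L_def] and a2 = cell_residual_add2[OF cd, folded L_def]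
  have cm: "L (\<lambda>x. (-1) * psiL x) B = - L psiL B" "L B (\<lambda>x. (-1) * psiL x) = - L B psiL" if "smooth1 B" for B
    using cell_residual_cmult[where k = "-1", of psiL B h c s f] cell_residual_cmult[where k = "-1", of B psiL h c s f] smooth1_ref that
    by (simp_all add: L_def)
  have s: "smooth1 (\<lambda>x. (-1) * psiL x)" "smooth1 (\<lambda>x. thL x + thR x)" "smooth1 (\<lambda>x. stp x + (thL x + thR x))"
    by (intro smooth1_mult smooth1_add smooth1_const smooth1_all)+
  have P0: "L A (pw 0) = L A psiL + L A stp" "L (pw 0) A = L psiL A + L stp A" if "smooth1 A" for A
    unfolding p0 by (rule a2[OF that smooth1_ref(1) smooth1_stp], rule a1[OF smooth1_ref(1) smooth1_stp that])
  have P1: "L A (pw 1) = - L A psiL + L A stp + L A thL + L A thR" "L (pw 1) A = - L psiL A + L stp A + L thL A + L thR A" if "smooth1 A" for A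
    unfolding p1 using a2[OF that s(1,3)] a2[OF that smooth1_stp s(2)] a2[OF that smooth1_ref(2,3)]
      a1[OF s(1,3) that] a1[OF smooth1_stp s(2) that] a1[OF smooth1_ref(2,3) that] cm[OF that] by simp_all
  show "L (pw 0) (pw 0) = L psiL psiL + L stp psiL + L psiL stp + L stp stp"
    using P0 smooth1_all by simp
  show "L (pw 1) (pw 0) = - L psiL psiL + L stp psiL - L psiL stp + L stp stp + L thL psiL + L thR psiL + L thL stp + L thR stp"
    using P0 P1 smooth1_all by simp
  show "L (pw 0) (pw 1) = - L psiL psiL - L stp psiL + L psiL stp + L stp stp + L psiL thL + L stp thL + L psiL thR + L stp thR"
    using P0 P1 smooth1_all by simp
qed

lemma local_functional_res_terms:
  assumes cd: "cell_data h c s t f"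
  shows "local_functional (cell_residual h c s f) a (corner_value a) p q
     (\<lambda>b. flux1 a b - (p b False + p b True) / 2) (\<lambda>b. flux2 a b - (q False b + q True b) / 2)
   = (\<Sum>(k, A, B)\<leftarrow>res_terms a (\<lambda>b1 b2. p b1 b2 - a 1 0) (\<lambda>b1 b2. q b1 b2 - a 0 1). k * cell_residual h c s f A B)"
  unfolding local_functional_def res_terms_def cell_residual_linear_identities[OF cd]
  by (simp add: corner_value_def flux1_def flux2_def sg_def) (simp add: field_simps)

lemma local_functional_bound:
  "\<exists>C\<ge>0. \<forall>h c s t f M a p q. cell_data h c s t f \<longrightarrow>
    \<bar>a 2 0\<bar> \<le> M \<and> \<bar>a 1 1\<bar> \<le> M \<and> \<bar>a 0 2\<bar> \<le> M \<and> \<bar>a 3 0\<bar> \<le> M \<and> \<bar>a 0 3\<bar> \<le> M \<longrightarrow>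
    (\<forall>b1 b2. \<bar>p b1 b2 - a 1 0\<bar> \<le> M \<and> \<bar>q b1 b2 - a 0 1\<bar> \<le> M) \<longrightarrow>
    \<bar>local_functional (cell_residual h c s f) a (corner_value a) p q
     (\<lambda>b. flux1 a b - (p b False + p b True) / 2) (\<lambda>b. flux2 a b - (q False b + q True b) / 2)\<bar>
    \<le> C * M * h * (L2_norm (cell h c) f + (\<Sum>i<5. L2_norm (cell h c) (t i)))"
proof -
  define P where "P = {pw 0, pw 1, pw 2, pw 3, psiL, stp, thL, thR, bump} \<times> {pw 0, pw 1, pw 2, pw 3, psiL, stp, thL, thR, bump}"
  have "finite P" "\<forall>(A, B)\<in>P. smooth1 A \<and> smooth1 B"
    unfolding P_def using smooth1_all by auto
  from residual_bound[OF this] obtain C where C: "C \<ge> 0" "\<And>h c s t f M ts. cell_data h c s t f \<Longrightarrow> moment_sums_zero ts \<Longrightarrow> snd ` set ts \<subseteq> P \<Longrightarrow>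
    (\<forall>p\<in>set ts. \<bar>fst p\<bar> \<le> M) \<Longrightarrow>
    \<bar>\<Sum>(k, A, B)\<leftarrow>ts. k * cell_residual h c s f A B\<bar> \<le> C * real (length ts) * M * h *
      (L2_norm (cell h c) f + (\<Sum>i<5. L2_norm (cell h c) (t i)))" by blast
  show ?thesis
  \<comment> \<open>21 is the length of \<open>res_terms\<close>. The largest coefficients are the
    flux corrections, bounded by (2 + 3 + 1) M.\<close>
  proof (intro exI[of _ "C * 21 * 6"] conjI allI impI)
    show "0 \<le> C * 21 * 6" using C(1) by simp
    fix h c s t f M and a :: "nat \<Rightarrow> nat \<Rightarrow> real" and p q :: "bool \<Rightarrow> bool \<Rightarrow> real"
    assume cd: "cell_data h c s t f"
      and a: "\<bar>a 2 0\<bar> \<le> M \<and> \<bar>a 1 1\<bar> \<le> M \<and> \<bar>a 0 2\<bar> \<le> M \<and> \<bar>a 3 0\<bar> \<le> M \<and> \<bar>a 0 3\<bar> \<le> M"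
      and pq: "\<forall>b1 b2. \<bar>p b1 b2 - a 1 0\<bar> \<le> M \<and> \<bar>q b1 b2 - a 0 1\<bar> \<le> M"
    define ts where "ts = res_terms a (\<lambda>b1 b2. p b1 b2 - a 1 0) (\<lambda>b1 b2. q b1 b2 - a 0 1)"
    have "\<bar>\<Sum>(k, A, B)\<leftarrow>ts. k * cell_residual h c s f A B\<bar> \<le> C * real (length ts) * (6 * M) * h *
      (L2_norm (cell h c) f + (\<Sum>i<5. L2_norm (cell h c) (t i)))"
    proof (rule C(2)[OF cd])
      show "moment_sums_zero ts" unfolding ts_def by (rule moment_sums_zero_res_terms)
      show "snd ` set ts \<subseteq> P" unfolding ts_def res_terms_def P_def by simp
      have d: "\<bar>p b1 b2 - a 1 0\<bar> \<le> M" "\<bar>q b1 b2 - a 0 1\<bar> \<le> M" for b1 b2 using pq by auto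
      show "\<forall>p\<in>set ts. \<bar>fst p\<bar> \<le> 6 * M"
        unfolding ts_def res_terms_def
        using a d[of False False] d[of False True] d[of True False] d[of True True]
        by (simp add: abs_le_iff) argo
    qed
    then show "\<bar>local_functional (cell_residual h c s f) a (corner_value a) p q
     (\<lambda>b. flux1 a b - (p b False + p b True) / 2) (\<lambda>b. flux2 a b - (q False b + q True b) / 2)\<bar>
    \<le> C * 21 * 6 * M * h * (L2_norm (cell h c) f + (\<Sum>i<5. L2_norm (cell h c) (t i)))"
      unfolding local_functional_res_terms[OF cd] ts_def[symmetric]
      by (simp add: ts_def res_terms_def mult_ac)
  qed
qed

section \<open>Faces of squares\<close>

abbreviation pt :: "real \<Rightarrow> real \<Rightarrow> real^2" where "pt y z \<equiv> vector [y, z]"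

lemma real2_eq_iff: "(x :: real^2) = y \<longleftrightarrow> x $ 1 = y $ 1 \<and> x $ 2 = y $ 2"
  by (simp add: vec_eq_iff forall_2)

lemma convex_square: "convex (square h c)"
  by (simp add: square_def)

lemma square_side_face:
  assumes "s = 1 \<or> s = -1" "i = 1 \<or> i = 2"
  shows "(square h c \<inter> {x. x $ i = c $ i + s * h}) face_of square h c"
proof -
  have ax: "(axis i (1::real)) \<bullet> x = x $ i" for x :: "real^2" by (simp add: inner_axis')
  from assms(1) show ?thesis
  proof
    assume s: "s = 1"
    show ?thesis
      using face_of_Int_supporting_hyperplane_le[OF convex_square, of h c "axis i 1" "c $ i + h"] assms(2)
      unfolding s ax by (auto simp: mem_square abs_le_iff)
  next
    assume s: "s = -1"
    show ?thesis
      using face_of_Int_supporting_hyperplane_ge[OF convex_square, of h c "c $ i - h" "axis i 1"] assms(2)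
      unfolding s ax by (auto simp: mem_square abs_le_iff)
  qed
qed

lemma vertical_segment:
  assumes "h > 0"
  shows "closed_segment (pt y (z - h)) (pt y (z + h)) = {x. x $ 1 = y \<and> \<bar>x $ 2 - z\<bar> \<le> h}"
proof (intro set_eqI iffI)
  fix x assume "x \<in> closed_segment (pt y (z - h)) (pt y (z + h))"
  then obtain u where u: "0 \<le> u" "u \<le> 1" and x: "x = (1 - u) *\<^sub>R pt y (z - h) + u *\<^sub>R pt y (z + h)"
    by (auto simp: in_segment)
  have "x $ 1 = y" by (simp add: x vector_2 algebra_simps)
  moreover have "x $ 2 - z = (2 * u - 1) * h" by (simp add: x vector_2 algebra_simps)
  moreover have "\<bar>2 * u - 1\<bar> * h \<le> 1 * h" using u assms by (intro mult_right_mono) auto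
  ultimately show "x \<in> {x. x $ 1 = y \<and> \<bar>x $ 2 - z\<bar> \<le> h}" using assms by (simp add: abs_mult)
next
  fix x :: "real^2" assume "x \<in> {x. x $ 1 = y \<and> \<bar>x $ 2 - z\<bar> \<le> h}"
  then have x: "x $ 1 = y" "\<bar>x $ 2 - z\<bar> \<le> h" by auto
  define u where "u = (x $ 2 - z + h) / (2 * h)"
  have "0 \<le> u" "u \<le> 1" using x(2) assms by (auto simp: u_def abs_le_iff field_simps)
  moreover have "2 * h * u = x $ 2 - z + h" using assms by (simp add: u_def)
  then have "x = (1 - u) *\<^sub>R pt y (z - h) + u *\<^sub>R pt y (z + h)"
    by (simp add: real2_eq_iff vector_2 x(1) algebra_simps)
  ultimately show "x \<in> closed_segment (pt y (z - h)) (pt y (z + h))" by (auto simp: in_segment)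
qed

lemma horizontal_segment:
  assumes "h > 0"
  shows "closed_segment (pt (y - h) z) (pt (y + h) z) = {x. x $ 2 = z \<and> \<bar>x $ 1 - y\<bar> \<le> h}"
proof (intro set_eqI iffI)
  fix x assume "x \<in> closed_segment (pt (y - h) z) (pt (y + h) z)"
  then obtain u where u: "0 \<le> u" "u \<le> 1" and x: "x = (1 - u) *\<^sub>R pt (y - h) z + u *\<^sub>R pt (y + h) z"
    by (auto simp: in_segment)
  have "x $ 2 = z" by (simp add: x vector_2 algebra_simps)
  moreover have "x $ 1 - y = (2 * u - 1) * h" by (simp add: x vector_2 algebra_simps)
  moreover have "\<bar>2 * u - 1\<bar> * h \<le> 1 * h" using u assms by (intro mult_right_mono) auto
  ultimately show "x \<in> {x. x $ 2 = z \<and> \<bar>x $ 1 - y\<bar> \<le> h}" using assms by (simp add: abs_mult)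
next
  fix x :: "real^2" assume "x \<in> {x. x $ 2 = z \<and> \<bar>x $ 1 - y\<bar> \<le> h}"
  then have x: "x $ 2 = z" "\<bar>x $ 1 - y\<bar> \<le> h" by auto
  define u where "u = (x $ 1 - y + h) / (2 * h)"
  have "0 \<le> u" "u \<le> 1" using x(2) assms by (auto simp: u_def abs_le_iff field_simps)
  moreover have "2 * h * u = x $ 1 - y + h" using assms by (simp add: u_def)
  then have "x = (1 - u) *\<^sub>R pt (y - h) z + u *\<^sub>R pt (y + h) z"
    by (simp add: real2_eq_iff vector_2 x(1) algebra_simps)
  ultimately show "x \<in> closed_segment (pt (y - h) z) (pt (y + h) z)" by (auto simp: in_segment)
qed

lemma aff_dim_segment: "a \<noteq> b \<Longrightarrow> aff_dim (closed_segment a b) = 1" for a b :: "real^2"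
  by (simp add: segment_convex_hull aff_dim_convex_hull)

lemma square_edges:
  assumes "h > 0" "s = 1 \<or> s = -1"
  shows "closed_segment (pt (c $ 1 + s * h) (c $ 2 - h)) (pt (c $ 1 + s * h) (c $ 2 + h)) edge_of square h c"
    and "closed_segment (pt (c $ 1 - h) (c $ 2 + s * h)) (pt (c $ 1 + h) (c $ 2 + s * h)) edge_of square h c"
proof -
  have "square h c \<inter> {x. x $ 1 = c $ 1 + s * h} = closed_segment (pt (c $ 1 + s * h) (c $ 2 - h)) (pt (c $ 1 + s * h) (c $ 2 + h))"
    unfolding vertical_segment[OF assms(1)] using assms by (auto simp: mem_square)
  then show "closed_segment (pt (c $ 1 + s * h) (c $ 2 - h)) (pt (c $ 1 + s * h) (c $ 2 + h)) edge_of square h c"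
    using square_side_face[OF assms(2), of 1 h c] assms(1)
    by (simp add: edge_of_def aff_dim_segment real2_eq_iff vector_2)
  have "square h c \<inter> {x. x $ 2 = c $ 2 + s * h} = closed_segment (pt (c $ 1 - h) (c $ 2 + s * h)) (pt (c $ 1 + h) (c $ 2 + s * h))"
    unfolding horizontal_segment[OF assms(1)] using assms by (auto simp: mem_square)
  then show "closed_segment (pt (c $ 1 - h) (c $ 2 + s * h)) (pt (c $ 1 + h) (c $ 2 + s * h)) edge_of square h c"
    using square_side_face[OF assms(2), of 2 h c] assms(1)
    by (simp add: edge_of_def aff_dim_segment real2_eq_iff vector_2)
qed

lemma square_corner:
  assumes "h > 0" "s = 1 \<or> s = -1" "t = 1 \<or> t = -1"
  shows "pt (c $ 1 + s * h) (c $ 2 + t * h) extreme_point_of square h c"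
proof -
  have "(square h c \<inter> {x. x $ 1 = c $ 1 + s * h}) \<inter> (square h c \<inter> {x. x $ 2 = c $ 2 + t * h}) face_of square h c"
    using assms by (intro face_of_Int square_side_face) auto
  also have "(square h c \<inter> {x. x $ 1 = c $ 1 + s * h}) \<inter> (square h c \<inter> {x. x $ 2 = c $ 2 + t * h})
    = {pt (c $ 1 + s * h) (c $ 2 + t * h)}"
    using assms by (auto simp: mem_square real2_eq_iff vector_2)
  finally show ?thesis by (simp add: face_of_singleton)
qed

section \<open>The grid of a uniform partition\<close>

text \<open>If the centres differ in coordinate i by a positive amount below 2h, a side of the
  second square crosses the inside of a segment that spans the first. A face that contains an inner
  point of a segment in the square contains the whole segment, but one end lies outside the second
  square.\<close>

lemma conforming_coordinate:
  assumes h: "h > 0" and f: "square h c \<inter> square h c' face_of square h c" "square h c \<inter> square h c' face_of square h c'"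
    and ne: "square h c \<inter> square h c' \<noteq> {}" and i: "i = 1 \<or> i = 2"
  shows "c' $ i = c $ i \<or> c' $ i = c $ i + 2 * h \<or> c' $ i = c $ i - 2 * h"
proof -
  have *: "c' $ i = c $ i + 2 * h"
    if f: "square h c \<inter> square h c' face_of square h c" and ne: "square h c \<inter> square h c' \<noteq> {}"
      and gt: "c' $ i > c $ i" for c c' :: "real^2"
  proof (rule ccontr)
    assume neq: "c' $ i \<noteq> c $ i + 2 * h"
    obtain w where w: "w \<in> square h c" "w \<in> square h c'" using ne by auto
    define j :: 2 where "j = (if i = 1 then 2 else 1)"
    \<comment> \<open>\<open>v r\<close> keeps the transversal coordinate of a point common to both
      squares, so that membership is decided by coordinate i alone.\<close>
    define v where "v r = (\<chi> k. if k = i then r else w $ k)" for r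
    have vi: "v r $ i = r" "v r $ j = w $ j" for r using i by (auto simp: v_def j_def)
    have wij: "\<bar>w $ i - c $ i\<bar> \<le> h" "\<bar>w $ i - c' $ i\<bar> \<le> h" "\<bar>w $ j - c $ j\<bar> \<le> h" "\<bar>w $ j - c' $ j\<bar> \<le> h"
      using w i by (auto simp: mem_square j_def)
    have lt: "c' $ i < c $ i + 2 * h" using wij(1,2) neq by (auto simp: abs_le_iff)
    have mem: "v r \<in> square h d \<longleftrightarrow> \<bar>r - d $ i\<bar> \<le> h \<and> \<bar>w $ j - d $ j\<bar> \<le> h" for r d
      using vi[of r] i by (auto simp: mem_square j_def)
    define a where "a = v (c $ i - h)" define b where "b = v (c $ i + h)" define x where "x = v (c' $ i - h)"
    have ab: "a \<in> square h c" "b \<in> square h c" using wij h by (auto simp: a_def b_def mem)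
    have x: "x \<in> square h c \<inter> square h c'" using wij h gt lt by (auto simp: x_def mem abs_le_iff)
    define u where "u = (c' $ i - c $ i) / (2 * h)"
    have u: "0 < u" "u < 1" "2 * h * u = c' $ i - c $ i" using h gt lt by (auto simp: u_def field_simps)
    have "x = (1 - u) *\<^sub>R a + u *\<^sub>R b"
    proof -
      have "x $ k = ((1 - u) *\<^sub>R a + u *\<^sub>R b) $ k" if "k = i \<or> k = j" for k
        using that u(3) vi by (auto simp: a_def b_def x_def algebra_simps)
      moreover have "k = i \<or> k = j" for k using i exhaust_2[of k] by (auto simp: j_def)
      ultimately show ?thesis by (simp add: vec_eq_iff)
    qed
    moreover have "a $ i \<noteq> b $ i" using h vi by (simp add: a_def b_def)
    then have "a \<noteq> b" by auto
    ultimately have "x \<in> open_segment a b" using u by (auto simp: in_segment)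
    then have "a \<in> square h c'" using face_ofD[OF f _ ab x] by blast
    then show False using gt h by (auto simp: a_def mem abs_le_iff)
  qed
  show ?thesis
    using *[OF f(1) ne] *[of c' c] f(2) ne by (cases "c' $ i" "c $ i" rule: linorder_cases) (auto simp: Int_commute)
qed

definition grid_centre :: "real \<Rightarrow> real^2 \<Rightarrow> int \<times> int \<Rightarrow> real^2" where
  "grid_centre h c k = pt (c $ 1 + 2 * h * of_int (fst k)) (c $ 2 + 2 * h * of_int (snd k))"

lemma grid_centre_nth [simp]: "grid_centre h c k $ 1 = c $ 1 + 2 * h * of_int (fst k)" "grid_centre h c k $ 2 = c $ 2 + 2 * h * of_int (snd k)"
  by (simp_all add: grid_centre_def vector_2)

text \<open>A square that meets an aligned one is aligned as well. Aligned and other squares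
  therefore cover two disjoint closed sets, and connectedness of the closure of \<Omega> leaves only
  the first.\<close>

lemma uniform_partition_grid:
  assumes up: "uniform_partition \<Omega> h T" and con: "connected \<Omega>" "\<Omega> \<noteq> {}"
  shows "\<exists>c. \<forall>K\<in>T. \<exists>k. K = square h (grid_centre h c k)"
proof -
  have h: "h > 0" and fin: "finite T" and sq: "\<And>K. K \<in> T \<Longrightarrow> \<exists>c. K = square h c"
    and un: "\<Union>T = closure \<Omega>" and fc: "\<And>K K'. K \<in> T \<Longrightarrow> K' \<in> T \<Longrightarrow> K \<inter> K' face_of K \<and> K \<inter> K' face_of K'"
    using up unfolding uniform_partition_def by auto
  have "T \<noteq> {}" using un con(2) closure_subset by fastforce
  then obtain K0 where "K0 \<in> T" by auto
  then obtain c where K0: "square h c \<in> T" using sq by metis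
  define G where "G = {K \<in> T. \<exists>k. K = square h (grid_centre h c k)}"
  have adj: "K' \<in> G" if K: "K \<in> G" "K' \<in> T" "K \<inter> K' \<noteq> {}" for K K'
  proof -
    obtain k where k: "K = square h (grid_centre h c k)" "K \<in> T" using K by (auto simp: G_def)
    obtain c' where c': "K' = square h c'" using sq K by blast
    have cc: "c' $ i = grid_centre h c k $ i \<or> c' $ i = grid_centre h c k $ i + 2 * h \<or> c' $ i = grid_centre h c k $ i - 2 * h" if "i = 1 \<or> i = 2" for i
      by (rule conforming_coordinate[OF h _ _ _ that]) (use fc[OF k(2) K(2)] K(3) in \<open>auto simp: k(1) c'\<close>)
    have "\<exists>m::int. c' $ 1 = c $ 1 + 2 * h * of_int m"
      using cc[of 1] by (auto intro: exI[of _ "fst k"] exI[of _ "fst k + 1"] exI[of _ "fst k - 1"] simp: algebra_simps)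
    moreover have "\<exists>m::int. c' $ 2 = c $ 2 + 2 * h * of_int m"
      using cc[of 2] by (auto intro: exI[of _ "snd k"] exI[of _ "snd k + 1"] exI[of _ "snd k - 1"] simp: algebra_simps)
    ultimately obtain m n :: int where "c' = grid_centre h c (m, n)" by (auto simp: real2_eq_iff)
    then show ?thesis using K(2) c' by (auto simp: G_def)
  qed
  have K0G: "square h c \<in> G" using K0 by (auto simp: G_def real2_eq_iff intro!: exI[of _ 0] arg_cong[of _ _ "square h"])
  have cl: "closed (\<Union>G)" "closed (\<Union>(T - G))"
    using fin sq by (auto simp: G_def square_def intro!: closed_Union) (metis closed_cbox)+
  have dis: "\<Union>G \<inter> \<Union>(T - G) = {}" using adj by fastforce
  have cov: "closure \<Omega> = \<Union>G \<union> \<Union>(T - G)" unfolding un[symmetric] by (auto simp: G_def)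
  have "connected (closure \<Omega>)" using con(1) by (rule connected_imp_connected_closure)
  then have "\<Union>G \<inter> closure \<Omega> = {} \<or> \<Union>(T - G) \<inter> closure \<Omega> = {}"
    by (rule connected_closedD[OF _ _ _ cl]) (use dis cov in auto)
  moreover have "c \<in> \<Union>G" using UnionI[OF K0G, of c] h by (simp add: mem_square)
  ultimately have "\<Union>(T - G) = {}" using cov by blast
  have "K \<in> G" if "K \<in> T" for K
  proof (rule ccontr)
    assume "K \<notin> G"
    then have "K = {}" using that \<open>\<Union>(T - G) = {}\<close> by auto
    moreover obtain c' where "K = square h c'" using sq \<open>K \<in> T\<close> by blast
    moreover have "c' \<in> square h c'" using h by (simp add: mem_square)
    ultimately show False by auto
  qed
  then show ?thesis unfolding G_def by blast
qed

text \<open>Near a frontier point the part strictly below the Lipschitz graph is open and disjoint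
  from \<Omega>, hence also from its closure. This excludes slits, so that an open set covered by
  squares of the partition lies in \<Omega>.\<close>

lemma interior_closure_lipschitz_domain:
  assumes "lipschitz_domain \<Omega>"
  shows "interior (closure \<Omega>) = \<Omega>"
proof
  have op: "open \<Omega>" using assms by (simp add: lipschitz_domain_def)
  show "\<Omega> \<subseteq> interior (closure \<Omega>)" using op closure_subset interior_maximal by blast
  show "interior (closure \<Omega>) \<subseteq> \<Omega>"
  proof (rule ccontr)
    assume "\<not> interior (closure \<Omega>) \<subseteq> \<Omega>"
    then obtain p where p: "p \<in> interior (closure \<Omega>)" "p \<notin> \<Omega>" by auto
    then have "p \<in> frontier \<Omega>" using op interior_subset by (auto simp: frontier_def interior_open)
    then obtain r Q \<gamma> L where r: "r > 0" and Q: "orthogonal_transformation (Q :: real^2 \<Rightarrow> real^2)"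
      and lip: "L-lipschitz_on UNIV (\<gamma> :: real \<Rightarrow> real)"
      and eq: "\<Omega> \<inter> ball p r = {x \<in> ball p r. \<gamma> (Q x $ 1) < Q x $ 2}"
      using assms unfolding lipschitz_domain_def by blast
    obtain e where e: "e > 0" "ball p e \<subseteq> closure \<Omega>" using p(1) by (auto simp: mem_interior)
    have le: "Q p $ 2 \<le> \<gamma> (Q p $ 1)" using eq p(2) r by (metis (mono_tags, lifting) Int_iff centre_in_ball mem_Collect_eq not_le)
    define d where "d = min r e / 2"
    have d: "d > 0" "d < r" "d < e" using r e by (auto simp: d_def)
    obtain w where w: "Q w = axis 2 1" using Q orthogonal_transformation_surj by (metis surjD)
    have nw: "norm w = 1" using Q w by (metis norm_axis_1 orthogonal_transformation_norm)
    \<comment> \<open>A step from \<open>p\<close> in the downward direction of the rotated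
      coordinates: it stays in both balls and lands strictly below the graph.\<close>
    define y where "y = p - d *\<^sub>R w"
    have Qy: "Q y = Q p - d *\<^sub>R axis 2 1"
      using orthogonal_transformation_linear[OF Q] w by (simp add: y_def linear_diff linear_cmul)
    have Qy1: "Q y $ 1 = Q p $ 1" "Q y $ 2 = Q p $ 2 - d" by (simp_all add: Qy axis_def)
    have yb: "y \<in> ball p r" "y \<in> ball p e" using d nw by (simp_all add: y_def dist_norm)
    define U where "U = ball p r \<inter> {x. Q x $ 2 < \<gamma> (Q x $ 1)}"
    have contQ: "continuous_on UNIV (\<lambda>x. Q x $ i)" for i
      using orthogonal_transformation_linear[OF Q] by (intro continuous_intros linear_continuous_on) (simp add: linear_conv_bounded_linear)
    have cont\<gamma>: "continuous_on UNIV (\<lambda>x. \<gamma> (Q x $ 1))"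
      using lipschitz_on_continuous_on[OF lip] contQ[of 1] continuous_on_compose2[of UNIV \<gamma> UNIV "\<lambda>x. Q x $ 1"] by auto
    have "open U" unfolding U_def using contQ[of 2] cont\<gamma> by (intro open_Int open_ball open_Collect_less)
    moreover have "U \<inter> \<Omega> = {}"
    proof -
      have "x \<notin> \<Omega>" if "x \<in> U" for x
      proof
        assume "x \<in> \<Omega>"
        then have "x \<in> \<Omega> \<inter> ball p r" using that by (simp add: U_def)
        then show False unfolding eq using that by (auto simp: U_def)
      qed
      then show ?thesis by auto
    qed
    ultimately have "U \<inter> closure \<Omega> = {}" using open_Int_closure_eq_empty by blast
    moreover have "y \<in> U" using yb le d by (simp add: U_def Qy1)
    ultimately show False using yb e by auto
  qed
qed

section \<open>Morley functions on the grid\<close>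

definition lp :: "(nat \<Rightarrow> nat \<Rightarrow> real) \<Rightarrow> real \<Rightarrow> real \<Rightarrow> real" where
  "lp a y z = a 0 0 + a 1 0 * y + a 0 1 * z + a 2 0 * y^2 + a 1 1 * y * z + a 0 2 * z^2 + a 3 0 * y^3 + a 0 3 * z^3"

definition cell_poly :: "real \<Rightarrow> real^2 \<Rightarrow> (nat \<Rightarrow> nat \<Rightarrow> real) \<Rightarrow> real^2 \<Rightarrow> real" where
  "cell_poly h c a x = lp a ((x $ 1 - c $ 1) / h) ((x $ 2 - c $ 2) / h)"

text \<open>Scaling about the centre preserves P(K): the expansion of a cube of one coordinate
  produces only powers of the same coordinate, hence no monomial outside the space.\<close>

lemma morley_polys_local:
  assumes "p \<in> morley_polys" "h > 0"
  shows "\<exists>a. p = cell_poly h c a"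
proof -
  obtain q \<alpha> \<beta> where q: "q \<in> polys 2" and p: "\<And>x. p x = q x + \<alpha> * (x $ 1) ^ 3 + \<beta> * (x $ 2) ^ 3"
    using assms(1) unfolding morley_polys_def by auto
  obtain e where e: "\<And>x. q x = (\<Sum>(i,j)\<in>{(i,j). i + j \<le> 2}. e i j * (x $ 1) ^ i * (x $ 2) ^ j)"
    using q unfolding polys_def by auto
  have S: "{(i,j). i + j \<le> (2::nat)} = {(0,0), (0,1), (0,2), (1,0), (1,1), (2,0)}" by auto
  have q': "q x = e 0 0 + e 0 1 * x $ 2 + e 0 2 * (x $ 2)^2 + e 1 0 * x $ 1 + e 1 1 * x $ 1 * x $ 2 + e 2 0 * (x $ 1)^2" for x
    unfolding e S by simp
  let ?u = "c $ 1" and ?v = "c $ 2"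
  \<comment> \<open>The last branch is meant for the index pair (0, 3); its value at other pairs is
    irrelevant, as \<open>lp\<close> does not read them.\<close>
  define a :: "nat \<Rightarrow> nat \<Rightarrow> real" where "a i j =
     (if i = 0 \<and> j = 0 then e 0 0 + e 0 1 * ?v + e 0 2 * ?v^2 + e 1 0 * ?u + e 1 1 * ?u * ?v + e 2 0 * ?u^2 + \<alpha> * ?u^3 + \<beta> * ?v^3
      else if i = 1 \<and> j = 0 then h * (e 1 0 + e 1 1 * ?v + 2 * e 2 0 * ?u + 3 * \<alpha> * ?u^2)
      else if i = 0 \<and> j = 1 then h * (e 0 1 + e 1 1 * ?u + 2 * e 0 2 * ?v + 3 * \<beta> * ?v^2)
      else if i = 2 \<and> j = 0 then h^2 * (e 2 0 + 3 * \<alpha> * ?u)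
      else if i = 1 \<and> j = 1 then h^2 * e 1 1
      else if i = 0 \<and> j = 2 then h^2 * (e 0 2 + 3 * \<beta> * ?v)
      else if i = 3 \<and> j = 0 then h^3 * \<alpha> else h^3 * \<beta>)" for i j
  have "p x = cell_poly h c a x" for x
  proof -
    define y where "y = (x $ 1 - ?u) / h"
    define z where "z = (x $ 2 - ?v) / h"
    have x: "x $ 1 = ?u + h * y" "x $ 2 = ?v + h * z" using assms(2) by (simp_all add: y_def z_def)
    have "cell_poly h c a x = lp a y z" by (simp add: cell_poly_def y_def z_def)
    moreover have "p x = lp a y z"
      unfolding p q' x lp_def a_def by (simp add: power2_eq_square power3_eq_cube) algebra
    ultimately show ?thesis by simp
  qed
  then show ?thesis by (auto simp: fun_eq_iff)
qed

lemma cell_poly_has_derivative: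
  assumes "h > 0"
  shows "(cell_poly h c a has_derivative (\<lambda>v. (v $ 1 / h) * (a 1 0 + 2 * a 2 0 * ((x $ 1 - c $ 1) / h) + a 1 1 * ((x $ 2 - c $ 2) / h) + 3 * a 3 0 * ((x $ 1 - c $ 1) / h)^2)
     + (v $ 2 / h) * (a 0 1 + a 1 1 * ((x $ 1 - c $ 1) / h) + 2 * a 0 2 * ((x $ 2 - c $ 2) / h) + 3 * a 0 3 * ((x $ 2 - c $ 2) / h)^2))) (at x)"
proof -
  define y where "y x = (x $ 1 - c $ 1) / h" for x :: "real^2"
  define z where "z x = (x $ 2 - c $ 2) / h" for x :: "real^2"
  have n: "((\<lambda>x::real^2. x $ i) has_derivative (\<lambda>v. v $ i)) (at x)" for i
    by (intro bounded_linear_imp_has_derivative bounded_linear_vec_nth)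
  have y: "(y has_derivative (\<lambda>v. v $ 1 / h)) (at x)" and z: "(z has_derivative (\<lambda>v. v $ 2 / h)) (at x)"
    unfolding y_def[abs_def] z_def[abs_def] using assms by (auto intro!: derivative_eq_intros n)
  have "((\<lambda>x. lp a (y x) (z x)) has_derivative (\<lambda>v. (v $ 1 / h) * (a 1 0 + 2 * a 2 0 * y x + a 1 1 * z x + 3 * a 3 0 * (y x)^2)
     + (v $ 2 / h) * (a 0 1 + a 1 1 * y x + 2 * a 0 2 * z x + 3 * a 0 3 * (z x)^2))) (at x)"
    unfolding lp_def by (auto intro!: derivative_eq_intros y z simp: fun_eq_iff) algebra
  then show ?thesis unfolding cell_poly_def[abs_def] y_def z_def .
qed

text \<open>The edge length 2h meets the factor 1/h of the derivative, so the flux does not depend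
  on h. The part of the derivative that is linear along the edge integrates to zero.\<close>

lemma edge_flux_cell_poly:
  assumes h: "h > 0" and s: "s = 1 \<or> s = -1"
  shows "edge_flux (pt (c $ 1 + s * h) (c $ 2 - h)) (pt (c $ 1 + s * h) (c $ 2 + h)) (axis 1 1) (cell_poly h c a)
      = 2 * flux1 a (s = 1)"
    and "edge_flux (pt (c $ 1 - h) (c $ 2 + s * h)) (pt (c $ 1 + h) (c $ 2 + s * h)) (axis 2 1) (cell_poly h c a)
      = 2 * flux2 a (s = 1)"
proof -
  have fd: "frechet_derivative (cell_poly h c a) (at x) = (\<lambda>v. (v $ 1 / h) * (a 1 0 + 2 * a 2 0 * ((x $ 1 - c $ 1) / h) + a 1 1 * ((x $ 2 - c $ 2) / h) + 3 * a 3 0 * ((x $ 1 - c $ 1) / h)^2)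
     + (v $ 2 / h) * (a 0 1 + a 1 1 * ((x $ 1 - c $ 1) / h) + 2 * a 0 2 * ((x $ 2 - c $ 2) / h) + 3 * a 0 3 * ((x $ 2 - c $ 2) / h)^2))" for x
    using frechet_derivative_at[OF cell_poly_has_derivative[OF h]] by metis
  have I: "integral {0..1} (\<lambda>t. (F + G * (2 * t - 1)) / h) = F / h" for F G :: real
  proof -
    have "((\<lambda>t. (F + G * (2 * t - 1)) / h) has_integral ((F * 1 + G * (1^2 - 1)) / h - (F * 0 + G * (0^2 - 0)) / h)) {0..1}"
      using h by (intro fundamental_theorem_of_calculus)
        (auto simp: has_real_derivative_iff_has_vector_derivative[symmetric] intro!: derivative_eq_intros)
    then have "((\<lambda>t. (F + G * (2 * t - 1)) / h) has_integral F / h) {0..1}" by simp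
    then show ?thesis by (rule integral_unique)
  qed
  have s2: "s^2 = 1" "s = sg (s = 1)" using s by (auto simp: sg_def)
  have n: "norm (pt 0 (2 * h)) = 2 * h" "norm (pt (2 * h) 0) = 2 * h"
    using h by (simp_all add: norm_vec_def L2_set_def UNIV_2 vector_2 real_sqrt_mult)
  have d1: "pt (c $ 1 + s * h) (c $ 2 + h) - pt (c $ 1 + s * h) (c $ 2 - h) = pt 0 (2 * h)"
    "pt (c $ 1 + h) (c $ 2 + s * h) - pt (c $ 1 - h) (c $ 2 + s * h) = pt (2 * h) 0"
    by (simp_all add: real2_eq_iff vector_2)
  have E1: "frechet_derivative (cell_poly h c a) (at (pt (c $ 1 + s * h) (c $ 2 - h) + t *\<^sub>R pt 0 (2 * h))) (axis 1 1)
    = (flux1 a (s = 1) + a 1 1 * (2 * t - 1)) / h" for t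
  proof -
    let ?x = "pt (c $ 1 + s * h) (c $ 2 - h) + t *\<^sub>R pt 0 (2 * h)"
    have x: "(?x $ 1 - c $ 1) / h = s" "(?x $ 2 - c $ 2) / h = 2 * t - 1"
      using h by (simp_all add: vector_2 field_simps)
    have ax: "(axis 1 1 :: real^2) $ 1 = 1" "(axis 1 1 :: real^2) $ 2 = 0" by (simp_all add: axis_def)
    show ?thesis unfolding fd x ax flux1_def s2(1) using s2(2) h by (simp add: field_simps)
  qed
  show "edge_flux (pt (c $ 1 + s * h) (c $ 2 - h)) (pt (c $ 1 + s * h) (c $ 2 + h)) (axis 1 1) (cell_poly h c a)
      = 2 * flux1 a (s = 1)"
    unfolding edge_flux_def d1 n E1 I using h by simp
  have E2: "frechet_derivative (cell_poly h c a) (at (pt (c $ 1 - h) (c $ 2 + s * h) + t *\<^sub>R pt (2 * h) 0)) (axis 2 1)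
    = (flux2 a (s = 1) + a 1 1 * (2 * t - 1)) / h" for t
  proof -
    let ?x = "pt (c $ 1 - h) (c $ 2 + s * h) + t *\<^sub>R pt (2 * h) 0"
    have x: "(?x $ 1 - c $ 1) / h = 2 * t - 1" "(?x $ 2 - c $ 2) / h = s"
      using h by (simp_all add: vector_2 field_simps)
    have ax: "(axis 2 1 :: real^2) $ 1 = 0" "(axis 2 1 :: real^2) $ 2 = 1" by (simp_all add: axis_def)
    show ?thesis unfolding fd x ax flux2_def s2(1) using s2(2) h by (simp add: field_simps)
  qed
  show "edge_flux (pt (c $ 1 - h) (c $ 2 + s * h)) (pt (c $ 1 + h) (c $ 2 + s * h)) (axis 2 1) (cell_poly h c a)
      = 2 * flux2 a (s = 1)"
    unfolding edge_flux_def d1 n E2 I using h by simp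
qed

lemma cell_poly_corner:
  assumes "h > 0"
  shows "cell_poly h c a (pt (c $ 1 + sg b1 * h) (c $ 2 + sg b2 * h)) = corner_value a b1 b2"
proof -
  have "sg b^2 = 1" "sg b^3 = sg b" for b by (simp_all add: sg_def)
  then show ?thesis using assms by (simp add: cell_poly_def lp_def corner_value_def vector_2 algebra_simps)
qed

lemma cell_square_disjoint:
  assumes "h > 0" "x \<in> cell h (grid_centre h c k)" "x \<in> square h (grid_centre h c k')"
  shows "k = k'"
proof -
  have "m = n" if "\<bar>y - (e + 2 * h * of_int m)\<bar> < h" "\<bar>y - (e + 2 * h * of_int n)\<bar> \<le> h" for y e and m n :: int
  proof -
    have "\<bar>2 * h * of_int m - 2 * h * of_int n\<bar> < 2 * h" using that by linarith
    also have "2 * h * of_int m - 2 * h * of_int n = 2 * h * of_int (m - n)" by (simp add: algebra_simps)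
    finally have "2 * h * \<bar>of_int (m - n) :: real\<bar> < 2 * h * 1" using assms(1) by (simp add: abs_mult)
    then have "\<bar>of_int (m - n) :: real\<bar> < 1" using assms(1) by simp
    then show ?thesis by linarith
  qed
  then show ?thesis using assms(2,3) unfolding mem_cell mem_square grid_centre_nth prod_eq_iff by blast
qed

lemma square_grid_centre_inj:
  assumes "h > 0"
  shows "square h (grid_centre h c k) = square h (grid_centre h c k') \<longleftrightarrow> k = k'"
proof
  assume "square h (grid_centre h c k) = square h (grid_centre h c k')"
  moreover have "grid_centre h c k \<in> cell h (grid_centre h c k)" using assms by (simp add: mem_cell)
  ultimately show "k = k'" using cell_square_disjoint[OF assms] cell_subset_square by blast
qed simp

text \<open>An open set that meets a closed square also meets its interior, and an interior point of
  a square belongs to no other square of the grid.\<close>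

lemma not_in_domain:
  assumes up: "uniform_partition \<Omega> h T" and op: "open \<Omega>" and grid: "\<forall>K\<in>T. \<exists>k. K = square h (grid_centre h c k)"
    and k: "square h (grid_centre h c k) \<notin> T" "x \<in> square h (grid_centre h c k)"
  shows "x \<notin> \<Omega>"
proof
  assume x: "x \<in> \<Omega>"
  have h: "h > 0" and un: "\<Union>T = closure \<Omega>" using up by (auto simp: uniform_partition_def)
  have ne: "box (grid_centre h c k - (\<chi> i. h)) (grid_centre h c k + (\<chi> i. h)) \<noteq> {}"
  proof -
    have "grid_centre h c k \<in> cell h (grid_centre h c k)" using h by (simp add: mem_cell)
    then show ?thesis unfolding cell_def by blast
  qed
  have "x \<in> closure (cell h (grid_centre h c k))" using k(2) closure_box[OF ne] by (simp add: cell_def square_def)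
  then have "\<Omega> \<inter> cell h (grid_centre h c k) \<noteq> {}"
    using open_Int_closure_eq_empty[OF op] x by blast
  then obtain y where y: "y \<in> \<Omega>" "y \<in> cell h (grid_centre h c k)" by blast
  have "y \<in> \<Union>T" using un closure_subset[of \<Omega>] y(1) by auto
  then obtain K where K: "K \<in> T" "y \<in> K" by auto
  obtain k' where "K = square h (grid_centre h c k')" using grid K(1) by blast
  with K have "square h (grid_centre h c k') \<in> T" "y \<in> square h (grid_centre h c k')" by auto
  then show False using cell_square_disjoint[OF h y(2)] k(1) by blast
qed

text \<open>A vertex in \<Omega> is touched only by squares of the partition; at any other vertex
  all values are zero, by the boundary condition or by the extension. For an edge not contained in
  the frontier, two squares of which just one belonged to the partition would leave the edge without
  points of \<Omega> and so put it into the frontier; hence both belong or neither does.\<close>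

lemma grid_coefficients:
  assumes up: "uniform_partition \<Omega> h T" and op: "open \<Omega>" and grid: "\<forall>K\<in>T. \<exists>k. K = square h (grid_centre h c k)"
    and w: "w \<in> morley_space \<Omega> T"
  shows "\<exists>A :: int \<times> int \<Rightarrow> nat \<Rightarrow> nat \<Rightarrow> real.
    (\<forall>k. square h (grid_centre h c k) \<notin> T \<longrightarrow> A k = (\<lambda>_ _. 0)) \<and>
    (\<forall>k. square h (grid_centre h c k) \<in> T \<longrightarrow> (AE x in lebesgue_on (square h (grid_centre h c k)). w x = cell_poly h (grid_centre h c k) (A k) x)) \<and>
    (\<forall>i j b. corner_value (A (i, j)) True b = corner_value (A (i + 1, j)) False b) \<and>
    (\<forall>i j b. corner_value (A (i, j)) b True = corner_value (A (i, j + 1)) b False) \<and>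
    (\<forall>i j. flux1 (A (i, j)) True = flux1 (A (i + 1, j)) False) \<and>
    (\<forall>i j. flux2 (A (i, j)) True = flux2 (A (i, j + 1)) False)"
proof -
  have h: "h > 0" and un: "\<Union>T = closure \<Omega>" using up by (auto simp: uniform_partition_def)
  obtain p where P: "(\<forall>K\<in>T. p K \<in> morley_polys \<and> (AE x in lebesgue_on K. w x = p K x)) \<and>
       (\<forall>K\<in>T. \<forall>K'\<in>T. \<forall>z. z extreme_point_of K \<and> z extreme_point_of K' \<and> z \<in> \<Omega> \<longrightarrow> p K z = p K' z) \<and>
       (\<forall>K\<in>T. \<forall>z. z extreme_point_of K \<and> z \<in> frontier \<Omega> \<longrightarrow> p K z = 0) \<and>
       (\<forall>K\<in>T. \<forall>K'\<in>T. \<forall>a b n. closed_segment a b edge_of K \<and> closed_segment a b edge_of K' \<and>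
          \<not> closed_segment a b \<subseteq> frontier \<Omega> \<and> unit_normal a b n \<longrightarrow> edge_flux a b n (p K) = edge_flux a b n (p K')) \<and>
       (\<forall>K\<in>T. \<forall>a b n. closed_segment a b edge_of K \<and> closed_segment a b \<subseteq> frontier \<Omega> \<and> unit_normal a b n \<longrightarrow>
          edge_flux a b n (p K) = 0)"
    using w[unfolded morley_space_def mem_Collect_eq, THEN conjunct2] ..
  note P1 = P[THEN conjunct1] and P2 = P[THEN conjunct2, THEN conjunct1] and P3 = P[THEN conjunct2, THEN conjunct2, THEN conjunct1]
    and P4 = P[THEN conjunct2, THEN conjunct2, THEN conjunct2, THEN conjunct1] and P5 = P[THEN conjunct2, THEN conjunct2, THEN conjunct2, THEN conjunct2]
  have p1: "\<And>K. K \<in> T \<Longrightarrow> p K \<in> morley_polys" and p2: "\<And>K. K \<in> T \<Longrightarrow> AE x in lebesgue_on K. w x = p K x"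
    by (rule P1[rule_format, THEN conjunct1], assumption) (rule P1[rule_format, THEN conjunct2], assumption)
  have v1: "\<And>K K' z. K \<in> T \<Longrightarrow> K' \<in> T \<Longrightarrow> z extreme_point_of K \<Longrightarrow> z extreme_point_of K' \<Longrightarrow> z \<in> \<Omega> \<Longrightarrow> p K z = p K' z"
    by (rule P2[rule_format]; (intro conjI)?; assumption)
  have v2: "\<And>K z. K \<in> T \<Longrightarrow> z extreme_point_of K \<Longrightarrow> z \<in> frontier \<Omega> \<Longrightarrow> p K z = 0"
    by (rule P3[rule_format]; (intro conjI)?; assumption)
  have f1: "\<And>K K' a b n. K \<in> T \<Longrightarrow> K' \<in> T \<Longrightarrow> closed_segment a b edge_of K \<Longrightarrow> closed_segment a b edge_of K' \<Longrightarrow>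
        \<not> closed_segment a b \<subseteq> frontier \<Omega> \<Longrightarrow> unit_normal a b n \<Longrightarrow> edge_flux a b n (p K) = edge_flux a b n (p K')"
    by (rule P4[rule_format]; (intro conjI)?; assumption)
  have f2: "\<And>K a b n. K \<in> T \<Longrightarrow> closed_segment a b edge_of K \<Longrightarrow> closed_segment a b \<subseteq> frontier \<Omega> \<Longrightarrow> unit_normal a b n \<Longrightarrow>
        edge_flux a b n (p K) = 0"
    by (rule P5[rule_format]; (intro conjI)?; assumption)
  let ?S = "\<lambda>k. square h (grid_centre h c k)"
  have "\<exists>a. ?S k \<in> T \<longrightarrow> p (?S k) = cell_poly h (grid_centre h c k) a" for k using morley_polys_local[OF p1 h] by blast
  then obtain A0 where A0: "\<And>k. ?S k \<in> T \<Longrightarrow> p (?S k) = cell_poly h (grid_centre h c k) (A0 k)" by metis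
  define A where "A k = (if ?S k \<in> T then A0 k else (\<lambda>_ _. 0))" for k
  have pA: "p (?S k) = cell_poly h (grid_centre h c k) (A k)" if "?S k \<in> T" for k using A0 that by (simp add: A_def)
  have zA: "A k = (\<lambda>_ _. 0)" if "?S k \<notin> T" for k using that by (simp add: A_def)
  have fr: "x \<in> frontier \<Omega>" if "x \<notin> \<Omega>" "?S k \<in> T" "x \<in> ?S k" for x k
    using that un op by (auto simp: frontier_def interior_open)
  have V: "cell_poly h (grid_centre h c k) (A k) z = cell_poly h (grid_centre h c k') (A k') z"
    if z: "z extreme_point_of ?S k" "z extreme_point_of ?S k'" for z k k'
  proof -
    have m: "z \<in> ?S k" "z \<in> ?S k'" using z by (auto simp: extreme_point_of_def)
    show ?thesis
    proof (cases "z \<in> \<Omega>")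
      case True
      then have "?S k \<in> T" "?S k' \<in> T" using not_in_domain[OF up op grid] m by blast+
      then show ?thesis using v1 z True pA by metis
    next
      case False
      have "cell_poly h (grid_centre h c k) (A k) z = 0" if "z extreme_point_of ?S k" "z \<in> ?S k" for k
      proof (cases "?S k \<in> T")
        case True
        then show ?thesis using v2[OF True that(1) fr[OF False True that(2)]] pA by simp
      next
        case False
        then show ?thesis by (simp add: zA cell_poly_def lp_def)
      qed
      then show ?thesis using z m by metis
    qed
  qed
  have F: "edge_flux a b n (cell_poly h (grid_centre h c k) (A k)) = edge_flux a b n (cell_poly h (grid_centre h c k') (A k'))"
    if e: "closed_segment a b edge_of ?S k" "closed_segment a b edge_of ?S k'" "unit_normal a b n" for a b n k k'
  proof (cases "closed_segment a b \<subseteq> frontier \<Omega>")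
    case True
    have "edge_flux a b n (cell_poly h (grid_centre h c k) (A k)) = 0" if "closed_segment a b edge_of ?S k" for k
    proof (cases "?S k \<in> T")
      case inT: True
      then show ?thesis using f2[OF inT that True e(3)] pA by simp
    next
      case False
      have "cell_poly h (grid_centre h c k) (A k) = (\<lambda>_. 0)" by (simp add: zA[OF False] cell_poly_def lp_def fun_eq_iff)
      then show ?thesis by (simp add: edge_flux_def)
    qed
    then show ?thesis using e by metis
  next
    case False
    have sub: "closed_segment a b \<subseteq> ?S k" "closed_segment a b \<subseteq> ?S k'"
      using e(1,2) face_of_imp_subset by (auto simp: edge_of_def)
    show ?thesis
    proof (cases "?S k \<in> T \<and> ?S k' \<in> T")
      case True
      then show ?thesis using f1[of "?S k" "?S k'" a b n] e False pA by simp
    next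
      case notT: False
      show ?thesis
      proof (cases "?S k \<in> T \<or> ?S k' \<in> T")
        case True
        have "x \<in> frontier \<Omega>" if "x \<in> closed_segment a b" for x
        proof -
          have "x \<notin> \<Omega>" using notT not_in_domain[OF up op grid] sub that by blast
          then show ?thesis using True fr sub that by blast
        qed
        then show ?thesis using False by blast
      next
        case none: False
        have "cell_poly h (grid_centre h c k) (A k) = (\<lambda>_. 0)" "cell_poly h (grid_centre h c k') (A k') = (\<lambda>_. 0)"
          using none by (simp_all add: zA cell_poly_def lp_def fun_eq_iff)
        then show ?thesis by simp
      qed
    qed
  qed
  have sgc: "sg b = 1 \<or> sg b = -1" for b by (simp add: sg_def)
  have X1: "grid_centre h c (i, j) $ 1 + 1 * h = grid_centre h c (i + 1, j) $ 1 + (-1) * h" "grid_centre h c (i, j) $ 2 = grid_centre h c (i + 1, j) $ 2" for i j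
    by (simp_all add: algebra_simps)
  have X2: "grid_centre h c (i, j) $ 2 + 1 * h = grid_centre h c (i, j + 1) $ 2 + (-1) * h" "grid_centre h c (i, j) $ 1 = grid_centre h c (i, j + 1) $ 1" for i j
    by (simp_all add: algebra_simps)
  have c1: "corner_value (A (i, j)) True b = corner_value (A (i + 1, j)) False b" for i j b
  proof -
    let ?z = "pt (grid_centre h c (i, j) $ 1 + 1 * h) (grid_centre h c (i, j) $ 2 + sg b * h)"
    have z': "?z = pt (grid_centre h c (i + 1, j) $ 1 + (-1) * h) (grid_centre h c (i + 1, j) $ 2 + sg b * h)" using X1[of i j] by metis
    have "?z extreme_point_of ?S (i, j)" by (rule square_corner[OF h _ sgc]) simp
    moreover have "?z extreme_point_of ?S (i + 1, j)" unfolding z' by (rule square_corner[OF h _ sgc]) simp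
    ultimately have "cell_poly h (grid_centre h c (i, j)) (A (i, j)) ?z = cell_poly h (grid_centre h c (i + 1, j)) (A (i + 1, j)) ?z" by (rule V)
    then show ?thesis using cell_poly_corner[OF h, of "grid_centre h c (i, j)" "A (i, j)" True b] z'
        cell_poly_corner[OF h, of "grid_centre h c (i + 1, j)" "A (i + 1, j)" False b]
      by (metis sg_def)
  qed
  have c2: "corner_value (A (i, j)) b True = corner_value (A (i, j + 1)) b False" for i j b
  proof -
    let ?z = "pt (grid_centre h c (i, j) $ 1 + sg b * h) (grid_centre h c (i, j) $ 2 + 1 * h)"
    have z': "?z = pt (grid_centre h c (i, j + 1) $ 1 + sg b * h) (grid_centre h c (i, j + 1) $ 2 + (-1) * h)" using X2[of i j] by metis
    have "?z extreme_point_of ?S (i, j)" by (rule square_corner[OF h sgc]) simp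
    moreover have "?z extreme_point_of ?S (i, j + 1)" unfolding z' by (rule square_corner[OF h sgc]) simp
    ultimately have "cell_poly h (grid_centre h c (i, j)) (A (i, j)) ?z = cell_poly h (grid_centre h c (i, j + 1)) (A (i, j + 1)) ?z" by (rule V)
    then show ?thesis using cell_poly_corner[OF h, of "grid_centre h c (i, j)" "A (i, j)" b True] z'
        cell_poly_corner[OF h, of "grid_centre h c (i, j + 1)" "A (i, j + 1)" b False]
      by (metis sg_def)
  qed
  have un1: "unit_normal (pt y z) (pt y z') (axis 1 1)" "unit_normal (pt z y) (pt z' y) (axis 2 1)" for y z z'
    by (simp_all add: unit_normal_def inner_axis' vector_2)
  have g1: "flux1 (A (i, j)) True = flux1 (A (i + 1, j)) False" for i j
  proof -
    let ?a = "pt (grid_centre h c (i, j) $ 1 + 1 * h) (grid_centre h c (i, j) $ 2 - h)" and ?b = "pt (grid_centre h c (i, j) $ 1 + 1 * h) (grid_centre h c (i, j) $ 2 + h)"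
    have ab: "?a = pt (grid_centre h c (i + 1, j) $ 1 + (-1) * h) (grid_centre h c (i + 1, j) $ 2 - h)" "?b = pt (grid_centre h c (i + 1, j) $ 1 + (-1) * h) (grid_centre h c (i + 1, j) $ 2 + h)"
      using X1[of i j] by metis+
    have e1: "closed_segment ?a ?b edge_of ?S (i, j)" by (rule square_edges(1)[OF h]) simp
    have e2: "closed_segment ?a ?b edge_of ?S (i + 1, j)" unfolding ab by (rule square_edges(1)[OF h]) simp
    have f1: "edge_flux ?a ?b (axis 1 1) (cell_poly h (grid_centre h c (i, j)) (A (i, j))) = 2 * flux1 (A (i, j)) (1 = (1::real))"
      by (rule edge_flux_cell_poly(1)[OF h]) simp
    have f2: "edge_flux ?a ?b (axis 1 1) (cell_poly h (grid_centre h c (i + 1, j)) (A (i + 1, j))) = 2 * flux1 (A (i + 1, j)) (-1 = (1::real))"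
      unfolding ab by (rule edge_flux_cell_poly(1)[OF h]) simp
    show ?thesis using F[OF e1 e2 un1(1)] unfolding f1 f2 by simp
  qed
  have g2: "flux2 (A (i, j)) True = flux2 (A (i, j + 1)) False" for i j
  proof -
    let ?a = "pt (grid_centre h c (i, j) $ 1 - h) (grid_centre h c (i, j) $ 2 + 1 * h)" and ?b = "pt (grid_centre h c (i, j) $ 1 + h) (grid_centre h c (i, j) $ 2 + 1 * h)"
    have ab: "?a = pt (grid_centre h c (i, j + 1) $ 1 - h) (grid_centre h c (i, j + 1) $ 2 + (-1) * h)" "?b = pt (grid_centre h c (i, j + 1) $ 1 + h) (grid_centre h c (i, j + 1) $ 2 + (-1) * h)"
      using X2[of i j] by metis+
    have e1: "closed_segment ?a ?b edge_of ?S (i, j)" by (rule square_edges(2)[OF h]) simp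
    have e2: "closed_segment ?a ?b edge_of ?S (i, j + 1)" unfolding ab by (rule square_edges(2)[OF h]) simp
    have f1: "edge_flux ?a ?b (axis 2 1) (cell_poly h (grid_centre h c (i, j)) (A (i, j))) = 2 * flux2 (A (i, j)) (1 = (1::real))"
      by (rule edge_flux_cell_poly(2)[OF h]) simp
    have f2: "edge_flux ?a ?b (axis 2 1) (cell_poly h (grid_centre h c (i, j + 1)) (A (i, j + 1))) = 2 * flux2 (A (i, j + 1)) (-1 = (1::real))"
      unfolding ab by (rule edge_flux_cell_poly(2)[OF h]) simp
    show ?thesis using F[OF e1 e2 un1(2)] unfolding f1 f2 by simp
  qed
  have "AE x in lebesgue_on (?S k). w x = cell_poly h (grid_centre h c k) (A k) x" if "?S k \<in> T" for k
    using p2[OF that] unfolding pA[OF that] .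
  then show ?thesis using zA c1 c2 g1 g2 by (intro exI[of _ A]) simp
qed

section \<open>Hessians of Sobolev functions and of products\<close>

text \<open>Completeness of \<open>lebesgue\<close>: preimages under \<open>f\<close> and
  \<open>g\<close> differ only inside a null set, all of whose subsets are measurable.\<close>

lemma lebesgue_measurable_cong_AE:
  fixes f g :: "real^2 \<Rightarrow> real"
  assumes U: "U \<in> sets lebesgue" and g: "g \<in> borel_measurable (lebesgue_on U)"
    and ae: "AE x in lebesgue_on U. f x = g x"
  shows "f \<in> borel_measurable (lebesgue_on U)"
proof (rule measurableI)
  fix S :: "real set" assume S: "S \<in> sets borel"
  have "AE x in lebesgue. x \<in> U \<longrightarrow> f x = g x" using ae U by (simp add: AE_lebesgue_on)
  then obtain N where N: "N \<in> null_sets lebesgue" "{x. \<not> (x \<in> U \<longrightarrow> f x = g x)} \<subseteq> N"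
    unfolding eventually_ae_filter by auto
  have "g -` S \<inter> space (lebesgue_on U) \<in> sets (lebesgue_on U)" using g S by (rule measurable_sets)
  then have 1: "g -` S \<inter> U \<in> sets lebesgue" using U by (simp add: sets_restrict_space_iff)
  have "f -` S \<inter> U \<inter> N \<subseteq> N" by blast
  then have 2: "f -` S \<inter> U \<inter> N \<in> null_sets lebesgue" using N(1) by (rule null_sets_completion_subset)
  have "f -` S \<inter> U = ((g -` S \<inter> U) - N) \<union> (f -` S \<inter> U \<inter> N)" using N(2) by auto
  also have "\<dots> \<in> sets lebesgue" by (intro sets.Un sets.Diff 1 null_setsD2[OF 2] null_setsD2[OF N(1)])
  finally show "f -` S \<inter> space (lebesgue_on U) \<in> sets (lebesgue_on U)"
    using U by (simp add: sets_restrict_space_iff)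
qed simp

lemma L2_cong_AE:
  assumes "U \<in> sets lebesgue" "L2 U g" "AE x in lebesgue_on U. f x = g x"
  shows "L2 U f"
proof -
  have m: "f \<in> borel_measurable (lebesgue_on U)"
    by (rule lebesgue_measurable_cong_AE[OF assms(1) L2_measurable[OF assms(2)] assms(3)])
  moreover have "integrable (lebesgue_on U) (\<lambda>x. (f x)\<^sup>2)"
  proof (rule integrable_cong_AE_imp[OF L2_integrable_square[OF assms(2)]])
    show "(\<lambda>x. (f x)\<^sup>2) \<in> borel_measurable (lebesgue_on U)" using m by measurable
    show "AE x in lebesgue_on U. (g x)\<^sup>2 = (f x)\<^sup>2" using assms(3) by eventually_elim simp
  qed
  ultimately show ?thesis by (simp add: L2_def)
qed

lemma integral_subset_lebesgue_on:
  fixes f :: "real^2 \<Rightarrow> real"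
  assumes "U \<in> sets lebesgue" "V \<in> sets lebesgue" "V \<subseteq> U"
  shows "integrable (lebesgue_on U) f \<Longrightarrow> integrable (lebesgue_on V) f"
    and "(\<And>x. x \<in> U - V \<Longrightarrow> f x = 0) \<Longrightarrow> (LINT x|lebesgue_on U. f x) = (LINT x|lebesgue_on V. f x)"
proof -
  assume "integrable (lebesgue_on U) f"
  then have "integrable lebesgue (\<lambda>x. indicator U x * f x)" using assms by (simp add: integrable_lebesgue_on)
  then have "integrable lebesgue (\<lambda>x. indicator V x *\<^sub>R (indicator U x * f x))"
    by (rule integrable_mult_indicator[OF assms(2)])
  moreover have "(\<lambda>x. indicator V x *\<^sub>R (indicator U x * f x)) = (\<lambda>x. indicator V x * f x)"
    using assms(3) by (auto simp: fun_eq_iff indicator_def)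
  ultimately show "integrable (lebesgue_on V) f" using assms by (simp add: integrable_lebesgue_on)
next
  assume z: "\<And>x. x \<in> U - V \<Longrightarrow> f x = 0"
  have "(\<lambda>x. indicator U x * f x) = (\<lambda>x. indicator V x * f x)"
    using assms(3) z by (auto simp: fun_eq_iff indicator_def)
  then show "(LINT x|lebesgue_on U. f x) = (LINT x|lebesgue_on V. f x)"
    using assms by (simp add: integral_lebesgue_on)
qed

lemma measurable_lebesgue_on_subset:
  "V \<subseteq> U \<Longrightarrow> f \<in> borel_measurable (lebesgue_on U) \<Longrightarrow> f \<in> borel_measurable (lebesgue_on V)"
  using measurable_restrict_mono by blast

lemma L2_subset:
  assumes "U \<in> sets lebesgue" "V \<in> sets lebesgue" "V \<subseteq> U" "L2 U f"
  shows "L2 V f"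
  using assms integral_subset_lebesgue_on(1)[OF assms(1-3)] measurable_lebesgue_on_subset[OF assms(3)]
  by (auto simp: L2_def)

lemma AE_lebesgue_on_subset:
  assumes "U \<in> sets lebesgue" "V \<in> sets lebesgue" "V \<subseteq> U" "AE x in lebesgue_on U. P x"
  shows "AE x in lebesgue_on V. P x"
  using assms(4) unfolding AE_lebesgue_on[OF assms(1)] AE_lebesgue_on[OF assms(2)]
  by eventually_elim (use assms(3) in auto)

abbreviation mi :: "nat \<Rightarrow> nat \<Rightarrow> nat^2" where "mi i j \<equiv> vector [i, j]"

lemma multi_order_mi: "multi_order (mi i j) = i + j"
  by (simp add: multi_order_def vector_2)

lemma axis_mi: "axis 1 1 + axis 1 1 = mi 2 0" "axis 1 1 + axis 2 1 = mi 1 1"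
   "axis 2 1 + axis 1 1 = mi 1 1" "axis 2 1 + axis 2 1 = mi 0 2"
  by (simp_all add: vec_eq_iff forall_2 axis_def vector_2)

text \<open>\<open>hessian\<close> contains arbitrarily chosen weak derivatives. By uniqueness they
  equal any given ones almost everywhere, which makes explicit formulas available.\<close>

lemma a_form_eq:
  assumes U: "open U" and S: "\<And>i. i < 3 \<Longrightarrow> has_weak_deriv U (mi (2 - i) i) u (S i)" "\<And>i. i < 3 \<Longrightarrow> L2 U (S i)"
    and V: "\<And>i. i < 3 \<Longrightarrow> has_weak_deriv U (mi (2 - i) i) v (V i)" "\<And>i. i < 3 \<Longrightarrow> L2 U (V i)"
  shows "a_form U u v = (LINT x|lebesgue_on U. S 0 x * V 0 x + 2 * (S 1 x * V 1 x) + S 2 x * V 2 x)"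
    and "integrable (lebesgue_on U) (\<lambda>x. S 0 x * V 0 x + 2 * (S 1 x * V 1 x) + S 2 x * V 2 x)"
proof -
  have e: "hessian U u x \<bullet> hessian U v x = weak_deriv U (mi 2 0) u x * weak_deriv U (mi 2 0) v x
    + 2 * (weak_deriv U (mi 1 1) u x * weak_deriv U (mi 1 1) v x) + weak_deriv U (mi 0 2) u x * weak_deriv U (mi 0 2) v x" for x
    by (simp add: hessian_def inner_vec_def UNIV_2 axis_mi del: One_nat_def)
  have i: "integrable (lebesgue_on U) (\<lambda>x. S i x * V i x)" if "i < 3" for i
    using L2_integrable_mult S(2) V(2) that by blast
  show int: "integrable (lebesgue_on U) (\<lambda>x. S 0 x * V 0 x + 2 * (S 1 x * V 1 x) + S 2 x * V 2 x)"
    using i[of 0] i[of 1] i[of 2] by simp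
  have w: "AE x in lebesgue_on U. weak_deriv U (mi (2 - i) i) u x = S i x" "AE x in lebesgue_on U. weak_deriv U (mi (2 - i) i) v x = V i x"
    if "i < 3" for i using weak_deriv_AE[OF U S(1)[OF that]] weak_deriv_AE[OF U V(1)[OF that]] by auto
  have w0: "AE x in lebesgue_on U. weak_deriv U (mi 2 0) u x = S 0 x" "AE x in lebesgue_on U. weak_deriv U (mi 2 0) v x = V 0 x"
    and w1: "AE x in lebesgue_on U. weak_deriv U (mi 1 1) u x = S 1 x" "AE x in lebesgue_on U. weak_deriv U (mi 1 1) v x = V 1 x"
    and w2: "AE x in lebesgue_on U. weak_deriv U (mi 0 2) u x = S 2 x" "AE x in lebesgue_on U. weak_deriv U (mi 0 2) v x = V 2 x"
    using w[of 0] w[of 1] w[of 2] by simp_all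
  have ae: "AE x in lebesgue_on U. hessian U u x \<bullet> hessian U v x = S 0 x * V 0 x + 2 * (S 1 x * V 1 x) + S 2 x * V 2 x"
    using w0 w1 w2 unfolding e by eventually_elim simp
  show "a_form U u v = (LINT x|lebesgue_on U. S 0 x * V 0 x + 2 * (S 1 x * V 1 x) + S 2 x * V 2 x)"
    unfolding a_form_def
    by (rule integral_cong_AE[OF _ _ ae])
       (use lebesgue_measurable_cong_AE[OF open_sets_lebesgue[OF U] borel_measurable_integrable[OF int] ae] int in auto)
qed

lemma sobolev_weak_deriv:
  assumes "open U" "u \<in> sobolev m U" "multi_order \<alpha> \<le> m"
  shows "has_weak_deriv U \<alpha> u (weak_deriv U \<alpha> u)" "L2 U (weak_deriv U \<alpha> u)"
proof -
  obtain g where g: "L2 U g" "has_weak_deriv U \<alpha> u g" using assms unfolding sobolev_def by blast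
  show "has_weak_deriv U \<alpha> u (weak_deriv U \<alpha> u)"
    unfolding weak_deriv_def by (rule someI[where P = "\<lambda>g. has_weak_deriv U \<alpha> u g", OF g(2)])
  show "L2 U (weak_deriv U \<alpha> u)"
    by (rule L2_cong_AE[OF open_sets_lebesgue[OF assms(1)] g(1) weak_deriv_AE[OF assms(1) g(2)]])
qed

subsection \<open>Rescaled products as test functions\<close>

text \<open>The derivative of order \<open>\<alpha>\<close> of \<open>ctens h c A B\<close>, written
  again as a rescaled product; \<open>classical_deriv_ctens\<close> justifies this.\<close>

definition dct :: "nat^2 \<Rightarrow> real \<Rightarrow> real^2 \<Rightarrow> (real \<Rightarrow> real) \<Rightarrow> (real \<Rightarrow> real) \<Rightarrow> real^2 \<Rightarrow> real" where
  "dct \<alpha> h c A B x = (1 / h) ^ multi_order \<alpha> * ctens h c ((deriv ^^ (\<alpha> $ 1)) A) ((deriv ^^ (\<alpha> $ 2)) B) x"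

lemma tens_funpow_resc:
  assumes "smooth1 A" "smooth1 B"
  shows "tens ((deriv ^^ (\<alpha> $ 1)) (resc h (c $ 1) A)) ((deriv ^^ (\<alpha> $ 2)) (resc h (c $ 2) B)) = dct \<alpha> h c A B"
  by (simp add: funpow_deriv_resc assms tens_def dct_def ctens_def multi_order_def power_add fun_eq_iff)

lemma classical_deriv_ctens:
  "smooth1 A \<Longrightarrow> smooth1 B \<Longrightarrow> classical_deriv \<alpha> (ctens h c A B) = dct \<alpha> h c A B"
  unfolding ctens_def by (simp add: classical_deriv_tens smooth1_resc tens_funpow_resc)

lemma has_weak_deriv_ctens:
  assumes "open U" "smooth1 A" "smooth1 B"
  shows "has_weak_deriv U \<alpha> (ctens h c A B) (dct \<alpha> h c A B)"
  unfolding ctens_def using has_weak_deriv_tens[OF assms(1) smooth1_resc[OF assms(2)] smooth1_resc[OF assms(3)], of \<alpha> h "c $ 1" h "c $ 2"]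
  by (simp add: tens_funpow_resc assms)

lemma ctens_test:
  assumes "h > 0" "smooth1 A" "smooth1 B" "cbox (pt (c $ 1 - a * h) (c $ 2 - b * h)) (pt (c $ 1 + a * h) (c $ 2 + b * h)) \<subseteq> U"
    "\<And>x. x \<notin> {-a..a} \<Longrightarrow> A x = 0" "\<And>x. x \<notin> {-b..b} \<Longrightarrow> B x = 0"
  shows "ctens h c A B \<in> test_functions U"
proof -
  have *: "resc h e F x = 0" if "x \<notin> {e - d * h..e + d * h}" "\<And>x. x \<notin> {-d..d} \<Longrightarrow> F x = 0" for e d x and F :: "real \<Rightarrow> real"
  proof -
    have "(x - e) / h \<notin> {-d..d}" using that(1) assms(1) by (auto simp: field_simps)
    then show ?thesis using that(2) by (simp add: resc_def)
  qed
  show ?thesis unfolding ctens_def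
    by (rule tens_test[OF smooth1_resc[OF assms(2)] smooth1_resc[OF assms(3)] assms(4)]) (use * assms(5,6) in blast)+
qed

lemma continuous_on_dct:
  "smooth1 A \<Longrightarrow> smooth1 B \<Longrightarrow> continuous_on S (dct \<alpha> h c A B)"
  unfolding dct_def[abs_def] by (intro continuous_intros continuous_on_ctens smooth1_funpow_deriv)

lemma L2_continuous_compact_support:
  assumes "continuous_on UNIV (g :: real^2 \<Rightarrow> real)" "compact C" "\<And>x. x \<notin> C \<Longrightarrow> g x = 0" "U \<in> sets lebesgue"
  shows "L2 U g"
proof -
  have "integrable lborel (\<lambda>x. (g x)\<^sup>2)"
    by (rule integrable_continuous_compact_support[OF _ assms(2)]) (use assms in \<open>auto intro!: continuous_intros\<close>)
  then have "integrable lebesgue (\<lambda>x. (g x)\<^sup>2)" using integrable_completion by blast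
  then have "integrable lebesgue (\<lambda>x. indicator U x *\<^sub>R (g x)\<^sup>2)" by (rule integrable_mult_indicator[OF assms(4)])
  then show ?thesis unfolding L2_def using assms(4)
    by (auto simp: integrable_lebesgue_on intro!: measurable_restrict_space1 borel_measurable_lebesgue_continuous assms(1))
qed

lemma L2_bounded_set_continuous:
  assumes "continuous_on UNIV (g :: real^2 \<Rightarrow> real)" "h > 0"
  shows "L2 (cell h c) g"
proof -
  have "integrable lborel (\<lambda>x. indicator (square h c) x *\<^sub>R (g x)\<^sup>2)"
    unfolding square_def by (rule borel_integrable_compact) (auto intro!: continuous_intros continuous_on_subset[OF assms(1)])
  then have "integrable lebesgue (\<lambda>x. indicator (square h c) x *\<^sub>R (g x)\<^sup>2)" using integrable_completion by blast
  then have "integrable (lebesgue_on (square h c)) (\<lambda>x. (g x)\<^sup>2)" by (simp add: integrable_lebesgue_on square_def)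
  then have "L2 (square h c) g" unfolding L2_def
    by (auto intro!: measurable_restrict_space1 borel_measurable_lebesgue_continuous assms(1))
  then show ?thesis by (rule L2_subset[rotated 3]) (use cell_subset_square in \<open>auto simp: square_def\<close>)
qed

lemma dct_zero_off:
  assumes "ctens h c A B \<in> test_functions U" "smooth1 A" "smooth1 B"
  obtains C where "compact C" "C \<subseteq> U" "\<And>x \<alpha>. x \<notin> C \<Longrightarrow> dct \<alpha> h c A B x = 0"
proof -
  obtain C where C: "smooth (ctens h c A B)" "compact C" "C \<subseteq> U" "\<And>x. x \<notin> C \<Longrightarrow> ctens h c A B x = 0"
    using test_functionsD[OF assms(1)] by blast
  show ?thesis
    by (rule that[OF C(2,3)]) (use classical_deriv_zero_off[OF C(1,2,4)] classical_deriv_ctens[OF assms(2,3)] in metis)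
qed

lemma has_weak_deriv_zero: "open U \<Longrightarrow> has_weak_deriv U \<alpha> (\<lambda>x. 0) (\<lambda>x. 0)"
  using has_weak_deriv_cmult[OF has_weak_deriv_ctens[OF _ smooth1_bump smooth1_bump], of U \<alpha> 0 1 0] by simp

text \<open>The constant sequence approximates a test function. The difference is the zero function,
  but its chosen weak derivatives are only known to vanish almost everywhere, so its Sobolev norm
  has to be computed.\<close>

lemma ctens_sobolev0:
  assumes "open U" "ctens h c A B \<in> test_functions U" "smooth1 A" "smooth1 B"
  shows "ctens h c A B \<in> sobolev0 m U"
proof -
  have Us: "U \<in> sets lebesgue" using assms(1) by simp
  obtain C where C: "compact C" "C \<subseteq> U" "\<And>x \<alpha>. x \<notin> C \<Longrightarrow> dct \<alpha> h c A B x = 0" using dct_zero_off[OF assms(2-4)] by blast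
  have d: "L2 U (dct \<alpha> h c A B)" for \<alpha>
    by (rule L2_continuous_compact_support[OF continuous_on_dct[OF assms(3,4)] C(1) C(3) Us])
  have "dct 0 h c A B = ctens h c A B" by (simp add: dct_def multi_order_def fun_eq_iff)
  then have "L2 U (ctens h c A B)" using d[of 0] by simp
  then have 1: "ctens h c A B \<in> sobolev m U"
    unfolding sobolev_def using d has_weak_deriv_ctens[OF assms(1,3,4)] by blast
  have "L2_norm U (weak_deriv U \<alpha> (\<lambda>x. 0)) = 0" for \<alpha>
  proof -
    have ae: "AE x in lebesgue_on U. weak_deriv U \<alpha> (\<lambda>x. 0) x = 0"
      by (rule weak_deriv_AE[OF assms(1) has_weak_deriv_zero[OF assms(1)]])
    have "(LINT x|lebesgue_on U. weak_deriv U \<alpha> (\<lambda>x. 0) x * weak_deriv U \<alpha> (\<lambda>x. 0) x) = 0"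
      by (rule integral_eq_zero_AE) (use ae in eventually_elim, simp)
    then show ?thesis by (simp add: L2_norm_def L2_inner_def)
  qed
  then have "sobolev_norm m U (\<lambda>x. ctens h c A B x - ctens h c A B x) = 0" by (simp add: sobolev_norm_def)
  then show ?thesis unfolding sobolev0_def using 1 assms(2) by (auto intro!: exI[of _ "\<lambda>_. ctens h c A B"])
qed

section \<open>The weak equation tested with rescaled products\<close>

text \<open>Both pairings are turned into integrals of \<open>u\<close> against the same classical
  derivative of the product, so \<open>s\<close> and \<open>t\<close> never have to be compared
  directly. The two signs agree since \<open>m + n\<close> is even.\<close>

lemma cell_weak_of_weak_deriv:
  assumes U: "open U" "cell h c \<subseteq> U" "h > 0"
    and w: "has_weak_deriv U (mi i j) u s" "has_weak_deriv U (mi (i + m) (j + n)) u t"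
    and even: "m + n = 2"
  shows "cell_weak h c m n s t"
  unfolding cell_weak_def
proof (intro allI impI)
  fix A B :: "real \<Rightarrow> real" and r :: real
  assume AB: "smooth1 A" "smooth1 B" and r: "r < 1" and z: "\<forall>x. x \<notin> {- r..r} \<longrightarrow> A x = 0 \<and> B x = 0"
  have zd: "(deriv ^^ k) F x = 0" if "x \<notin> {-r..r}" "\<And>x. x \<notin> {-r..r} \<Longrightarrow> F x = 0" for F :: "real \<Rightarrow> real" and k x
    using that(1)
  proof (induction k arbitrary: x)
    case (Suc k)
    show ?case using Suc by (simp, intro deriv_zero_off[of "- {-r..r}"]) auto
  qed (use that(2) in auto)
  have zA: "(deriv ^^ k) A x = 0" "(deriv ^^ k) B x = 0" if "x \<notin> {-r..r}" for k x using zd[OF that] z by auto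
  have test: "ctens h c ((deriv ^^ k) A) ((deriv ^^ l) B) \<in> test_functions (cell h c)" for k l
  proof (rule ctens_test[OF U(3) _ _ _ zA])
    have "r * h < h" using r U(3) by simp
    then show "cbox (pt (c $ 1 - r * h) (c $ 2 - r * h)) (pt (c $ 1 + r * h) (c $ 2 + r * h)) \<subseteq> cell h c"
      by (auto simp: mem_cell mem_box_cart forall_2 vector_2)
  qed (use AB smooth1_funpow_deriv in auto)
  have testU: "ctens h c ((deriv ^^ k) A) ((deriv ^^ l) B) \<in> test_functions U" for k l
    using test test_functions_mono[OF U(2)] by blast
  have zo: "ctens h c ((deriv ^^ k) A) ((deriv ^^ l) B) x = 0" if "x \<notin> cell h c" for k l x
  proof -
    obtain C where "C \<subseteq> cell h c" "\<And>x. x \<notin> C \<Longrightarrow> ctens h c ((deriv ^^ k) A) ((deriv ^^ l) B) x = 0"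
      using test_functionsD[OF test[of k l]] by metis
    then show ?thesis using that by blast
  qed
  have restr: "(LINT x|lebesgue_on U. g x * ctens h c ((deriv ^^ k) A) ((deriv ^^ l) B) x) = pr h c g ((deriv ^^ k) A) ((deriv ^^ l) B)" for g k l
    unfolding pr_def by (rule integral_subset_lebesgue_on(2)) (use U zo in auto)
  have wk: "(LINT x|lebesgue_on U. u x * classical_deriv (mi k l) \<phi> x) = (-1) ^ (k + l) * (LINT x|lebesgue_on U. g x * \<phi> x)"
    if "has_weak_deriv U (mi k l) u g" "\<phi> \<in> test_functions U" for k l g \<phi>
    using that unfolding has_weak_deriv_def multi_order_mi by blast
  have 1: "(LINT x|lebesgue_on U. u x * dct (mi (i + m) (j + n)) h c A B x) = (-1) ^ (i + m + (j + n)) * pr h c t A B"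
    using wk[OF w(2) testU[of 0 0]] restr[of t 0 0]
    by (simp add: classical_deriv_ctens AB)
  have 2: "(LINT x|lebesgue_on U. u x * dct (mi i j) h c ((deriv ^^ m) A) ((deriv ^^ n) B) x) = (-1) ^ (i + j) * pr h c s ((deriv ^^ m) A) ((deriv ^^ n) B)"
    using wk[OF w(1) testU[of m n]] restr[of s m n]
    by (simp add: classical_deriv_ctens AB smooth1_funpow_deriv)
  have 3: "dct (mi i j) h c ((deriv ^^ m) A) ((deriv ^^ n) B) x = h ^ (m + n) * dct (mi (i + m) (j + n)) h c A B x" for x
    using U(3) by (simp add: dct_def multi_order_mi vector_2 funpow_add power_add field_simps)
  have "(-1) ^ (i + j) * pr h c s ((deriv ^^ m) A) ((deriv ^^ n) B) = h ^ (m + n) * ((-1) ^ (i + m + (j + n)) * pr h c t A B)"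
    unfolding 1[symmetric] 2[symmetric] 3 by (subst integral_mult_right_zero[symmetric]) (simp only: mult.left_commute)
  moreover have "i + m + (j + n) = (i + j) + 2" using even by simp
  ultimately have "(-1) ^ (i + j) * pr h c s ((deriv ^^ m) A) ((deriv ^^ n) B) = (-1) ^ (i + j) * (h ^ (m + n) * pr h c t A B)"
    by (simp only: power_add power2_minus power_one) simp
  then show "pr h c s ((deriv ^^ m) A) ((deriv ^^ n) B) = h ^ (m + n) * pr h c t A B" by simp
qed

definition shifted :: "real \<Rightarrow> (real \<Rightarrow> real) \<Rightarrow> real \<Rightarrow> real" where
  "shifted d A x = A (1 * x + d)"

lemma smooth1_shifted [intro]: "smooth1 A \<Longrightarrow> smooth1 (shifted d A)"
  unfolding shifted_def[abs_def] by (rule smooth1_affine)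

lemma deriv_shifted: "smooth1 A \<Longrightarrow> deriv (shifted d A) = shifted d (deriv A)"
proof (rule ext, rule DERIV_imp_deriv)
  fix x assume "smooth1 A"
  then have "((\<lambda>x. A (1 * x + d)) has_real_derivative deriv A (1 * x + d) * 1) (at x)"
    by (intro DERIV_chain2[OF smooth1_DERIV]) (auto intro!: derivative_eq_intros)
  then show "(shifted d A has_real_derivative shifted d (deriv A) x) (at x)" by (simp add: shifted_def[abs_def])
qed

lemma funpow_deriv_shifted: "smooth1 A \<Longrightarrow> (deriv ^^ n) (shifted d A) = shifted d ((deriv ^^ n) A)"
  by (induction n) (auto simp: deriv_shifted smooth1_funpow_deriv)

lemma ctens_shift:
  assumes "h > 0"
  shows "ctens h Z A B = ctens h g (shifted ((g $ 1 - Z $ 1) / h) A) (shifted ((g $ 2 - Z $ 2) / h) B)"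
proof -
  have "(y - e) / h = (y - e') / h + (e' - e) / h" for y e e' by (simp add: diff_divide_distrib)
  then show ?thesis by (simp add: ctens_eq shifted_def fun_eq_iff)
qed

lemma dct_shift:
  assumes "h > 0" "smooth1 A" "smooth1 B"
  shows "dct \<alpha> h Z A B = dct \<alpha> h g (shifted ((g $ 1 - Z $ 1) / h) A) (shifted ((g $ 2 - Z $ 2) / h) B)"
  using assms ctens_shift[OF assms(1), of Z _ _ g]
  by (simp add: dct_def fun_eq_iff funpow_deriv_shifted) 

lemma cell_residual_integral:
  assumes h: "h > 0" and AB: "smooth1 A" "smooth1 B" and s: "\<And>i. i < 3 \<Longrightarrow> L2 (cell h c) (s i)" and f: "L2 (cell h c) f"
  shows "(LINT x|lebesgue_on (cell h c). s 0 x * dct (mi 2 0) h c A B x + 2 * (s 1 x * dct (mi 1 1) h c A B x) + s 2 x * dct (mi 0 2) h c A B x)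
     - (LINT x|lebesgue_on (cell h c). f x * ctens h c A B x) = cell_residual h c s f A B"
proof -
  have i: "integrable (lebesgue_on (cell h c)) (\<lambda>x. s i x * dct (mi k l) h c A B x)"
    "(LINT x|lebesgue_on (cell h c). s i x * dct (mi k l) h c A B x) = (1 / h) ^ (k + l) * pr h c (s i) ((deriv ^^ k) A) ((deriv ^^ l) B)"
    if "i < 3" for i k l
  proof -
    have e: "(\<lambda>x. s i x * dct (mi k l) h c A B x) = (\<lambda>x. (1 / h) ^ (k + l) * (s i x * ctens h c ((deriv ^^ k) A) ((deriv ^^ l) B) x))"
      by (simp add: dct_def multi_order_mi vector_2 fun_eq_iff)
    show "integrable (lebesgue_on (cell h c)) (\<lambda>x. s i x * dct (mi k l) h c A B x)"
      unfolding e by (intro integrable_mult_right pr_integrable[OF h s[OF that]] smooth1_funpow_deriv AB)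
    show "(LINT x|lebesgue_on (cell h c). s i x * dct (mi k l) h c A B x) = (1 / h) ^ (k + l) * pr h c (s i) ((deriv ^^ k) A) ((deriv ^^ l) B)"
      unfolding e pr_def by simp
  qed
  show ?thesis
    using i(1)[of 0 2 0] i(1)[of 1 1 1] i(1)[of 2 0 2] i(2)[of 0 2 0] i(2)[of 1 1 1] i(2)[of 2 0 2]
    by (simp add: cell_residual_def pr_def[of h c f A B] power_divide power2_eq_square add_divide_distrib)
qed

text \<open>The open cells are disjoint and miss only the sides of finitely many squares. Off this
  null set the indicator of \<Omega> is the sum of the indicators of the cells.\<close>

lemma integral_over_cells:
  fixes g :: "real^2 \<Rightarrow> real"
  assumes up: "uniform_partition \<Omega> h T" and op: "open \<Omega>" and ic: "interior (closure \<Omega>) = \<Omega>"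
    and grid: "\<forall>K\<in>T. \<exists>k. K = square h (grid_centre h c k)" and TI: "TI = {k. square h (grid_centre h c k) \<in> T}"
    and g: "integrable (lebesgue_on \<Omega>) g"
  shows "finite TI" "\<And>k. k \<in> TI \<Longrightarrow> cell h (grid_centre h c k) \<subseteq> \<Omega>"
    "(LINT x|lebesgue_on \<Omega>. g x) = (\<Sum>k\<in>TI. LINT x|lebesgue_on (cell h (grid_centre h c k)). g x)"
proof -
  have h: "h > 0" and un: "\<Union>T = closure \<Omega>" and fT: "finite T" using up by (auto simp: uniform_partition_def)
  show fin: "finite TI"
  proof (rule finite_imageD)
    show "finite ((\<lambda>k. square h (grid_centre h c k)) ` TI)" by (rule finite_subset[OF _ fT]) (auto simp: TI)
    show "inj_on (\<lambda>k. square h (grid_centre h c k)) TI" by (auto simp: inj_on_def square_grid_centre_inj[OF h])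
  qed
  show sub: "cell h (grid_centre h c k) \<subseteq> \<Omega>" if "k \<in> TI" for k
  proof -
    have "cell h (grid_centre h c k) \<subseteq> closure \<Omega>" using that cell_subset_square[of h "grid_centre h c k"] Union_upper[of "square h (grid_centre h c k)" T] un by (auto simp: TI)
    then show ?thesis using ic interior_maximal[OF _ open_cell] by blast
  qed
  have Os: "\<Omega> \<in> sets lebesgue" using op by simp
  have neg: "negligible (\<Union>k\<in>TI. square h (grid_centre h c k) - cell h (grid_centre h c k))"
    using fin by (intro negligible_Union) (auto simp: square_def cell_def negligible_frontier_interval)
  have ind: "indicator \<Omega> x = (\<Sum>k\<in>TI. indicator (cell h (grid_centre h c k)) x :: real)"
    if x: "x \<notin> (\<Union>k\<in>TI. square h (grid_centre h c k) - cell h (grid_centre h c k))" for x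
  proof (cases "x \<in> \<Omega>")
    case True
    then have "x \<in> \<Union>T" using un closure_subset[of \<Omega>] by auto
    then obtain K where K: "K \<in> T" "x \<in> K" by auto
    then obtain k where "K = square h (grid_centre h c k)" using grid by blast
    with K have k: "k \<in> TI" "x \<in> square h (grid_centre h c k)" by (auto simp: TI)
    have xc: "x \<in> cell h (grid_centre h c k)"
    proof (rule ccontr)
      assume "x \<notin> cell h (grid_centre h c k)"
      then have "x \<in> square h (grid_centre h c k) - cell h (grid_centre h c k)" using k(2) by simp
      then show False using x k(1) UN_I[of k TI] by metis
    qed
    have "(\<Sum>j\<in>TI. indicator (cell h (grid_centre h c j)) x :: real) = (\<Sum>j\<in>TI. if j = k then 1 else 0)"
    proof (rule sum.cong[OF refl])
      fix j show "indicator (cell h (grid_centre h c j)) x = (if j = k then 1 else (0::real))"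
        using cell_square_disjoint[OF h _ k(2), of j] xc by (cases "j = k") (auto simp: indicator_def)
    qed
    then show ?thesis using True fin k(1) by simp
  next
    case False
    then have "indicator (cell h (grid_centre h c k)) x = (0::real)" if "k \<in> TI" for k using sub[OF that] by (auto simp: indicator_def)
    then show ?thesis using False by simp
  qed
  have gi: "integrable lebesgue (\<lambda>x. indicator (cell h (grid_centre h c k)) x * g x)" if "k \<in> TI" for k
    using integral_subset_lebesgue_on(1)[OF Os _ sub[OF that] g] by (simp add: integrable_lebesgue_on)
  have gO: "integrable lebesgue (\<lambda>x. indicator \<Omega> x * g x)" using g Os by (simp add: integrable_lebesgue_on)
  have "(LINT x|lebesgue_on \<Omega>. g x) = (LINT x|lebesgue. indicator \<Omega> x * g x)" using Os by (simp add: integral_lebesgue_on)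
  also have "\<dots> = (LINT x|lebesgue. (\<Sum>k\<in>TI. indicator (cell h (grid_centre h c k)) x * g x))"
  proof (rule integral_cong_AE)
    show "(\<lambda>x. indicator \<Omega> x * g x) \<in> borel_measurable lebesgue" using gO by (rule borel_measurable_integrable)
    show "(\<lambda>x. \<Sum>k\<in>TI. indicator (cell h (grid_centre h c k)) x * g x) \<in> borel_measurable lebesgue"
      by (intro borel_measurable_sum borel_measurable_integrable gi)
    have "(\<Union>k\<in>TI. square h (grid_centre h c k) - cell h (grid_centre h c k)) \<in> null_sets lebesgue"
      using neg negligible_iff_null_sets by blast
    then have "AE x in lebesgue. x \<notin> (\<Union>k\<in>TI. square h (grid_centre h c k) - cell h (grid_centre h c k))" by (rule AE_not_in)
    then show "AE x in lebesgue. indicator \<Omega> x * g x = (\<Sum>k\<in>TI. indicator (cell h (grid_centre h c k)) x * g x)"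
      by eventually_elim (simp add: ind sum_distrib_right)
  qed
  also have "\<dots> = (\<Sum>k\<in>TI. LINT x|lebesgue. indicator (cell h (grid_centre h c k)) x * g x)"
    using gi by (rule Bochner_Integration.integral_sum)
  also have "\<dots> = (\<Sum>k\<in>TI. LINT x|lebesgue_on (cell h (grid_centre h c k)). g x)"
    by (simp add: integral_lebesgue_on)
  finally show "(LINT x|lebesgue_on \<Omega>. g x) = (\<Sum>k\<in>TI. LINT x|lebesgue_on (cell h (grid_centre h c k)). g x)" .
qed

text \<open>One smooth product is admissible in the weak equation. Seen from the centre of any cell
  it is again a rescaled product at the same scale, with shifted factors, so each cell contributes a
  \<open>cell_residual\<close>.\<close>

lemma weak_equation_cells:
  assumes up: "uniform_partition \<Omega> h T" and op: "open \<Omega>" and ic: "interior (closure \<Omega>) = \<Omega>"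
    and grid: "\<forall>K\<in>T. \<exists>k. K = square h (grid_centre h c k)" and TI: "TI = {k. square h (grid_centre h c k) \<in> T}"
    and u: "u \<in> sobolev 2 \<Omega>" and f: "L2 \<Omega> f" and eq: "\<forall>v\<in>sobolev0 2 \<Omega>. a_form \<Omega> u v = L2_inner \<Omega> f v"
    and AB: "smooth1 A" "smooth1 B" and test: "ctens h Z A B \<in> test_functions \<Omega>"
  shows "(\<Sum>k\<in>TI. cell_residual h (grid_centre h c k) (\<lambda>i. weak_deriv \<Omega> (mi (2 - i) i) u) f
     (shifted ((grid_centre h c k $ 1 - Z $ 1) / h) A) (shifted ((grid_centre h c k $ 2 - Z $ 2) / h) B)) = 0"
proof -
  have h: "h > 0" using up by (auto simp: uniform_partition_def)
  have Os: "\<Omega> \<in> sets lebesgue" using op by simp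
  define s where "s i = weak_deriv \<Omega> (mi (2 - i) i) u" for i
  have s: "has_weak_deriv \<Omega> (mi (2 - i) i) u (s i)" "L2 \<Omega> (s i)" if "i < 3" for i
    unfolding s_def using sobolev_weak_deriv[OF op u, of "mi (2 - i) i"] that by (auto simp: multi_order_mi)
  define V where "V i = dct (mi (2 - i) i) h Z A B" for i
  obtain C where C: "compact C" "C \<subseteq> \<Omega>" "\<And>x \<alpha>. x \<notin> C \<Longrightarrow> dct \<alpha> h Z A B x = 0" using dct_zero_off[OF test AB] by blast
  have dL: "L2 \<Omega> (dct \<alpha> h Z A B)" for \<alpha>
    by (rule L2_continuous_compact_support[OF continuous_on_dct[OF AB] C(1) C(3) Os])
  have V: "has_weak_deriv \<Omega> (mi (2 - i) i) (ctens h Z A B) (V i)" "L2 \<Omega> (V i)" for i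
    unfolding V_def using has_weak_deriv_ctens[OF op AB] dL by auto
  have "dct 0 h Z A B = ctens h Z A B" by (simp add: dct_def multi_order_def fun_eq_iff)
  then have cL: "L2 \<Omega> (ctens h Z A B)" using dL[of 0] by simp
  have af: "a_form \<Omega> u (ctens h Z A B) = (LINT x|lebesgue_on \<Omega>. s 0 x * V 0 x + 2 * (s 1 x * V 1 x) + s 2 x * V 2 x)"
    "integrable (lebesgue_on \<Omega>) (\<lambda>x. s 0 x * V 0 x + 2 * (s 1 x * V 1 x) + s 2 x * V 2 x)"
    by (rule a_form_eq[OF op]; rule s V; assumption)+
  have fi: "integrable (lebesgue_on \<Omega>) (\<lambda>x. f x * ctens h Z A B x)" by (rule L2_integrable_mult[OF f cL])
  note sp = integral_over_cells[OF up op ic grid TI]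
  have Vs: "V 0 = dct (mi 2 0) h Z A B" "V 1 = dct (mi 1 1) h Z A B" "V 2 = dct (mi 0 2) h Z A B"
    by (simp_all add: V_def numeral_2_eq_2)
  have "a_form \<Omega> u (ctens h Z A B) - L2_inner \<Omega> f (ctens h Z A B) = 0"
    using bspec[OF eq ctens_sobolev0[OF op test AB]] by simp
  then have "(\<Sum>k\<in>TI. (LINT x|lebesgue_on (cell h (grid_centre h c k)). s 0 x * V 0 x + 2 * (s 1 x * V 1 x) + s 2 x * V 2 x)
      - (LINT x|lebesgue_on (cell h (grid_centre h c k)). f x * ctens h Z A B x)) = 0"
    unfolding af(1) L2_inner_def sp(3)[OF af(2)] sp(3)[OF fi] by (simp add: sum_subtractf)
  also have "(\<Sum>k\<in>TI. (LINT x|lebesgue_on (cell h (grid_centre h c k)). s 0 x * V 0 x + 2 * (s 1 x * V 1 x) + s 2 x * V 2 x)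
      - (LINT x|lebesgue_on (cell h (grid_centre h c k)). f x * ctens h Z A B x))
    = (\<Sum>k\<in>TI. cell_residual h (grid_centre h c k) s f (shifted ((grid_centre h c k $ 1 - Z $ 1) / h) A) (shifted ((grid_centre h c k $ 2 - Z $ 2) / h) B))"
  proof (rule sum.cong[OF refl])
    fix k assume k: "k \<in> TI"
    have L: "L2 (cell h (grid_centre h c k)) g" if "L2 \<Omega> g" for g
      using L2_subset[OF Os _ sp(2)[OF fi k] that] by simp
    show "(LINT x|lebesgue_on (cell h (grid_centre h c k)). s 0 x * V 0 x + 2 * (s 1 x * V 1 x) + s 2 x * V 2 x)
      - (LINT x|lebesgue_on (cell h (grid_centre h c k)). f x * ctens h Z A B x)
      = cell_residual h (grid_centre h c k) s f (shifted ((grid_centre h c k $ 1 - Z $ 1) / h) A) (shifted ((grid_centre h c k $ 2 - Z $ 2) / h) B)"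
      unfolding Vs dct_shift[OF h AB, of _ Z "grid_centre h c k"] ctens_shift[OF h, of Z A B "grid_centre h c k"]
      by (rule cell_residual_integral[OF h _ _ L[OF s(2)] L[OF f]]) (use AB in auto)
  qed
  finally show ?thesis unfolding s_def .
qed

section \<open>Summation over the grid\<close>

definition bi :: "bool \<Rightarrow> int" where "bi b = (if b then 1 else 0)"

definition offs :: "bool \<Rightarrow> int set" where "offs e = (if e then {0, -1} else {0})"

text \<open>For \<open>e = (e1, e2)\<close> this is the centre of the lower left vertex, left edge, lower edge, or
  the cell itself; the incident cells are those with index in \<open>z + offs e1 \<times> offs e2\<close>.\<close>

definition star_centre :: "real \<Rightarrow> real^2 \<Rightarrow> int \<times> int \<Rightarrow> bool \<Rightarrow> bool \<Rightarrow> real^2" where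
  "star_centre h c z e1 e2 = pt (grid_centre h c z $ 1 - of_int (bi e1) * h) (grid_centre h c z $ 2 - of_int (bi e2) * h)"

text \<open>The incident squares cover the open box of half-widths 1 + \<open>bi e\<close> in units
  of h, which thus lies in the interior of the closure. Strictly smaller half-widths leave room for
  a compact support.\<close>

lemma star_in_domain:
  assumes up: "uniform_partition \<Omega> h T" and ic: "interior (closure \<Omega>) = \<Omega>"
    and TI: "TI = {k. square h (grid_centre h c k) \<in> T}"
    and z: "\<forall>o1\<in>offs e1. \<forall>o2\<in>offs e2. (fst z + o1, snd z + o2) \<in> TI"
    and r: "r1 < 1 + real_of_int (bi e1)" "r2 < 1 + real_of_int (bi e2)"
  defines "Z \<equiv> star_centre h c z e1 e2"
  shows "cbox (pt (Z $ 1 - r1 * h) (Z $ 2 - r2 * h)) (pt (Z $ 1 + r1 * h) (Z $ 2 + r2 * h)) \<subseteq> \<Omega>"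
proof -
  have h: "h > 0" and un: "\<Union>T = closure \<Omega>" using up by (auto simp: uniform_partition_def)
  define R1 where "R1 = (1 + real_of_int (bi e1)) * h"
  define R2 where "R2 = (1 + real_of_int (bi e2)) * h"
  have R: "r1 * h < R1" "r2 * h < R2" using r h by (simp_all add: R1_def R2_def)
  \<comment> \<open>If the star has two cells in this direction they meet at its centre: offset 0
    serves the points to the right and -1 those to the left.\<close>
  have cover: "\<exists>j\<in>offs e. \<bar>y - (x + 2 * h * of_int (n + j))\<bar> \<le> h"
    if "\<bar>y - (x + 2 * h * of_int n - of_int (bi e) * h)\<bar> < (1 + real_of_int (bi e)) * h" for y x n e
    using that h by (cases e; cases "y \<ge> x + 2 * h * of_int n - of_int (bi e) * h")
      (auto simp: bi_def offs_def algebra_simps abs_le_iff abs_less_iff)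
  have "box (pt (Z $ 1 - R1) (Z $ 2 - R2)) (pt (Z $ 1 + R1) (Z $ 2 + R2)) \<subseteq> closure \<Omega>"
  proof
    fix x assume "x \<in> box (pt (Z $ 1 - R1) (Z $ 2 - R2)) (pt (Z $ 1 + R1) (Z $ 2 + R2))"
    then have xs: "\<bar>x $ 1 - Z $ 1\<bar> < R1" "\<bar>x $ 2 - Z $ 2\<bar> < R2"
      by (auto simp: mem_box_cart forall_2 vector_2 abs_less_iff)
    have "\<exists>o1\<in>offs e1. \<bar>x $ 1 - (c $ 1 + 2 * h * of_int (fst z + o1))\<bar> \<le> h"
      by (rule cover) (use xs(1) in \<open>simp add: R1_def Z_def star_centre_def vector_2\<close>)
    moreover have "\<exists>o2\<in>offs e2. \<bar>x $ 2 - (c $ 2 + 2 * h * of_int (snd z + o2))\<bar> \<le> h"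
      by (rule cover) (use xs(2) in \<open>simp add: R2_def Z_def star_centre_def vector_2\<close>)
    ultimately obtain o1 o2 where o: "o1 \<in> offs e1" "o2 \<in> offs e2"
      and "\<bar>x $ 1 - (c $ 1 + 2 * h * of_int (fst z + o1))\<bar> \<le> h" "\<bar>x $ 2 - (c $ 2 + 2 * h * of_int (snd z + o2))\<bar> \<le> h"
      by blast
    then have x: "x \<in> square h (grid_centre h c (fst z + o1, snd z + o2))" by (simp add: mem_square)
    have "square h (grid_centre h c (fst z + o1, snd z + o2)) \<in> T" using z o by (auto simp: TI)
    then show "x \<in> closure \<Omega>" using x un by auto
  qed
  then have "box (pt (Z $ 1 - R1) (Z $ 2 - R2)) (pt (Z $ 1 + R1) (Z $ 2 + R2)) \<subseteq> \<Omega>"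
    using ic interior_maximal[OF _ open_box] by metis
  moreover have "cbox (pt (Z $ 1 - r1 * h) (Z $ 2 - r2 * h)) (pt (Z $ 1 + r1 * h) (Z $ 2 + r2 * h)) \<subseteq>
      box (pt (Z $ 1 - R1) (Z $ 2 - R2)) (pt (Z $ 1 + R1) (Z $ 2 + R2))"
    using R by (auto simp: mem_box_cart forall_2 vector_2)
  ultimately show ?thesis by blast
qed

text \<open>Half-width \<open>bi e + 1/2\<close> keeps the support away from all cells but the
  incident ones, and these belong to the partition. The shift \<open>2 * o + bi e\<close> is the
  position of a cell centre relative to the centre of the star, in units of h.\<close>

lemma star_sum:
  assumes up: "uniform_partition \<Omega> h T" and op: "open \<Omega>" and ic: "interior (closure \<Omega>) = \<Omega>"
    and grid: "\<forall>K\<in>T. \<exists>k. K = square h (grid_centre h c k)" and TI: "TI = {k. square h (grid_centre h c k) \<in> T}"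
    and u: "u \<in> sobolev 2 \<Omega>" and f: "L2 \<Omega> f" and eq: "\<forall>v\<in>sobolev0 2 \<Omega>. a_form \<Omega> u v = L2_inner \<Omega> f v"
    and z: "\<forall>o1\<in>offs e1. \<forall>o2\<in>offs e2. (fst z + o1, snd z + o2) \<in> TI"
    and AB: "smooth1 A" "smooth1 B"
    and A0: "\<And>x. x \<notin> {- (of_int (bi e1) + 1/2)..of_int (bi e1) + 1/2} \<Longrightarrow> A x = 0"
    and B0: "\<And>x. x \<notin> {- (of_int (bi e2) + 1/2)..of_int (bi e2) + 1/2} \<Longrightarrow> B x = 0"
  shows "(\<Sum>(o1, o2)\<in>offs e1 \<times> offs e2. cell_residual h (grid_centre h c (fst z + o1, snd z + o2)) (\<lambda>i. weak_deriv \<Omega> (mi (2 - i) i) u) f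
     (shifted (2 * of_int o1 + of_int (bi e1)) A) (shifted (2 * of_int o2 + of_int (bi e2)) B)) = 0"
proof -
  have h: "h > 0" using up by (auto simp: uniform_partition_def)
  define Z where "Z = star_centre h c z e1 e2"
  define L where "L k = cell_residual h (grid_centre h c k) (\<lambda>i. weak_deriv \<Omega> (mi (2 - i) i) u) f" for k
  define d1 where "d1 k = 2 * real_of_int (fst k - fst z) + of_int (bi e1)" for k :: "int \<times> int"
  define d2 where "d2 k = 2 * real_of_int (snd k - snd z) + of_int (bi e2)" for k :: "int \<times> int"
  have test: "ctens h Z A B \<in> test_functions \<Omega>"
    by (rule ctens_test[OF h AB _ A0 B0]) (simp_all add: Z_def, rule star_in_domain[OF up ic TI z], auto)
  have d: "(grid_centre h c k $ 1 - Z $ 1) / h = d1 k" "(grid_centre h c k $ 2 - Z $ 2) / h = d2 k" for k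
    using h by (simp_all add: Z_def star_centre_def vector_2 d1_def d2_def field_simps)
  have shz: "shifted (2 * real_of_int j + of_int (bi e)) F x = 0"
    if "\<And>x. x \<notin> {- (of_int (bi e) + 1/2)..of_int (bi e) + 1/2} \<Longrightarrow> F x = 0" "j \<notin> offs e" "x \<in> {-1<..<1}" for F x e and j :: int
  proof -
    have "1 * x + (2 * real_of_int j + of_int (bi e)) \<notin> {- (of_int (bi e) + 1/2)..of_int (bi e) + 1/2}"
    proof (cases e)
      case True
      then have "j \<ge> 1 \<or> j \<le> -2" using that(2) by (auto simp: offs_def)
      then have "real_of_int j \<ge> 1 \<or> real_of_int j \<le> -2" by linarith
      then show ?thesis using True that(3) by (auto simp: bi_def)
    next
      case False
      then have "j \<ge> 1 \<or> j \<le> -1" using that(2) by (auto simp: offs_def)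
      then have "real_of_int j \<ge> 1 \<or> real_of_int j \<le> -1" by linarith
      then show ?thesis using False that(3) by (auto simp: bi_def)
    qed
    then show ?thesis unfolding shifted_def by (rule that(1))
  qed
  let ?S = "(\<lambda>(o1, o2). (fst z + o1, snd z + o2)) ` (offs e1 \<times> offs e2)"
  have fo: "finite (offs e)" for e by (simp add: offs_def)
  have g: "integrable (lebesgue_on \<Omega>) (\<lambda>x. (f x)\<^sup>2)" using f by (rule L2_integrable_square)
  have "0 = (\<Sum>k\<in>TI. L k (shifted (d1 k) A) (shifted (d2 k) B))"
    using weak_equation_cells[OF up op ic grid TI u f eq AB test] unfolding d L_def by simp
  also have "\<dots> = (\<Sum>k\<in>?S. L k (shifted (d1 k) A) (shifted (d2 k) B))"
  proof (rule sum.mono_neutral_right)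
    show "finite TI" by (rule integral_over_cells(1)[OF up op ic grid TI g])
    show "?S \<subseteq> TI" using z by auto
    show "\<forall>k\<in>TI - ?S. L k (shifted (d1 k) A) (shifted (d2 k) B) = 0"
    proof
      fix k assume "k \<in> TI - ?S"
      then have "fst k - fst z \<notin> offs e1 \<or> snd k - snd z \<notin> offs e2"
      proof -
        have "k = (\<lambda>(o1, o2). (fst z + o1, snd z + o2)) (fst k - fst z, snd k - snd z)" by simp
        then show ?thesis using \<open>k \<in> TI - ?S\<close> by blast
      qed
      then show "L k (shifted (d1 k) A) (shifted (d2 k) B) = 0"
      proof
        assume o: "fst k - fst z \<notin> offs e1"
        have "shifted (d1 k) A x = 0" if "x \<in> {-1<..<1}" for x
          unfolding d1_def by (rule shz[OF _ o that]) (rule A0)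
        then show ?thesis unfolding L_def by (intro cell_residual_zero[OF h smooth1_shifted[OF AB(2)]]) auto
      next
        assume o: "snd k - snd z \<notin> offs e2"
        have "shifted (d2 k) B x = 0" if "x \<in> {-1<..<1}" for x
          unfolding d2_def by (rule shz[OF _ o that]) (rule B0)
        then show ?thesis unfolding L_def by (intro cell_residual_zero'[OF h smooth1_shifted[OF AB(1)]]) auto
      qed
    qed
  qed
  also have "\<dots> = (\<Sum>p\<in>offs e1 \<times> offs e2. L (case p of (o1, o2) \<Rightarrow> (fst z + o1, snd z + o2))
      (shifted (d1 (case p of (o1, o2) \<Rightarrow> (fst z + o1, snd z + o2))) A) (shifted (d2 (case p of (o1, o2) \<Rightarrow> (fst z + o1, snd z + o2))) B))"
    by (subst sum.reindex) (auto simp: inj_on_def)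
  also have "\<dots> = (\<Sum>(o1, o2)\<in>offs e1 \<times> offs e2. L (fst z + o1, snd z + o2)
     (shifted (2 * of_int o1 + of_int (bi e1)) A) (shifted (2 * of_int o2 + of_int (bi e2)) B))"
    by (rule sum.cong) (auto simp: d1_def d2_def)
  finally show ?thesis unfolding L_def by simp
qed

text \<open>A sum over cells is regrouped by one of their corners or edges. Vanishing of
  \<open>v\<close> off \<open>VI\<close> is where the zero extension enters: corners and edges that
  are not interior drop out.\<close>

lemma sum_grid_shift:
  fixes v :: "int \<times> int \<Rightarrow> real"
  assumes "finite TI" "\<And>z. z \<in> VI \<Longrightarrow> z - s \<in> TI" "\<And>k. k \<in> TI \<Longrightarrow> k + s \<notin> VI \<Longrightarrow> v (k + s) = 0"
  shows "(\<Sum>k\<in>TI. v (k + s) * L k) = (\<Sum>z\<in>VI. v z * L (z - s))"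
proof -
  have im: "(\<lambda>z. z - s) ` VI \<subseteq> TI" using assms(2) by auto
  have "(\<Sum>z\<in>VI. v z * L (z - s)) = (\<Sum>k\<in>(\<lambda>z. z - s) ` VI. v (k + s) * L k)"
    by (subst sum.reindex) (auto simp: inj_on_def)
  also have "\<dots> = (\<Sum>k\<in>TI. v (k + s) * L k)"
    by (rule sum.mono_neutral_left[OF assms(1) im]) (use assms(3) in force)
  finally show ?thesis by simp
qed

text \<open>The corners, the left and the lower edges of the cell with index \<open>k\<close> are those with index
  \<open>k\<close>, and the remaining ones those of the neighbouring cells.\<close>

definition glued :: "(int \<times> int) set \<Rightarrow> (int \<times> int \<Rightarrow> nat \<Rightarrow> nat \<Rightarrow> real) \<Rightarrow> bool" where
  "glued TI A \<longleftrightarrow> (\<forall>k. k \<notin> TI \<longrightarrow> A k = (\<lambda>_ _. 0)) \<and>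
    (\<forall>i j b. corner_value (A (i, j)) True b = corner_value (A (i + 1, j)) False b) \<and>
    (\<forall>i j b. corner_value (A (i, j)) b True = corner_value (A (i, j + 1)) b False) \<and>
    (\<forall>i j. flux1 (A (i, j)) True = flux1 (A (i + 1, j)) False) \<and>
    (\<forall>i j. flux2 (A (i, j)) True = flux2 (A (i, j + 1)) False)"

definition inner_vertices :: "(int \<times> int) set \<Rightarrow> (int \<times> int) set" where
  "inner_vertices TI = {z. z \<in> TI \<and> z - (1, 0) \<in> TI \<and> z - (0, 1) \<in> TI \<and> z - (1, 1) \<in> TI}"

text \<open>At an inner vertex the gradient is taken from one of the four cells; any of them would do.\<close>

definition vgrad :: "(int \<times> int) set \<Rightarrow> (int \<times> int \<Rightarrow> nat \<Rightarrow> nat \<Rightarrow> real) \<Rightarrow> nat \<Rightarrow> nat \<Rightarrow> int \<times> int \<Rightarrow> real" where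
  "vgrad TI A i j z = (if z \<in> inner_vertices TI then A z i j else 0)"

definition cell_corner :: "int \<times> int \<Rightarrow> bool \<Rightarrow> bool \<Rightarrow> int \<times> int" where
  "cell_corner k b1 b2 = k + (bi b1, bi b2)"

definition csize :: "(nat \<Rightarrow> nat \<Rightarrow> real) \<Rightarrow> real" where
  "csize a = \<bar>a 2 0\<bar> + \<bar>a 1 1\<bar> + \<bar>a 0 2\<bar> + \<bar>a 3 0\<bar> + \<bar>a 0 3\<bar>"

definition patch_size :: "(int \<times> int \<Rightarrow> nat \<Rightarrow> nat \<Rightarrow> real) \<Rightarrow> int \<times> int \<Rightarrow> real" where
  "patch_size A k = (\<Sum>s\<in>{-1, 0, 1} \<times> {-1, 0, 1}. csize (A (k + s)))"

lemma csize_nonneg: "csize a \<ge> 0"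
  by (simp add: csize_def)

section \<open>Jumps of the first-order coefficients between neighbouring cells\<close>

lemma glued_corner:
  assumes "glued TI A"
  shows "corner_value (A k) b1 b2 = corner_value (A (cell_corner k b1 b2)) False False"
proof -
  obtain i j where k: "k = (i, j)" by force
  have 1: "corner_value (A (i, j)) b1 b2 = corner_value (A (i + bi b1, j)) False b2" for i j b1 b2
    using assms by (cases b1) (auto simp: glued_def bi_def)
  have 2: "corner_value (A (i, j)) b1 b2 = corner_value (A (i, j + bi b2)) b1 False" for i j b1 b2
    using assms by (cases b2) (auto simp: glued_def bi_def)
  show ?thesis using 1[of i j b1 b2] 2[of "i + bi b1" j False b2] by (simp add: k cell_corner_def)
qed

lemma glued_flux:
  assumes "glued TI A"
  shows "flux1 (A k) b = flux1 (A (k + (bi b, 0))) False" "flux2 (A k) b = flux2 (A (k + (0, bi b))) False"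
proof -
  obtain i j where k: "k = (i, j)" by force
  show "flux1 (A k) b = flux1 (A (k + (bi b, 0))) False" "flux2 (A k) b = flux2 (A (k + (0, bi b))) False"
    using assms unfolding k by (cases b; auto simp: glued_def bi_def)+
qed

lemma csize_ge:
  "\<bar>a 2 0\<bar> + \<bar>a 3 0\<bar> \<le> csize a" "\<bar>a 0 2\<bar> + \<bar>a 0 3\<bar> \<le> csize a"
  "\<bar>a 1 1\<bar> + \<bar>a 3 0\<bar> \<le> csize a" "\<bar>a 1 1\<bar> + \<bar>a 0 3\<bar> \<le> csize a"
  by (simp_all add: csize_def)

text \<open>Equal mean normal derivatives compare the normal component of the gradient across an
  edge; equal values at both of its ends compare the tangential one. Only coefficients of order 2
  and 3 remain, with factors at most 3.\<close>

lemma glued_adjacent: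
  assumes "glued TI A"
  shows "\<bar>A (i, j) 1 0 - A (i + 1, j) 1 0\<bar> \<le> 3 * (csize (A (i, j)) + csize (A (i + 1, j)))"
    and "\<bar>A (i, j) 0 1 - A (i + 1, j) 0 1\<bar> \<le> 3 * (csize (A (i, j)) + csize (A (i + 1, j)))"
    and "\<bar>A (i, j) 1 0 - A (i, j + 1) 1 0\<bar> \<le> 3 * (csize (A (i, j)) + csize (A (i, j + 1)))"
    and "\<bar>A (i, j) 0 1 - A (i, j + 1) 0 1\<bar> \<le> 3 * (csize (A (i, j)) + csize (A (i, j + 1)))"
proof -
  have f: "flux1 (A (i, j)) True = flux1 (A (i + 1, j)) False" "flux2 (A (i, j)) True = flux2 (A (i, j + 1)) False"
    and c1: "corner_value (A (i, j)) True b = corner_value (A (i + 1, j)) False b"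
    and c2: "corner_value (A (i, j)) b True = corner_value (A (i, j + 1)) b False" for b
    using assms unfolding glued_def by blast+
  have le: "\<bar>x - y\<bar> \<le> 3 * (X + Y)" if "x + u * p + r * q = y - u * p' + r * q'" "\<bar>p\<bar> + \<bar>q\<bar> \<le> X" "\<bar>p'\<bar> + \<bar>q'\<bar> \<le> Y"
    "u = 2 \<and> r = 3 \<or> u = 1 \<and> r = 1" for x y X Y u p r q p' q' :: real
    using that(4) that(1-3) by (elim disjE) (auto simp: abs_le_iff abs_if split: if_splits)
  show "\<bar>A (i, j) 1 0 - A (i + 1, j) 1 0\<bar> \<le> 3 * (csize (A (i, j)) + csize (A (i + 1, j)))"
    by (rule le[OF _ csize_ge(1) csize_ge(1), where u = 2 and r = 3]) (use f(1) in \<open>simp_all add: flux1_def sg_def\<close>)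
  show "\<bar>A (i, j) 0 1 - A (i, j + 1) 0 1\<bar> \<le> 3 * (csize (A (i, j)) + csize (A (i, j + 1)))"
    by (rule le[OF _ csize_ge(2) csize_ge(2), where u = 2 and r = 3]) (use f(2) in \<open>simp_all add: flux2_def sg_def\<close>)
  show "\<bar>A (i, j) 0 1 - A (i + 1, j) 0 1\<bar> \<le> 3 * (csize (A (i, j)) + csize (A (i + 1, j)))"
    by (rule le[OF _ csize_ge(4) csize_ge(4), where u = 1 and r = 1])
       (use c1[of True] c1[of False] in \<open>simp_all add: corner_value_def sg_def\<close>)
  show "\<bar>A (i, j) 1 0 - A (i, j + 1) 1 0\<bar> \<le> 3 * (csize (A (i, j)) + csize (A (i, j + 1)))"
    by (rule le[OF _ csize_ge(3) csize_ge(3), where u = 1 and r = 1])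
       (use c2[of True] c2[of False] in \<open>simp_all add: corner_value_def sg_def\<close>)
qed

text \<open>Any two of the four cells around a vertex are joined by at most two edges, and each edge
  costs at most 3 times the sum of all four sizes.\<close>

lemma square_path:
  fixes a00 a10 a01 a11 :: real
  assumes "\<bar>a00 - a10\<bar> \<le> 3 * (m00 + m10)" "\<bar>a01 - a11\<bar> \<le> 3 * (m01 + m11)"
    "\<bar>a00 - a01\<bar> \<le> 3 * (m00 + m01)" "\<bar>a10 - a11\<bar> \<le> 3 * (m10 + m11)"
    "m00 \<ge> 0" "m10 \<ge> 0" "m01 \<ge> 0" "m11 \<ge> 0"
    and u: "u = a11 \<or> u = a01 \<or> u = a10 \<or> u = a00" and v: "v = a11 \<or> v = a01 \<or> v = a10 \<or> v = a00"
  shows "\<bar>u - v\<bar> \<le> 6 * (m11 + m01 + m10 + m00)"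
proof -
  have le: "a00 - a10 \<le> 3 * (m00 + m10)" "a10 - a00 \<le> 3 * (m00 + m10)" "a01 - a11 \<le> 3 * (m01 + m11)" "a11 - a01 \<le> 3 * (m01 + m11)"
    "a00 - a01 \<le> 3 * (m00 + m01)" "a01 - a00 \<le> 3 * (m00 + m01)" "a10 - a11 \<le> 3 * (m10 + m11)" "a11 - a10 \<le> 3 * (m10 + m11)"
    using assms(1-4) by linarith+
  have "u - v \<le> 6 * (m11 + m01 + m10 + m00)" using u v le assms(5-8) by auto
  moreover have "v - u \<le> 6 * (m11 + m01 + m10 + m00)" using u v le assms(5-8) by auto
  ultimately show ?thesis by linarith
qed

lemma vgrad_bound:
  assumes g: "glued TI A" and pq: "(p, q) = (1, 0) \<or> (p, q) = (0, 1)"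
  shows "\<bar>vgrad TI A p q (cell_corner k b1 b2) - A k p q\<bar> \<le> 6 * patch_size A k"
proof -
  obtain i j where z: "cell_corner k b1 b2 = (i + 1, j + 1)" by (metis diff_add_cancel surj_pair)
  let ?a = "\<lambda>k. A k p q" and ?m = "\<lambda>k. csize (A k)"
  define D where "D = ?m (i + 1, j + 1) + ?m (i, j + 1) + ?m (i + 1, j) + ?m (i, j)"
  have m0: "?m k \<ge> 0" for k by (rule csize_nonneg)
  have adj: "\<bar>?a (i, j) - ?a (i + 1, j)\<bar> \<le> 3 * (?m (i, j) + ?m (i + 1, j))"
    "\<bar>?a (i, j + 1) - ?a (i + 1, j + 1)\<bar> \<le> 3 * (?m (i, j + 1) + ?m (i + 1, j + 1))"
    "\<bar>?a (i, j) - ?a (i, j + 1)\<bar> \<le> 3 * (?m (i, j) + ?m (i, j + 1))"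
    "\<bar>?a (i + 1, j) - ?a (i + 1, j + 1)\<bar> \<le> 3 * (?m (i + 1, j) + ?m (i + 1, j + 1))"
    using glued_adjacent[OF g, of i j] glued_adjacent[OF g, of i "j + 1"] glued_adjacent[OF g, of "i + 1" j] pq by auto
  define N where "N = {(i + 1, j + 1), (i, j + 1), (i + 1, j), (i, j)}"
  have m: "?m (i, j) \<ge> 0" "?m (i + 1, j) \<ge> 0" "?m (i, j + 1) \<ge> 0" "?m (i + 1, j + 1) \<ge> 0" by (rule m0)+
  have near: "\<bar>?a x - ?a y\<bar> \<le> 6 * D" if "x \<in> N" "y \<in> N" for x y
    unfolding D_def by (rule square_path[OF adj m]) (use that in \<open>auto simp: N_def\<close>)
  have k: "k \<in> N" using z unfolding N_def cell_corner_def bi_def by (cases k; cases b1; cases b2; auto)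
  have zN: "cell_corner k b1 b2 \<in> N" by (simp add: z N_def)
  have b1: "\<bar>vgrad TI A p q (cell_corner k b1 b2) - A k p q\<bar> \<le> 6 * D"
  proof (cases "cell_corner k b1 b2 \<in> inner_vertices TI")
    case True
    then show ?thesis using near[OF zN k] by (simp add: vgrad_def)
  next
    case False
    \<comment> \<open>A cell outside the partition has zero coefficients. The default value 0 of
      \<open>vgrad\<close> is therefore again the gradient in one of the four cells, and the same
      comparison applies.\<close>
    then have "\<exists>y\<in>N. y \<notin> TI" unfolding z inner_vertices_def N_def by auto
    then obtain y where y: "y \<in> N" "y \<notin> TI" by auto
    then have "A y = (\<lambda>_ _. 0)" using g unfolding glued_def by blast
    then have "?a y = 0" by simp
    then show ?thesis using near[OF y(1) k] False by (simp add: vgrad_def)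
  qed
  have "D = (\<Sum>x\<in>N. ?m x)" by (simp add: D_def N_def)
  also have "\<dots> \<le> (\<Sum>x\<in>(\<lambda>s. k + s) ` ({-1, 0, 1} \<times> {-1, 0, 1}). ?m x)"
  proof (rule sum_mono2)
    show "N \<subseteq> (\<lambda>s. k + s) ` ({-1, 0, 1} \<times> {-1, 0, 1})"
    proof
      fix y assume y: "y \<in> N"
      then have "y - k \<in> {-1, 0, 1} \<times> {-1, 0, 1}" using k by (auto simp: N_def zero_prod_def)
      then show "y \<in> (\<lambda>s. k + s) ` ({-1, 0, 1} \<times> {-1, 0, 1})" by (rule image_eqI[rotated]) simp
    qed
  qed (auto simp: m0)
  also have "\<dots> = patch_size A k" unfolding patch_size_def by (subst sum.reindex) (auto simp: inj_on_def)
  finally show ?thesis using b1 by linarith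
qed

lemma csize_le_patch_size: "csize (A k) \<le> patch_size A k"
proof -
  have "csize (A (k + (0, 0))) \<le> patch_size A k" unfolding patch_size_def
    by (rule member_le_sum) (auto simp: csize_nonneg)
  then show ?thesis by (simp add: zero_prod_def[symmetric])
qed

text \<open>The companion terms are collected by vertices and edges. The contributions of the four
  cells at a vertex, or of the two cells at an edge, amount to the weak equation tested with one
  smooth product, so every group sums to zero and only the Morley polynomials remain.\<close>

lemma sum_local_functional:
  assumes up: "uniform_partition \<Omega> h T" and op: "open \<Omega>" and ic: "interior (closure \<Omega>) = \<Omega>"
    and grid: "\<forall>K\<in>T. \<exists>k. K = square h (grid_centre h c k)" and TI: "TI = {k. square h (grid_centre h c k) \<in> T}"
    and u: "u \<in> sobolev 2 \<Omega>" and f: "L2 \<Omega> f" and eq: "\<forall>v\<in>sobolev0 2 \<Omega>. a_form \<Omega> u v = L2_inner \<Omega> f v"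
    and A: "glued TI A"
  defines "L \<equiv> \<lambda>k. cell_residual h (grid_centre h c k) (\<lambda>i. weak_deriv \<Omega> (mi (2 - i) i) u) f"
  defines "P \<equiv> \<lambda>k b1 b2. vgrad TI A 1 0 (cell_corner k b1 b2)"
  defines "Q \<equiv> \<lambda>k b1 b2. vgrad TI A 0 1 (cell_corner k b1 b2)"
  shows "(\<Sum>k\<in>TI. local_functional (L k) (A k) (corner_value (A k)) (P k) (Q k)
     (\<lambda>b. flux1 (A k) b - (P k b False + P k b True) / 2) (\<lambda>b. flux2 (A k) b - (Q k False b + Q k True b) / 2))
   = (\<Sum>k\<in>TI. A k 0 0 * L k (pw 0) (pw 0) + A k 1 0 * L k (pw 1) (pw 0) + A k 0 1 * L k (pw 0) (pw 1) + A k 2 0 * L k (pw 2) (pw 0)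
      + A k 1 1 * L k (pw 1) (pw 1) + A k 0 2 * L k (pw 0) (pw 2) + A k 3 0 * L k (pw 3) (pw 0) + A k 0 3 * L k (pw 0) (pw 3))"
proof -
  have h: "h > 0" using up by (auto simp: uniform_partition_def)
  have fin: "finite TI" by (rule integral_over_cells(1)[OF up op ic grid TI L2_integrable_square[OF f]])
  have star: "(\<Sum>(o1, o2)\<in>offs e1 \<times> offs e2. L (fst z + o1, snd z + o2)
     (shifted (2 * of_int o1 + of_int (bi e1)) F) (shifted (2 * of_int o2 + of_int (bi e2)) G)) = 0"
    if "\<forall>o1\<in>offs e1. \<forall>o2\<in>offs e2. (fst z + o1, snd z + o2) \<in> TI" "smooth1 F" "smooth1 G"
      "\<And>x. x \<notin> {- (of_int (bi e1) + 1/2)..of_int (bi e1) + 1/2} \<Longrightarrow> F x = 0"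
      "\<And>x. x \<notin> {- (of_int (bi e2) + 1/2)..of_int (bi e2) + 1/2} \<Longrightarrow> G x = 0" for e1 e2 z F G
    unfolding L_def by (rule star_sum[OF up op ic grid TI u f eq that(1-3)]; rule that(4) that(5); assumption)
  have Az: "A k = (\<lambda>_ _. 0)" if "k \<notin> TI" for k using A that unfolding glued_def by blast
  have cong: "L k F G = L k F' G'" if "\<And>x. x \<in> {-1<..<1} \<Longrightarrow> F x = F' x" "\<And>x. x \<in> {-1<..<1} \<Longrightarrow> G x = G' x" for k F F' G G'
    unfolding L_def by (rule cell_residual_cong[OF h]) (use that in auto)
  let ?V = "inner_vertices TI"
  have vertex: "(\<Sum>k\<in>TI. v (cell_corner k False False) * L k FL GL + v (cell_corner k True False) * L k FR GL
       + v (cell_corner k False True) * L k FL GR + v (cell_corner k True True) * L k FR GR) = 0"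
    if v: "\<And>z. z \<notin> ?V \<Longrightarrow> v z = 0" and FG: "smooth1 F" "smooth1 G"
      "\<And>x. x \<notin> {-3/2..3/2} \<Longrightarrow> F x = 0" "\<And>x. x \<notin> {-3/2..3/2} \<Longrightarrow> G x = 0"
      and loc: "\<And>x. x \<in> {-1<..<1} \<Longrightarrow> F (x + 1) = FL x" "\<And>x. x \<in> {-1<..<1} \<Longrightarrow> F (x - 1) = FR x"
       "\<And>x. x \<in> {-1<..<1} \<Longrightarrow> G (x + 1) = GL x" "\<And>x. x \<in> {-1<..<1} \<Longrightarrow> G (x - 1) = GR x"
    for v :: "int \<times> int \<Rightarrow> real" and F G FL FR GL GR
  proof -
    have z0: "L z FL GL + L (z - (1, 0)) FR GL + L (z - (0, 1)) FL GR + L (z - (1, 1)) FR GR = 0" if z: "z \<in> ?V" for z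
    proof -
      have "\<forall>o1\<in>offs True. \<forall>o2\<in>offs True. (fst z + o1, snd z + o2) \<in> TI"
        using z by (cases z) (auto simp: inner_vertices_def offs_def)
      then have "(\<Sum>(o1, o2)\<in>offs True \<times> offs True. L (fst z + o1, snd z + o2) (shifted (2 * real_of_int o1 + real_of_int (bi True)) F)
          (shifted (2 * real_of_int o2 + real_of_int (bi True)) G)) = 0"
        by (rule star[OF _ FG(1,2)]) (rule FG, simp add: bi_def)+
      then have "L z (shifted 1 F) (shifted 1 G) + L (z - (1, 0)) (shifted (-1) F) (shifted 1 G) + L (z - (0, 1)) (shifted 1 F) (shifted (-1) G)
          + L (z - (1, 1)) (shifted (-1) F) (shifted (-1) G) = 0"
        unfolding sum.cartesian_product[symmetric] by (cases z) (simp add: offs_def bi_def algebra_simps)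
      moreover have "L k (shifted 1 F) (shifted 1 G) = L k FL GL" "L k (shifted (-1) F) (shifted 1 G) = L k FR GL"
        "L k (shifted 1 F) (shifted (-1) G) = L k FL GR" "L k (shifted (-1) F) (shifted (-1) G) = L k FR GR" for k
        by (rule cong; simp add: shifted_def loc)+
      ultimately show ?thesis by simp
    qed
    have r: "(\<Sum>k\<in>TI. v (cell_corner k b1 b2) * M k) = (\<Sum>z\<in>?V. v z * M (z - (bi b1, bi b2)))" for b1 b2 M
      unfolding cell_corner_def by (rule sum_grid_shift[OF fin]) (auto simp: inner_vertices_def bi_def v zero_prod_def[symmetric])
    show ?thesis unfolding sum.distrib r
      unfolding sum.distrib[symmetric] using z0 by (auto intro!: sum.neutral simp: bi_def zero_prod_def[symmetric] simp flip: distrib_left)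
  qed
  have edge1: "(\<Sum>k\<in>TI. d (k + (bi False, 0)) * L k thL bump + d (k + (bi True, 0)) * L k thR bump) = 0"
    if d: "\<And>z. \<not> (z \<in> TI \<and> z - (1, 0) \<in> TI) \<Longrightarrow> d z = 0" for d :: "int \<times> int \<Rightarrow> real"
  proof -
    let ?E = "{z. z \<in> TI \<and> z - (1, 0) \<in> TI}"
    have z0: "L z thL bump + L (z - (1, 0)) thR bump = 0" if z: "z \<in> ?E" for z
    proof -
      have "\<forall>o1\<in>offs True. \<forall>o2\<in>offs False. (fst z + o1, snd z + o2) \<in> TI"
        using z by (cases z) (auto simp: offs_def)
      then have "(\<Sum>(o1, o2)\<in>offs True \<times> offs False. L (fst z + o1, snd z + o2) (shifted (2 * real_of_int o1 + real_of_int (bi True)) theta)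
          (shifted (2 * real_of_int o2 + real_of_int (bi False)) bump)) = 0"
        by (rule star[OF _ smooth1_theta smooth1_bump]) (auto simp: bi_def intro!: theta_zero bump_zero)
      then have "L z (shifted 1 theta) (shifted 0 bump) + L (z - (1, 0)) (shifted (-1) theta) (shifted 0 bump) = 0"
        unfolding sum.cartesian_product[symmetric] by (cases z) (simp add: offs_def bi_def algebra_simps)
      moreover have "L k (shifted 1 theta) (shifted 0 bump) = L k thL bump" "L k (shifted (-1) theta) (shifted 0 bump) = L k thR bump" for k
        by (rule cong; simp add: shifted_def theta_shift)+
      ultimately show ?thesis by simp
    qed
    have r: "(\<Sum>k\<in>TI. d (k + (bi b, 0)) * M k) = (\<Sum>z\<in>?E. d z * M (z - (bi b, 0)))" for b M
      by (rule sum_grid_shift[OF fin]) (auto simp: bi_def d zero_prod_def[symmetric])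
    show ?thesis unfolding sum.distrib r
      unfolding sum.distrib[symmetric] using z0 by (auto intro!: sum.neutral simp: bi_def zero_prod_def[symmetric] simp flip: distrib_left)
  qed
  have edge2: "(\<Sum>k\<in>TI. d (k + (0, bi False)) * L k bump thL + d (k + (0, bi True)) * L k bump thR) = 0"
    if d: "\<And>z. \<not> (z \<in> TI \<and> z - (0, 1) \<in> TI) \<Longrightarrow> d z = 0" for d :: "int \<times> int \<Rightarrow> real"
  proof -
    let ?E = "{z. z \<in> TI \<and> z - (0, 1) \<in> TI}"
    have z0: "L z bump thL + L (z - (0, 1)) bump thR = 0" if z: "z \<in> ?E" for z
    proof -
      have "\<forall>o1\<in>offs False. \<forall>o2\<in>offs True. (fst z + o1, snd z + o2) \<in> TI"
        using z by (cases z) (auto simp: offs_def)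
      then have "(\<Sum>(o1, o2)\<in>offs False \<times> offs True. L (fst z + o1, snd z + o2) (shifted (2 * real_of_int o1 + real_of_int (bi False)) bump)
          (shifted (2 * real_of_int o2 + real_of_int (bi True)) theta)) = 0"
        by (rule star[OF _ smooth1_bump smooth1_theta]) (auto simp: bi_def intro!: theta_zero bump_zero)
      then have "L z (shifted 0 bump) (shifted 1 theta) + L (z - (0, 1)) (shifted 0 bump) (shifted (-1) theta) = 0"
        unfolding sum.cartesian_product[symmetric] by (cases z) (simp add: offs_def bi_def algebra_simps)
      moreover have "L k (shifted 0 bump) (shifted 1 theta) = L k bump thL" "L k (shifted 0 bump) (shifted (-1) theta) = L k bump thR" for k
        by (rule cong; simp add: shifted_def theta_shift)+
      ultimately show ?thesis by simp
    qed
    have r: "(\<Sum>k\<in>TI. d (k + (0, bi b)) * M k) = (\<Sum>z\<in>?E. d z * M (z - (0, bi b)))" for b M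
      by (rule sum_grid_shift[OF fin]) (auto simp: bi_def d zero_prod_def[symmetric])
    show ?thesis unfolding sum.distrib r
      unfolding sum.distrib[symmetric] using z0 by (auto intro!: sum.neutral simp: bi_def zero_prod_def[symmetric] simp flip: distrib_left)
  qed
  have pz: "psi x = 0" "theta x = 0" if "x \<notin> {-3/2..3/2}" for x using that by (auto intro!: psi_zero theta_zero)
  \<comment> \<open>A vertex carries the index of the cell whose lower left corner it is, so that
    one function on indices describes all corner values.\<close>
  define vv where "vv z = corner_value (A z) False False" for z
  have vv: "corner_value (A k) b1 b2 = vv (cell_corner k b1 b2)" for k b1 b2
    unfolding vv_def by (rule glued_corner[OF A])
  have vv0: "vv z = 0" if "z \<notin> ?V" for z
  proof -
    have cz: "corner_value (\<lambda>_ _. 0) b1 b2 = 0" for b1 b2 by (simp add: corner_value_def)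
    from that consider "z \<notin> TI" | "z - (1, 0) \<notin> TI" | "z - (0, 1) \<notin> TI" | "z - (1, 1) \<notin> TI" by (auto simp: inner_vertices_def)
    then show ?thesis
    proof cases
      case 1 then show ?thesis by (simp add: vv_def Az cz)
    next
      case 2 then show ?thesis using vv[of "z - (1, 0)" True False] by (simp add: Az cz cell_corner_def bi_def)
    next
      case 3 then show ?thesis using vv[of "z - (0, 1)" False True] by (simp add: Az cz cell_corner_def bi_def)
    next
      case 4 then show ?thesis using vv[of "z - (1, 1)" True True] by (simp add: Az cz cell_corner_def bi_def)
    qed
  qed
  have g0: "vgrad TI A i j z = 0" if "z \<notin> ?V" for i j z using that by (simp add: vgrad_def)
  define D1 where "D1 z = flux1 (A z) False - (vgrad TI A 1 0 z + vgrad TI A 1 0 (z + (0, 1))) / 2" for z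
  define D2 where "D2 z = flux2 (A z) False - (vgrad TI A 0 1 z + vgrad TI A 0 1 (z + (1, 0))) / 2" for z
  have D1: "flux1 (A k) b - (P k b False + P k b True) / 2 = D1 (k + (bi b, 0))" for k b
    using glued_flux(1)[OF A, of k b] by (cases k) (simp add: D1_def P_def cell_corner_def bi_def)
  have D2: "flux2 (A k) b - (Q k False b + Q k True b) / 2 = D2 (k + (0, bi b))" for k b
    using glued_flux(2)[OF A, of k b] by (cases k) (simp add: D2_def Q_def cell_corner_def bi_def add.commute)
  have D10: "D1 z = 0" if "\<not> (z \<in> TI \<and> z - (1, 0) \<in> TI)" for z
  proof -
    \<comment> \<open>These are the two ends of the left edge of cell \<open>z\<close>. If that edge
      is not shared by two cells of the partition, neither end is an inner vertex, and the gradients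
      in \<open>D1\<close> vanish along with the flux.\<close>
    have "z \<notin> ?V" "z + (0, 1) \<notin> ?V" using that by (cases z; auto simp: inner_vertices_def)+
    moreover have "flux1 (A z) False = 0"
      using that glued_flux(1)[OF A, of "z - (1, 0)" True] Az[of z] Az[of "z - (1, 0)"] by (auto simp: bi_def flux1_def)
    ultimately show ?thesis by (simp add: D1_def g0)
  qed
  have D20: "D2 z = 0" if "\<not> (z \<in> TI \<and> z - (0, 1) \<in> TI)" for z
  proof -
    have "z \<notin> ?V" "z + (1, 0) \<notin> ?V" using that by (cases z; auto simp: inner_vertices_def)+
    moreover have "flux2 (A z) False = 0"
      using that glued_flux(2)[OF A, of "z - (0, 1)" True] Az[of z] Az[of "z - (0, 1)"] by (auto simp: bi_def flux2_def)
    ultimately show ?thesis by (simp add: D2_def g0)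
  qed
  have s1: "(\<Sum>k\<in>TI. vv (cell_corner k False False) * L k psiL psiL + vv (cell_corner k True False) * L k stp psiL
       + vv (cell_corner k False True) * L k psiL stp + vv (cell_corner k True True) * L k stp stp) = 0"
    by (rule vertex[OF vv0 smooth1_psi smooth1_psi pz(1) pz(1)]) (auto simp: psi_shift)
  have s2: "(\<Sum>k\<in>TI. P k False False * L k thL psiL + P k True False * L k thR psiL
       + P k False True * L k thL stp + P k True True * L k thR stp) = 0"
    unfolding P_def by (rule vertex[OF g0 smooth1_theta smooth1_psi pz(2) pz(1)]) (auto simp: psi_shift theta_shift)
  have s3: "(\<Sum>k\<in>TI. Q k False False * L k psiL thL + Q k True False * L k stp thL
       + Q k False True * L k psiL thR + Q k True True * L k stp thR) = 0"
    unfolding Q_def by (rule vertex[OF g0 smooth1_psi smooth1_theta pz(1) pz(2)]) (auto simp: psi_shift theta_shift)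
  have s4: "(\<Sum>k\<in>TI. D1 (k + (bi False, 0)) * L k thL bump + D1 (k + (bi True, 0)) * L k thR bump) = 0"
    by (rule edge1) (rule D10)
  have s5: "(\<Sum>k\<in>TI. D2 (k + (0, bi False)) * L k bump thL + D2 (k + (0, bi True)) * L k bump thR) = 0"
    by (rule edge2) (rule D20)
  show ?thesis
    unfolding local_functional_def vv D1 D2 sum_subtractf
    using s1 s2 s3 s4 s5 by (simp add: sum.distrib)
qed

section \<open>The energy of a Morley function on one cell\<close>

lemma integral_resc:
  assumes "h > 0" "smooth1 A"
  shows "integrable lborel (\<lambda>t. indicator {e - h<..<e + h} t * resc h e A t)"
    and "(\<integral>t. indicator {e - h<..<e + h} t * resc h e A t \<partial>lborel) = h * mom0 A"
proof -
  define g where "g = (\<lambda>x. indicator {-1<..<1} x * A x :: real)"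
  define F where "F = (\<lambda>t. indicator {e - h<..<e + h} t * resc h e A t)"
  have si: "set_integrable lborel {-1<..<1} A"
  proof (rule set_integrable_subset[of lborel "{-1..1}"])
    show "set_integrable lborel {-1..1} A" unfolding set_integrable_def
      by (intro borel_integrable_compact smooth1_continuous_on assms(2)) auto
  qed auto
  have gi: "integrable lborel g" using si by (simp add: g_def set_integrable_def)
  have "(\<integral>x. g x \<partial>lborel) = integral {-1<..<1} A"
    using set_borel_integral_eq_integral(2)[OF si] by (simp add: g_def set_lebesgue_integral_def)
  then have gm: "(\<integral>x. g x \<partial>lborel) = mom0 A" by (simp add: mom0_def integral_open_interval_real)
  have Fg: "F (e + h * x) = g x" for x
  proof -
    have "e + h * x \<in> {e - h<..<e + h} \<longleftrightarrow> x \<in> {-1<..<1}"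
      using assms(1) mult_less_cancel_left_pos[of h "-1" x] mult_less_cancel_left_pos[of h x 1] by auto
    then show ?thesis using assms(1) by (auto simp: F_def g_def resc_def indicator_def)
  qed
  show "integrable lborel (\<lambda>t. indicator {e - h<..<e + h} t * resc h e A t)"
    using lborel_integrable_real_affine_iff[of h F e] gi assms(1) unfolding Fg by (simp add: F_def)
  show "(\<integral>t. indicator {e - h<..<e + h} t * resc h e A t \<partial>lborel) = h * mom0 A"
    using lborel_integral_real_affine[of h F e] gm assms(1) unfolding Fg by (simp add: F_def)
qed

lemma integral_ctens:
  assumes "h > 0" "smooth1 A" "smooth1 B"
  shows "integrable (lebesgue_on (cell h c)) (ctens h c A B)"
    and "(LINT x|lebesgue_on (cell h c). ctens h c A B x) = h\<^sup>2 * (mom0 A * mom0 B)"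
proof -
  define a where "a = (\<lambda>t. indicator {c $ 1 - h<..<c $ 1 + h} t * resc h (c $ 1) A t)"
  define b where "b = (\<lambda>t. indicator {c $ 2 - h<..<c $ 2 + h} t * resc h (c $ 2) B t)"
  note ia = integral_resc[OF assms(1,2), of "c $ 1", folded a_def]
  note ib = integral_resc[OF assms(1,3), of "c $ 2", folded b_def]
  have e: "(\<lambda>x. indicator (cell h c) x * ctens h c A B x) = tens a b"
    by (auto simp: fun_eq_iff tens_def a_def b_def ctens_def mem_cell indicator_def abs_less_iff)
  have "integrable lborel (tens a b)" by (rule integrable_tens[OF ia(1) ib(1)])
  then have ii: "integrable lebesgue (tens a b)" "integral\<^sup>L lebesgue (tens a b) = integral\<^sup>L lborel (tens a b)"
    using integrable_completion[of "tens a b" lborel] integral_completion[of "tens a b" lborel] by auto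
  show "integrable (lebesgue_on (cell h c)) (ctens h c A B)"
    using ii(1) by (simp add: integrable_lebesgue_on e)
  show "(LINT x|lebesgue_on (cell h c). ctens h c A B x) = h\<^sup>2 * (mom0 A * mom0 B)"
    using ii(2) integral_tens[OF ia(1) ib(1)] unfolding ia(2) ib(2)
    by (simp add: integral_lebesgue_on e power2_eq_square)
qed

definition morley_terms :: "(nat \<Rightarrow> nat \<Rightarrow> real) \<Rightarrow> (real \<times> (real \<Rightarrow> real) \<times> (real \<Rightarrow> real)) list" where
  "morley_terms a = [(a 0 0, pw 0, pw 0), (a 1 0, pw 1, pw 0), (a 0 1, pw 0, pw 1), (a 2 0, pw 2, pw 0), (a 1 1, pw 1, pw 1),
     (a 0 2, pw 0, pw 2), (a 3 0, pw 3, pw 0), (a 0 3, pw 0, pw 3)]"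

lemma cell_poly_morley_terms: "cell_poly h c a = (\<lambda>x. \<Sum>(k, A, B)\<leftarrow>morley_terms a. k * ctens h c A B x)"
  by (simp add: fun_eq_iff morley_terms_def cell_poly_def lp_def ctens_eq pw_def)

lemma smooth1_morley_terms: "(k, A, B) \<in> set (morley_terms a) \<Longrightarrow> smooth1 A \<and> smooth1 B"
  by (auto simp: morley_terms_def smooth1_pw)

lemma has_weak_deriv_ctens_list:
  assumes "open U" "\<And>k A B. (k, A, B) \<in> set ts \<Longrightarrow> smooth1 A \<and> smooth1 B"
  shows "has_weak_deriv U \<alpha> (\<lambda>x. \<Sum>(k, A, B)\<leftarrow>ts. k * ctens h c A B x) (\<lambda>x. \<Sum>(k, A, B)\<leftarrow>ts. k * dct \<alpha> h c A B x)"
  using assms(2)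
proof (induction ts)
  case Nil
  then show ?case using has_weak_deriv_zero[OF assms(1)] by simp
next
  case (Cons p ts)
  obtain k A B where p: "p = (k, A, B)" by (metis prod.collapse)
  have "has_weak_deriv U \<alpha> (\<lambda>x. k * ctens h c A B x) (\<lambda>x. k * dct \<alpha> h c A B x)"
    using Cons.prems[of k A B] p by (intro has_weak_deriv_cmult has_weak_deriv_ctens assms(1)) auto
  moreover have "has_weak_deriv U \<alpha> (\<lambda>x. \<Sum>(k, A, B)\<leftarrow>ts. k * ctens h c A B x) (\<lambda>x. \<Sum>(k, A, B)\<leftarrow>ts. k * dct \<alpha> h c A B x)"
    by (rule Cons.IH) (use Cons.prems in auto)
  ultimately show ?case using has_weak_deriv_add[OF assms(1)] by (simp add: p)
qed

lemma continuous_on_dct_list: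
  assumes "\<And>k A B. (k, A, B) \<in> set ts \<Longrightarrow> smooth1 A \<and> smooth1 B"
  shows "continuous_on S (\<lambda>x. \<Sum>(k, A, B)\<leftarrow>ts. k * dct \<alpha> h c A B x)"
  using assms by (induction ts) (auto intro!: continuous_intros continuous_on_dct)

lemma L2_dct_list:
  assumes "h > 0" "\<And>k A B. (k, A, B) \<in> set ts \<Longrightarrow> smooth1 A \<and> smooth1 B"
  shows "L2 (cell h c) (\<lambda>x. \<Sum>(k, A, B)\<leftarrow>ts. k * dct \<alpha> h c A B x)"
  by (rule L2_bounded_set_continuous[OF continuous_on_dct_list[OF assms(2)] assms(1)])

lemma cell_residual_integral_list:
  assumes h: "h > 0" and s: "\<And>i. i < 3 \<Longrightarrow> L2 (cell h c) (s i)" and f: "L2 (cell h c) f"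
    and ts: "\<And>k A B. (k, A, B) \<in> set ts \<Longrightarrow> smooth1 A \<and> smooth1 B"
  defines "D \<equiv> \<lambda>i ts x. \<Sum>(k, A, B)\<leftarrow>ts. k * dct (mi (2 - i) i) h c A B x"
  shows "(LINT x|lebesgue_on (cell h c). s 0 x * D 0 ts x + 2 * (s 1 x * D 1 ts x) + s 2 x * D 2 ts x)
     - (LINT x|lebesgue_on (cell h c). f x * (\<Sum>(k, A, B)\<leftarrow>ts. k * ctens h c A B x)) = (\<Sum>(k, A, B)\<leftarrow>ts. k * cell_residual h c s f A B)"
  using ts
proof (induction ts)
  case Nil
  then show ?case by (simp add: D_def)
next
  case (Cons p ts)
  obtain k A B where p: "p = (k, A, B)" by (metis prod.collapse)
  have AB: "smooth1 A" "smooth1 B" using Cons.prems[of k A B] p by auto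
  have ts: "\<And>k A B. (k, A, B) \<in> set ts \<Longrightarrow> smooth1 A \<and> smooth1 B" using Cons.prems by auto
  have L: "L2 (cell h c) (D i ts)" for i unfolding D_def by (rule L2_dct_list[OF h]) (rule ts)
  have d: "L2 (cell h c) (dct \<alpha> h c A B)" for \<alpha>
    by (rule L2_bounded_set_continuous[OF continuous_on_dct[OF AB] h])
  have d0: "dct 0 h c A B = ctens h c A B" for A B by (simp add: dct_def multi_order_def fun_eq_iff)
  have c: "L2 (cell h c) (ctens h c A B)" "L2 (cell h c) (\<lambda>x. \<Sum>(k, A, B)\<leftarrow>ts. k * ctens h c A B x)"
  proof -
    have "L2 (cell h c) (\<lambda>x. \<Sum>(k, A, B)\<leftarrow>ts. k * dct 0 h c A B x)" by (rule L2_dct_list[OF h]) (rule ts)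
    then show "L2 (cell h c) (\<lambda>x. \<Sum>(k, A, B)\<leftarrow>ts. k * ctens h c A B x)" by (simp add: d0)
    show "L2 (cell h c) (ctens h c A B)" using d[of 0] by (simp add: d0)
  qed
  have i1: "integrable (lebesgue_on (cell h c)) (\<lambda>x. s 0 x * D 0 ts x + 2 * (s 1 x * D 1 ts x) + s 2 x * D 2 ts x)"
    using L2_integrable_mult[OF s L] by simp
  have i2: "integrable (lebesgue_on (cell h c)) (\<lambda>x. s 0 x * dct (mi 2 0) h c A B x + 2 * (s 1 x * dct (mi 1 1) h c A B x) + s 2 x * dct (mi 0 2) h c A B x)"
    using L2_integrable_mult[OF s d] by simp
  note i3 = L2_integrable_mult[OF f c(1)] and i4 = L2_integrable_mult[OF f c(2)]
  have DE: "D 0 (p # ts) x = k * dct (mi 2 0) h c A B x + D 0 ts x" "D 1 (p # ts) x = k * dct (mi 1 1) h c A B x + D 1 ts x"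
     "D 2 (p # ts) x = k * dct (mi 0 2) h c A B x + D 2 ts x" for x by (simp_all add: D_def p numeral_2_eq_2)
  have "(LINT x|lebesgue_on (cell h c). s 0 x * D 0 (p # ts) x + 2 * (s 1 x * D 1 (p # ts) x) + s 2 x * D 2 (p # ts) x)
     = (LINT x|lebesgue_on (cell h c). k * (s 0 x * dct (mi 2 0) h c A B x + 2 * (s 1 x * dct (mi 1 1) h c A B x) + s 2 x * dct (mi 0 2) h c A B x)
        + (s 0 x * D 0 ts x + 2 * (s 1 x * D 1 ts x) + s 2 x * D 2 ts x))"
    unfolding DE by (rule Bochner_Integration.integral_cong) (simp_all add: algebra_simps)
  also have "\<dots> = k * (LINT x|lebesgue_on (cell h c). s 0 x * dct (mi 2 0) h c A B x + 2 * (s 1 x * dct (mi 1 1) h c A B x) + s 2 x * dct (mi 0 2) h c A B x)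
        + (LINT x|lebesgue_on (cell h c). s 0 x * D 0 ts x + 2 * (s 1 x * D 1 ts x) + s 2 x * D 2 ts x)"
    by (subst Bochner_Integration.integral_add[OF integrable_mult_right[OF i2] i1]) simp
  finally have 1: "(LINT x|lebesgue_on (cell h c). s 0 x * D 0 (p # ts) x + 2 * (s 1 x * D 1 (p # ts) x) + s 2 x * D 2 (p # ts) x) = \<dots>" .
  have "(LINT x|lebesgue_on (cell h c). f x * (\<Sum>(k, A, B)\<leftarrow>p # ts. k * ctens h c A B x))
    = (LINT x|lebesgue_on (cell h c). k * (f x * ctens h c A B x) + f x * (\<Sum>(k, A, B)\<leftarrow>ts. k * ctens h c A B x))"
    by (rule Bochner_Integration.integral_cong) (simp_all add: algebra_simps p)
  also have "\<dots> = k * (LINT x|lebesgue_on (cell h c). f x * ctens h c A B x) + (LINT x|lebesgue_on (cell h c). f x * (\<Sum>(k, A, B)\<leftarrow>ts. k * ctens h c A B x))"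
    by (subst Bochner_Integration.integral_add[OF integrable_mult_right[OF i3] i4]) simp
  finally have 2: "(LINT x|lebesgue_on (cell h c). f x * (\<Sum>(k, A, B)\<leftarrow>p # ts. k * ctens h c A B x)) = \<dots>" .
  have 3: "(\<Sum>(k, A, B)\<leftarrow>p # ts. k * cell_residual h c s f A B) = k * cell_residual h c s f A B + (\<Sum>(k, A, B)\<leftarrow>ts. k * cell_residual h c s f A B)" by (simp add: p)
  have comb: "r * p + q - (r * p' + q') = r * l + m" if "p - p' = l" "q - q' = m" for p p' q q' l m r :: real
    unfolding that[symmetric] by (simp add: algebra_simps)
  show ?case unfolding 1 2 3
    by (rule comb[OF cell_residual_integral[OF h AB _ f] Cons.IH[OF ts]]) (rule s)
qed

lemma morley_cell_weak_deriv:
  assumes "h > 0" and w: "AE x in lebesgue_on (square h c). w x = cell_poly h c a x"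
  shows "has_weak_deriv (cell h c) \<alpha> w (\<lambda>x. \<Sum>(k, A, B)\<leftarrow>morley_terms a. k * dct \<alpha> h c A B x)"
    and "AE x in lebesgue_on (cell h c). w x = cell_poly h c a x"
proof -
  show ae: "AE x in lebesgue_on (cell h c). w x = cell_poly h c a x"
    by (rule AE_lebesgue_on_subset[OF _ _ cell_subset_square w]) (simp_all add: square_def)
  show "has_weak_deriv (cell h c) \<alpha> w (\<lambda>x. \<Sum>(k, A, B)\<leftarrow>morley_terms a. k * dct \<alpha> h c A B x)"
  proof (rule has_weak_deriv_cong_AE[OF open_cell])
    show "has_weak_deriv (cell h c) \<alpha> (cell_poly h c a) (\<lambda>x. \<Sum>(k, A, B)\<leftarrow>morley_terms a. k * dct \<alpha> h c A B x)"
      unfolding cell_poly_morley_terms by (rule has_weak_deriv_ctens_list[OF open_cell]) (rule smooth1_morley_terms)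
    show "AE x in lebesgue_on (cell h c). cell_poly h c a x = w x" using ae by eventually_elim simp
  qed
qed

lemma cell_consistency:
  assumes h: "h > 0" and s: "\<And>i. i < 3 \<Longrightarrow> L2 (cell h c) (s i)" "\<And>i. i < 3 \<Longrightarrow> has_weak_deriv (cell h c) (mi (2 - i) i) u (s i)"
    and f: "L2 (cell h c) f" and w: "AE x in lebesgue_on (square h c). w x = cell_poly h c a x"
  shows "a_form (cell h c) u w - (LINT x|lebesgue_on (cell h c). f x * w x) = (\<Sum>(k, A, B)\<leftarrow>morley_terms a. k * cell_residual h c s f A B)"
proof -
  define D where "D i ts x = (\<Sum>(k, A, B)\<leftarrow>ts. k * dct (mi (2 - i) i) h c A B x)" for i ts x
  have D: "L2 (cell h c) (D i (morley_terms a))" for i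
    unfolding D_def by (rule L2_dct_list[OF h]) (rule smooth1_morley_terms)
  have Dw: "has_weak_deriv (cell h c) (mi (2 - i) i) w (D i (morley_terms a))" for i
    unfolding D_def by (rule morley_cell_weak_deriv(1)[OF h w])
  have 1: "a_form (cell h c) u w = (LINT x|lebesgue_on (cell h c). s 0 x * D 0 (morley_terms a) x + 2 * (s 1 x * D 1 (morley_terms a) x) + s 2 x * D 2 (morley_terms a) x)"
    by (rule a_form_eq(1)[OF open_cell]) (use s D Dw in auto)
  have m: "cell_poly h c a \<in> borel_measurable (lebesgue_on (cell h c))"
  proof -
    have "continuous_on UNIV (cell_poly h c a)"
      unfolding cell_poly_def[abs_def] lp_def using h by (intro continuous_intros) auto
    then show ?thesis by (intro measurable_restrict_space1 borel_measurable_lebesgue_continuous)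
  qed
  note ae = morley_cell_weak_deriv(2)[OF h w]
  have wm: "w \<in> borel_measurable (lebesgue_on (cell h c))"
    by (rule lebesgue_measurable_cong_AE[OF _ m ae]) simp
  have 2: "(LINT x|lebesgue_on (cell h c). f x * w x) = (LINT x|lebesgue_on (cell h c). f x * cell_poly h c a x)"
  proof (rule integral_cong_AE)
    show "AE x in lebesgue_on (cell h c). f x * w x = f x * cell_poly h c a x" using ae by eventually_elim simp
  qed (use m wm L2_measurable[OF f] in auto)
  show ?thesis unfolding 1 2 unfolding cell_poly_morley_terms D_def
    by (rule cell_residual_integral_list[OF h s(1) f]) (assumption, rule smooth1_morley_terms)
qed

lemma deriv2_pw:
  "deriv (pw 0) = (\<lambda>x. 0)" "deriv (pw 1) = (\<lambda>x. 1)"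
  "(deriv ^^ 2) (pw 0) = (\<lambda>x. 0)" "(deriv ^^ 2) (pw 1) = (\<lambda>x. 0)" "(deriv ^^ 2) (pw 2) = (\<lambda>x. 2)" "(deriv ^^ 2) (pw 3) = (\<lambda>x. 6 * x)"
proof -
  have d: "deriv (pw n) = (\<lambda>x. real n * pw (n - 1) x)" for n by (simp add: deriv_ref(4) pw_def fun_eq_iff)
  show "deriv (pw 0) = (\<lambda>x. 0)" "deriv (pw 1) = (\<lambda>x. 1)" by (simp_all add: d pw_def)
  have d2: "(deriv ^^ 2) (pw n) = (\<lambda>x. real n * (real (n - 1) * pw (n - 1 - 1) x))" for n
    unfolding numeral_2_eq_2 by (simp add: d deriv_cmult smooth1_pw)
  show "(deriv ^^ 2) (pw 0) = (\<lambda>x. 0)" "(deriv ^^ 2) (pw 1) = (\<lambda>x. 0)" "(deriv ^^ 2) (pw 2) = (\<lambda>x. 2)" "(deriv ^^ 2) (pw 3) = (\<lambda>x. 6 * x)"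
    unfolding d2 by (simp_all add: pw_def fun_eq_iff)
qed

text \<open>The pure second derivatives are affine in one local variable and the mixed one is
  constant. Odd terms integrate to zero, so the energy is diagonal in the coefficients and bounds
  each of them. Four inverse powers of h meet the h^2 of the area.\<close>

lemma cell_energy:
  assumes h: "h > 0" and w: "AE x in lebesgue_on (square h c). w x = cell_poly h c a x"
  shows "a_form (cell h c) w w = (16 * (a 2 0)\<^sup>2 + 48 * (a 3 0)\<^sup>2 + 8 * (a 1 1)\<^sup>2 + 16 * (a 0 2)\<^sup>2 + 48 * (a 0 3)\<^sup>2) / h\<^sup>2"
proof -
  define D where "D i x = (\<Sum>(k, A, B)\<leftarrow>morley_terms a. k * dct (mi (2 - i) i) h c A B x)" for i x
  have D: "L2 (cell h c) (D i)" for i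
    unfolding D_def by (rule L2_dct_list[OF h]) (rule smooth1_morley_terms)
  have Dw: "has_weak_deriv (cell h c) (mi (2 - i) i) w (D i)" for i
    unfolding D_def by (rule morley_cell_weak_deriv(1)[OF h w])
  have "a_form (cell h c) w w = (LINT x|lebesgue_on (cell h c). D 0 x * D 0 x + 2 * (D 1 x * D 1 x) + D 2 x * D 2 x)"
    by (rule a_form_eq(1)[OF open_cell]) (use D Dw in auto)
  also have "\<dots> = (LINT x|lebesgue_on (cell h c). (1 / h) ^ 4 * ((4 * (a 2 0)\<^sup>2 + 2 * (a 1 1)\<^sup>2 + 4 * (a 0 2)\<^sup>2) * ctens h c (pw 0) (pw 0) x
     + 24 * a 2 0 * a 3 0 * ctens h c (pw 1) (pw 0) x + 24 * a 0 2 * a 0 3 * ctens h c (pw 0) (pw 1) x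
     + 36 * (a 3 0)\<^sup>2 * ctens h c (pw 2) (pw 0) x + 36 * (a 0 3)\<^sup>2 * ctens h c (pw 0) (pw 2) x))"
  proof (rule Bochner_Integration.integral_cong[OF refl])
    fix x :: "real^2"
    define y where "y = (x $ 1 - c $ 1) / h"
    define z where "z = (x $ 2 - c $ 2) / h"
    have p: "pw 0 t = 1" "pw 1 t = t" "pw 2 t = t\<^sup>2" for t by (simp_all add: pw_def)
    have D0: "D 0 x = (1 / h)\<^sup>2 * (2 * a 2 0 + 6 * a 3 0 * y)"
      by (simp add: D_def morley_terms_def dct_def multi_order_mi vector_2 ctens_eq deriv2_pw p y_def algebra_simps power_divide power2_eq_square diff_divide_distrib del: funpow.simps One_nat_def)
    have D1: "D 1 x = (1 / h)\<^sup>2 * a 1 1"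
      using deriv2_pw(1,2) by (simp add: D_def morley_terms_def dct_def multi_order_mi vector_2 ctens_eq deriv2_pw p power2_eq_square)
    have D2: "D 2 x = (1 / h)\<^sup>2 * (2 * a 0 2 + 6 * a 0 3 * z)"
      by (simp add: D_def morley_terms_def dct_def multi_order_mi vector_2 ctens_eq deriv2_pw p z_def algebra_simps power_divide power2_eq_square diff_divide_distrib del: funpow.simps One_nat_def)
    show "D 0 x * D 0 x + 2 * (D 1 x * D 1 x) + D 2 x * D 2 x = (1 / h) ^ 4 * ((4 * (a 2 0)\<^sup>2 + 2 * (a 1 1)\<^sup>2 + 4 * (a 0 2)\<^sup>2) * ctens h c (pw 0) (pw 0) x
     + 24 * a 2 0 * a 3 0 * ctens h c (pw 1) (pw 0) x + 24 * a 0 2 * a 0 3 * ctens h c (pw 0) (pw 1) x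
     + 36 * (a 3 0)\<^sup>2 * ctens h c (pw 2) (pw 0) x + 36 * (a 0 3)\<^sup>2 * ctens h c (pw 0) (pw 2) x)"
      unfolding D0 D1 D2 ctens_eq y_def[symmetric] z_def[symmetric] p by algebra
  qed
  also have "\<dots> = (1 / h) ^ 4 * (h\<^sup>2 * (16 * (a 2 0)\<^sup>2 + 48 * (a 3 0)\<^sup>2 + 8 * (a 1 1)\<^sup>2 + 16 * (a 0 2)\<^sup>2 + 48 * (a 0 3)\<^sup>2))"
  proof -
    have m: "mom0 (pw 0) = 2" "mom0 (pw 1) = 0" "mom0 (pw 2) = 2 / 3" using mom0_eqs by simp_all
    show ?thesis using integral_ctens[OF h smooth1_pw smooth1_pw, where c = c]
      by (simp add: m algebra_simps del: One_nat_def)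
  qed
  also have "\<dots> = (16 * (a 2 0)\<^sup>2 + 48 * (a 3 0)\<^sup>2 + 8 * (a 1 1)\<^sup>2 + 16 * (a 0 2)\<^sup>2 + 48 * (a 0 3)\<^sup>2) / h\<^sup>2"
    using h by (simp add: power2_eq_square eval_nat_numeral field_simps)
  finally show ?thesis .
qed

text \<open>5 is the number of coefficients and 8 the smallest weight in the energy.\<close>

lemma csize_square_le:
  "8 * (csize a)\<^sup>2 \<le> 5 * (16 * (a 2 0)\<^sup>2 + 48 * (a 3 0)\<^sup>2 + 8 * (a 1 1)\<^sup>2 + 16 * (a 0 2)\<^sup>2 + 48 * (a 0 3)\<^sup>2)"
proof -
  define x where "x i = [\<bar>a 2 0\<bar>, \<bar>a 1 1\<bar>, \<bar>a 0 2\<bar>, \<bar>a 3 0\<bar>, \<bar>a 0 3\<bar>] ! i" for i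
  have "(\<Sum>i<5. x i)\<^sup>2 \<le> (\<Sum>i<5. (x i)\<^sup>2) * card {..<5::nat}" by (rule sum_squared_le_sum_of_squares)
  moreover have "(\<Sum>i<5. x i) = csize a" "(\<Sum>i<5. (x i)\<^sup>2) = (a 2 0)\<^sup>2 + (a 1 1)\<^sup>2 + (a 0 2)\<^sup>2 + (a 3 0)\<^sup>2 + (a 0 3)\<^sup>2"
    by (simp_all add: x_def csize_def eval_nat_numeral)
  ultimately have "(csize a)\<^sup>2 \<le> 5 * ((a 2 0)\<^sup>2 + (a 1 1)\<^sup>2 + (a 0 2)\<^sup>2 + (a 3 0)\<^sup>2 + (a 0 3)\<^sup>2)" by (simp del: One_nat_def)
  moreover have "(a 2 0)\<^sup>2 \<ge> 0" "(a 3 0)\<^sup>2 \<ge> 0" "(a 0 2)\<^sup>2 \<ge> 0" "(a 0 3)\<^sup>2 \<ge> 0" by simp_all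
  ultimately show ?thesis unfolding distrib_left by linarith
qed

section \<open>The consistency error\<close>

text \<open>One factor 9 is Cauchy-Schwarz over the cells of a patch, the other counts the patches
  in which a given cell occurs. Cells outside the partition contribute nothing.\<close>

lemma sum_patch_size_square_le:
  assumes "finite TI" "\<And>k. k \<notin> TI \<Longrightarrow> A k = (\<lambda>_ _. 0)"
  shows "(\<Sum>k\<in>TI. (patch_size A k)\<^sup>2) \<le> 81 * (\<Sum>k\<in>TI. (csize (A k))\<^sup>2)"
proof -
  let ?S = "{-1, 0, 1 :: int} \<times> {-1, 0, 1 :: int}"
  have c9: "card ?S = 9" by simp
  have shift: "(\<Sum>k\<in>TI. (csize (A (k + s)))\<^sup>2) \<le> (\<Sum>k\<in>TI. (csize (A k))\<^sup>2)" for s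
  proof -
    have "(\<Sum>k\<in>TI. (csize (A (k + s)))\<^sup>2) = (\<Sum>k\<in>(\<lambda>k. k + s) ` TI. (csize (A k))\<^sup>2)"
      by (subst sum.reindex) (auto simp: inj_on_def)
    also have "\<dots> = (\<Sum>k\<in>(\<lambda>k. k + s) ` TI \<inter> TI. (csize (A k))\<^sup>2)"
      using assms by (intro sum.mono_neutral_right) (auto simp: csize_def)
    also have "\<dots> \<le> (\<Sum>k\<in>TI. (csize (A k))\<^sup>2)" using assms(1) by (intro sum_mono2) auto
    finally show ?thesis .
  qed
  have "(\<Sum>k\<in>TI. (patch_size A k)\<^sup>2) \<le> (\<Sum>k\<in>TI. (\<Sum>s\<in>?S. (csize (A (k + s)))\<^sup>2) * 9)"
    unfolding patch_size_def using sum_squared_le_sum_of_squares[of _ ?S] c9 by (intro sum_mono) (metis of_nat_numeral)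
  also have "\<dots> = 9 * (\<Sum>s\<in>?S. \<Sum>k\<in>TI. (csize (A (k + s)))\<^sup>2)"
    unfolding sum_distrib_right[symmetric] by (subst sum.swap) (rule mult.commute)
  also have "\<dots> \<le> 9 * (\<Sum>s\<in>?S. \<Sum>k\<in>TI. (csize (A k))\<^sup>2)" by (rule mult_left_mono[OF sum_mono[OF shift]]) simp
  also have "\<dots> = 81 * (\<Sum>k\<in>TI. (csize (A k))\<^sup>2)" using c9 by simp
  finally show ?thesis .
qed

lemma sobolev_seminorm4:
  "(sobolev_seminorm 4 U u)\<^sup>2 = (\<Sum>m<5. (L2_norm U (weak_deriv U (mi (4 - m) m) u))\<^sup>2)"
proof -
  have S: "{\<alpha>. multi_order \<alpha> = 4} = (\<lambda>m. mi (4 - m) m) ` {..<5}"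
  proof (intro set_eqI iffI)
    fix \<alpha> assume "\<alpha> \<in> {\<alpha>. multi_order \<alpha> = 4}"
    then have "\<alpha> $ 1 + \<alpha> $ 2 = 4" by (simp add: multi_order_def)
    then have "\<alpha> = mi (4 - \<alpha> $ 2) (\<alpha> $ 2)" "\<alpha> $ 2 < 5" by (auto simp: vec_eq_iff forall_2 vector_2)
    then show "\<alpha> \<in> (\<lambda>m. mi (4 - m) m) ` {..<5}" by blast
  qed (auto simp: multi_order_mi)
  have inj: "inj_on (\<lambda>m. mi (4 - m) m) {..<5}" by (auto simp: inj_on_def vec_eq_iff forall_2 vector_2)
  have "(sobolev_seminorm 4 U u)\<^sup>2 = (\<Sum>\<alpha> | multi_order \<alpha> = 4. (L2_norm U (weak_deriv U \<alpha> u))\<^sup>2)"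
    unfolding sobolev_seminorm_def by (simp add: sum_nonneg)
  also have "\<dots> = (\<Sum>m<5. (L2_norm U (weak_deriv U (mi (4 - m) m) u))\<^sup>2)"
    unfolding S by (subst sum.reindex[OF inj]) simp
  finally show ?thesis .
qed

lemma sum_cell_norms:
  assumes up: "uniform_partition \<Omega> h T" and op: "open \<Omega>" and ic: "interior (closure \<Omega>) = \<Omega>"
    and grid: "\<forall>K\<in>T. \<exists>k. K = square h (grid_centre h c k)" and TI: "TI = {k. square h (grid_centre h c k) \<in> T}" and g: "L2 \<Omega> g"
  shows "(\<Sum>k\<in>TI. (L2_norm (cell h (grid_centre h c k)) g)\<^sup>2) = (L2_norm \<Omega> g)\<^sup>2"
  unfolding L2_norm_square by (rule integral_over_cells(3)[OF up op ic grid TI L2_integrable_square[OF g], symmetric])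

text \<open>Cauchy-Schwarz over the cells separates the coefficients of \<open>w\<close> from the
  norms of \<open>f\<close> and of the fourth derivatives. In 162 = 6 * 9 * 3 the 6 comes from
  \<open>vgrad_bound\<close>, the 9 is the root of 81 in \<open>sum_patch_size_square_le\<close>,
  and the 3 exceeds the root of 6, the number of norms on each cell.\<close>

lemma consistency_error_bound:
  assumes C: "C \<ge> 0" "\<And>h c s t f M a p q. cell_data h c s t f \<Longrightarrow>
    \<bar>a 2 0\<bar> \<le> M \<and> \<bar>a 1 1\<bar> \<le> M \<and> \<bar>a 0 2\<bar> \<le> M \<and> \<bar>a 3 0\<bar> \<le> M \<and> \<bar>a 0 3\<bar> \<le> M \<Longrightarrow>
    (\<forall>b1 b2. \<bar>p b1 b2 - a 1 0\<bar> \<le> M \<and> \<bar>q b1 b2 - a 0 1\<bar> \<le> M) \<Longrightarrow>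
    \<bar>local_functional (cell_residual h c s f) a (corner_value a) p q
     (\<lambda>b. flux1 a b - (p b False + p b True) / 2) (\<lambda>b. flux2 a b - (q False b + q True b) / 2)\<bar>
    \<le> C * M * h * (L2_norm (cell h c) f + (\<Sum>i<5. L2_norm (cell h c) (t i)))"
    and dom: "lipschitz_domain \<Omega>" and up: "uniform_partition \<Omega> h T" and f: "L2 \<Omega> f"
    and eq: "\<forall>v\<in>sobolev0 2 \<Omega>. a_form \<Omega> u v = L2_inner \<Omega> f v" and u4: "u \<in> sobolev 4 \<Omega>"
    and w: "w \<in> morley_space \<Omega> T"
  shows "ah_form T u w - L2_inner \<Omega> f w \<le> 162 * C * h\<^sup>2 * (L2_norm \<Omega> f + sobolev_seminorm 4 \<Omega> u) * h_seminorm T w"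
proof -
  have h: "h > 0" and fT: "finite T" using up by (auto simp: uniform_partition_def)
  have op: "open \<Omega>" and con: "connected \<Omega>" "\<Omega> \<noteq> {}" using dom by (auto simp: lipschitz_domain_def)
  have ic: "interior (closure \<Omega>) = \<Omega>" by (rule interior_closure_lipschitz_domain[OF dom])
  have Os: "\<Omega> \<in> sets lebesgue" using op by simp
  obtain c where grid: "\<forall>K\<in>T. \<exists>k. K = square h (grid_centre h c k)" using uniform_partition_grid[OF up con] by blast
  define TI where TI: "TI = {k. square h (grid_centre h c k) \<in> T}"
  let ?cell = "\<lambda>k. cell h (grid_centre h c k)"
  note sp = integral_over_cells[OF up op ic grid TI]
  have fin: "finite TI" by (rule sp(1)[OF L2_integrable_square[OF f]])
  have sub: "?cell k \<subseteq> \<Omega>" if "k \<in> TI" for k by (rule sp(2)[OF L2_integrable_square[OF f] that])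
  obtain A :: "int \<times> int \<Rightarrow> nat \<Rightarrow> nat \<Rightarrow> real" where gl: "glued TI A"
    and wA: "\<And>k. k \<in> TI \<Longrightarrow> AE x in lebesgue_on (square h (grid_centre h c k)). w x = cell_poly h (grid_centre h c k) (A k) x"
    using grid_coefficients[OF up op grid w] unfolding glued_def TI mem_Collect_eq by blast
  have Az: "A k = (\<lambda>_ _. 0)" if "k \<notin> TI" for k using gl that unfolding glued_def by blast
  have wL: "L2 \<Omega> w" using w by (simp add: morley_space_def)
  have u2: "u \<in> sobolev 2 \<Omega>" using u4 unfolding sobolev_def by auto
  define s where "s = (\<lambda>i. weak_deriv \<Omega> (mi (2 - i) i) u)"
  define t where "t = (\<lambda>i. weak_deriv \<Omega> (mi (4 - i) i) u)"
  have s: "has_weak_deriv \<Omega> (mi (2 - i) i) u (s i)" "L2 \<Omega> (s i)" if "i < 3" for i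
    unfolding s_def using sobolev_weak_deriv[OF op u4, of "mi (2 - i) i"] that by (auto simp: multi_order_mi)
  have t: "has_weak_deriv \<Omega> (mi (4 - i) i) u (t i)" "L2 \<Omega> (t i)" if "i < 5" for i
    unfolding t_def using sobolev_weak_deriv[OF op u4, of "mi (4 - i) i"] that by (auto simp: multi_order_mi)
  have L: "L2 (?cell k) g" if "k \<in> TI" "L2 \<Omega> g" for k g
    using L2_subset[OF Os _ sub[OF that(1)] that(2)] by simp
  have cd: "cell_data h (grid_centre h c k) s t f" if k: "k \<in> TI" for k
    unfolding cell_data_def
  proof (intro conjI allI impI h L[OF k f])
    show "L2 (?cell k) (s i)" if "i < 3" for i using L[OF k s(2)[OF that]] .
    show "L2 (?cell k) (t i)" if "i < 5" for i using L[OF k t(2)[OF that]] .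
    show "cell_weak h (grid_centre h c k) (2 - j) j (s i) (t (i + j))" if i: "i < 3" and j: "j < 3" for i j
    proof (rule cell_weak_of_weak_deriv[OF op sub[OF k] h s(1)[OF i]])
      have "2 - i + (2 - j) = 4 - (i + j)" using i j by simp
      then show "has_weak_deriv \<Omega> (mi (2 - i + (2 - j)) (i + j)) u (t (i + j))" using t(1)[of "i + j"] i j by simp
      show "2 - j + j = 2" using j by simp
    qed
  qed
  have ahT: "ah_form T g g' = (\<Sum>k\<in>TI. a_form (?cell k) g g')" for g g'
  proof -
    have "T = (\<lambda>k. square h (grid_centre h c k)) ` TI" using grid by (auto simp: TI)
    moreover have "inj_on (\<lambda>k. square h (grid_centre h c k)) TI" by (auto simp: inj_on_def square_grid_centre_inj[OF h])
    ultimately show ?thesis unfolding ah_form_def by (simp add: sum.reindex interior_square)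
  qed
  define Lk where "Lk k = cell_residual h (grid_centre h c k) s f" for k
  define P where "P = (\<lambda>k b1 b2. vgrad TI A 1 0 (cell_corner k b1 b2))"
  define Q where "Q = (\<lambda>k b1 b2. vgrad TI A 0 1 (cell_corner k b1 b2))"
  define F where "F k = local_functional (Lk k) (A k) (corner_value (A k)) (P k) (Q k)
     (\<lambda>b. flux1 (A k) b - (P k b False + P k b True) / 2) (\<lambda>b. flux2 (A k) b - (Q k False b + Q k True b) / 2)" for k
  have "ah_form T u w - L2_inner \<Omega> f w = (\<Sum>k\<in>TI. a_form (?cell k) u w - (LINT x|lebesgue_on (?cell k). f x * w x))"
    unfolding ahT L2_inner_def sp(3)[OF L2_integrable_mult[OF f wL]] by (simp add: sum_subtractf)
  also have "\<dots> = (\<Sum>k\<in>TI. \<Sum>(r, G, H)\<leftarrow>morley_terms (A k). r * Lk k G H)"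
  proof (rule sum.cong[OF refl])
    fix k assume k: "k \<in> TI"
    show "a_form (?cell k) u w - (LINT x|lebesgue_on (?cell k). f x * w x) = (\<Sum>(r, G, H)\<leftarrow>morley_terms (A k). r * Lk k G H)"
      unfolding Lk_def
    proof (rule cell_consistency[OF h _ _ L[OF k f] wA[OF k]])
      show "L2 (?cell k) (s i)" if "i < 3" for i using L[OF k s(2)[OF that]] .
      show "has_weak_deriv (?cell k) (mi (2 - i) i) u (s i)" if "i < 3" for i
        by (rule has_weak_deriv_subset[OF op open_cell sub[OF k] s(1)[OF that]])
    qed
  qed
  also have "\<dots> = (\<Sum>k\<in>TI. F k)"
    using sum_local_functional[OF up op ic grid TI u2 f eq gl]
    unfolding F_def P_def Q_def Lk_def s_def by (simp add: morley_terms_def add.assoc)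
  finally have E: "ah_form T u w - L2_inner \<Omega> f w = (\<Sum>k\<in>TI. F k)" .
  define X where "X k = L2_norm (?cell k) f + (\<Sum>i<5. L2_norm (?cell k) (t i))" for k
  have X0: "X k \<ge> 0" for k unfolding X_def by (intro add_nonneg_nonneg sum_nonneg L2_norm_nonneg)
  have p0: "patch_size A k \<ge> 0" for k unfolding patch_size_def by (intro sum_nonneg csize_nonneg)
  have Fk: "F k \<le> 6 * C * h * (\<bar>patch_size A k\<bar> * \<bar>X k\<bar>)" if k: "k \<in> TI" for k
  proof -
    have "\<bar>F k\<bar> \<le> C * (6 * patch_size A k) * h * X k"
      unfolding F_def Lk_def X_def
    proof (rule C(2)[OF cd[OF k]])
      have "csize (A k) \<le> 6 * patch_size A k" using csize_le_patch_size[of A k] p0[of k] by linarith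
      then show "\<bar>A k 2 0\<bar> \<le> 6 * patch_size A k \<and> \<bar>A k 1 1\<bar> \<le> 6 * patch_size A k \<and> \<bar>A k 0 2\<bar> \<le> 6 * patch_size A k
          \<and> \<bar>A k 3 0\<bar> \<le> 6 * patch_size A k \<and> \<bar>A k 0 3\<bar> \<le> 6 * patch_size A k"
        unfolding csize_def by (intro conjI; linarith)
      show "\<forall>b1 b2. \<bar>P k b1 b2 - A k 1 0\<bar> \<le> 6 * patch_size A k \<and> \<bar>Q k b1 b2 - A k 0 1\<bar> \<le> 6 * patch_size A k"
        unfolding P_def Q_def using vgrad_bound[OF gl] by simp
    qed
    then show ?thesis using X0[of k] p0[of k] by (simp add: mult_ac)
  qed
  have "(\<Sum>k\<in>TI. F k) \<le> 6 * C * h * (\<Sum>k\<in>TI. \<bar>patch_size A k\<bar> * \<bar>X k\<bar>)"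
    unfolding sum_distrib_left by (rule sum_mono) (rule Fk)
  also have "\<dots> \<le> 6 * C * h * (L2_set (patch_size A) TI * L2_set X TI)"
    using C(1) h by (intro mult_left_mono L2_set_mult_ineq) auto
  also have "\<dots> \<le> 6 * C * h * ((9 * h * h_seminorm T w) * (3 * (L2_norm \<Omega> f + sobolev_seminorm 4 \<Omega> u)))"
  proof (intro mult_left_mono mult_mono)
    define Eg where "Eg k = 16 * (A k 2 0)\<^sup>2 + 48 * (A k 3 0)\<^sup>2 + 8 * (A k 1 1)\<^sup>2 + 16 * (A k 0 2)\<^sup>2 + 48 * (A k 0 3)\<^sup>2" for k
    have e: "a_form (?cell k) w w = Eg k / h\<^sup>2" if "k \<in> TI" for k
      unfolding Eg_def by (rule cell_energy[OF h wA[OF that]])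
    have sn: "ah_form T w w = (\<Sum>k\<in>TI. Eg k) / h\<^sup>2" unfolding ahT by (simp add: e sum_divide_distrib)
    have Eg0: "Eg k \<ge> 0" for k by (simp add: Eg_def)
    have sn0: "ah_form T w w \<ge> 0" unfolding sn using Eg0 by (intro divide_nonneg_nonneg sum_nonneg) auto
    have "(\<Sum>k\<in>TI. (patch_size A k)\<^sup>2) \<le> 81 * (\<Sum>k\<in>TI. (csize (A k))\<^sup>2)"
      by (rule sum_patch_size_square_le[OF fin Az])
    also have "\<dots> \<le> 81 * (\<Sum>k\<in>TI. Eg k)"
    proof (intro mult_left_mono sum_mono)
      fix k
      have "8 * (csize (A k))\<^sup>2 \<le> 5 * Eg k" using csize_square_le[of "A k"] by (simp only: Eg_def)
      then show "(csize (A k))\<^sup>2 \<le> Eg k" using Eg0[of k] by linarith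
    qed simp
    also have "\<dots> = (9 * h * h_seminorm T w)\<^sup>2"
      unfolding h_seminorm_def power_mult_distrib real_sqrt_pow2[OF sn0] using h by (simp add: sn)
    finally have "(\<Sum>k\<in>TI. (patch_size A k)\<^sup>2) \<le> (9 * h * h_seminorm T w)\<^sup>2" .
    then show "L2_set (patch_size A) TI \<le> 9 * h * h_seminorm T w"
      unfolding L2_set_def using h sn0 by (intro real_le_lsqrt) (auto simp: h_seminorm_def sum_nonneg)
    show "0 \<le> 9 * h * h_seminorm T w" using h sn0 by (simp add: h_seminorm_def)
    \<comment> \<open>The load norm becomes a sixth entry after the five norms of fourth
      derivatives, so that one Cauchy-Schwarz inequality covers all of them.\<close>
    define Y where "Y k i = (if i < 5 then L2_norm (?cell k) (t i) else L2_norm (?cell k) f)" for k and i :: nat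
    have XY: "X k = (\<Sum>i<6. Y k i)" "(\<Sum>i<6. (Y k i)\<^sup>2) = (L2_norm (?cell k) f)\<^sup>2 + (\<Sum>i<5. (L2_norm (?cell k) (t i))\<^sup>2)" for k
      by (simp_all add: X_def Y_def eval_nat_numeral)
    have "(\<Sum>k\<in>TI. (X k)\<^sup>2) \<le> (\<Sum>k\<in>TI. 6 * ((L2_norm (?cell k) f)\<^sup>2 + (\<Sum>i<5. (L2_norm (?cell k) (t i))\<^sup>2)))"
    proof (rule sum_mono)
      fix k
      have "(X k)\<^sup>2 \<le> (\<Sum>i<6. (Y k i)\<^sup>2) * card {..<6::nat}" unfolding XY(1) by (rule sum_squared_le_sum_of_squares)
      then show "(X k)\<^sup>2 \<le> 6 * ((L2_norm (?cell k) f)\<^sup>2 + (\<Sum>i<5. (L2_norm (?cell k) (t i))\<^sup>2))" unfolding XY(2) by simp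
    qed
    also have "\<dots> = 6 * ((L2_norm \<Omega> f)\<^sup>2 + (\<Sum>i<5. (L2_norm \<Omega> (t i))\<^sup>2))"
    proof -
      have "(\<Sum>k\<in>TI. \<Sum>i<5. (L2_norm (?cell k) (t i))\<^sup>2) = (\<Sum>i<5. (L2_norm \<Omega> (t i))\<^sup>2)"
        by (subst sum.swap) (use sum_cell_norms[OF up op ic grid TI t(2)] in simp)
      then show ?thesis unfolding sum_distrib_left[symmetric] sum.distrib
        using sum_cell_norms[OF up op ic grid TI f] by simp
    qed
    also have "\<dots> = 6 * ((L2_norm \<Omega> f)\<^sup>2 + (sobolev_seminorm 4 \<Omega> u)\<^sup>2)"
      unfolding sobolev_seminorm4 t_def ..
    also have "\<dots> \<le> (3 * (L2_norm \<Omega> f + sobolev_seminorm 4 \<Omega> u))\<^sup>2"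
    proof -
      have "L2_norm \<Omega> f \<ge> 0" "sobolev_seminorm 4 \<Omega> u \<ge> 0"
        by (simp_all add: L2_norm_nonneg sobolev_seminorm_def sum_nonneg)
      then show ?thesis by (simp add: power2_eq_square algebra_simps)
    qed
    finally have "(\<Sum>k\<in>TI. (X k)\<^sup>2) \<le> (3 * (L2_norm \<Omega> f + sobolev_seminorm 4 \<Omega> u))\<^sup>2" .
    then show "L2_set X TI \<le> 3 * (L2_norm \<Omega> f + sobolev_seminorm 4 \<Omega> u)"
      unfolding L2_set_def by (intro real_le_lsqrt) (auto simp: L2_norm_nonneg sobolev_seminorm_def sum_nonneg)
  qed (use C(1) h in \<open>auto simp: L2_set_nonneg\<close>)
  also have "\<dots> = 162 * C * h\<^sup>2 * (L2_norm \<Omega> f + sobolev_seminorm 4 \<Omega> u) * h_seminorm T w"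
    by (simp add: power2_eq_square)
  finally show ?thesis unfolding E .
qed

theorem theorem3p4:
  fixes \<Omega> :: "(real^2) set"
  assumes "bounded \<Omega>" and "lipschitz_domain \<Omega>"
  shows "\<exists>C>0. \<forall>h T f u w\<^sub>h.
    uniform_partition \<Omega> h T \<longrightarrow>
    L2 \<Omega> f \<longrightarrow>
    u \<in> sobolev0 2 \<Omega> \<longrightarrow>
    (\<forall>v \<in> sobolev0 2 \<Omega>. a_form \<Omega> u v = L2_inner \<Omega> f v) \<longrightarrow>
    u \<in> sobolev 4 \<Omega> \<longrightarrow>
    w\<^sub>h \<in> morley_space \<Omega> T \<longrightarrow>
    ah_form T u w\<^sub>h - L2_inner \<Omega> f w\<^sub>h
      \<le> C * h\<^sup>2 * (L2_norm \<Omega> f + sobolev_seminorm 4 \<Omega> u) * h_seminorm T w\<^sub>h"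
proof -
  from local_functional_bound obtain C where C: "C \<ge> 0" "\<And>h c s t f M a p q. cell_data h c s t f \<Longrightarrow>
    \<bar>a 2 0\<bar> \<le> M \<and> \<bar>a 1 1\<bar> \<le> M \<and> \<bar>a 0 2\<bar> \<le> M \<and> \<bar>a 3 0\<bar> \<le> M \<and> \<bar>a 0 3\<bar> \<le> M \<Longrightarrow>
    (\<forall>b1 b2. \<bar>p b1 b2 - a 1 0\<bar> \<le> M \<and> \<bar>q b1 b2 - a 0 1\<bar> \<le> M) \<Longrightarrow>
    \<bar>local_functional (cell_residual h c s f) a (corner_value a) p q
     (\<lambda>b. flux1 a b - (p b False + p b True) / 2) (\<lambda>b. flux2 a b - (q False b + q True b) / 2)\<bar>
    \<le> C * M * h * (L2_norm (cell h c) f + (\<Sum>i<5. L2_norm (cell h c) (t i)))" by blast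
  have C': "C + 1 \<ge> 0" using C(1) by simp
  have CC: "162 * C * x * y * z \<le> (162 * C + 1) * x * y * z" if "x \<ge> 0" "y \<ge> 0" "z \<ge> 0" for x y z :: real
    using that by (simp add: distrib_right)
  show ?thesis
  \<comment> \<open>The constant has to be positive, while \<open>C\<close> may be zero.\<close>
  proof (intro exI[of _ "162 * C + 1"] conjI allI impI)
    show "162 * C + 1 > 0" using C(1) by simp
    fix h T f u w
    assume a: "uniform_partition \<Omega> h T" "L2 \<Omega> f" "u \<in> sobolev0 2 \<Omega>"
      "\<forall>v \<in> sobolev0 2 \<Omega>. a_form \<Omega> u v = L2_inner \<Omega> f v" "u \<in> sobolev 4 \<Omega>" "w \<in> morley_space \<Omega> T"
    have "ah_form T u w - L2_inner \<Omega> f w \<le> 162 * C * h\<^sup>2 * (L2_norm \<Omega> f + sobolev_seminorm 4 \<Omega> u) * h_seminorm T w"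
      by (rule consistency_error_bound[OF C assms(2) a(1,2,4-6)])
    also have "\<dots> \<le> (162 * C + 1) * h\<^sup>2 * (L2_norm \<Omega> f + sobolev_seminorm 4 \<Omega> u) * h_seminorm T w"
    proof (rule CC)
      show "0 \<le> L2_norm \<Omega> f + sobolev_seminorm 4 \<Omega> u"
        by (simp add: L2_norm_nonneg sobolev_seminorm_def sum_nonneg)
      show "0 \<le> h_seminorm T w"
        unfolding h_seminorm_def ah_form_def a_form_def
        by (intro real_sqrt_ge_zero sum_nonneg Bochner_Integration.integral_nonneg) simp
    qed simp
    finally show "ah_form T u w - L2_inner \<Omega> f w
      \<le> (162 * C + 1) * h\<^sup>2 * (L2_norm \<Omega> f + sobolev_seminorm 4 \<Omega> u) * h_seminorm T w" .
  qed
qed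

end
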